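(* Let $N\ge2$, $m\ge0$, $r,\alpha\in(0,1)$, $p\in(2,2^* )$, and assume $$p>\frac{N-1-r^2\alpha^2}{\kappa(r,m)}+2,$$ where $$\kappa(r,m)=\begin{cases}mr^2+\max\Bigl\{\bigl(\tfrac{N-2}{2}\bigr)^2,\ \bigl(\tfrac{\pi}{1-r}\bigr)^2r^{N-1}\Bigr\},&N\ge3,\\[4pt] mr^2+\bigl(\tfrac{\pi}{1-r}\bigr)^2r^{N},&N=2.\end{cases}$$ Then every ground state solution of $$-\Delta u+\alpha^2\partial_\theta^2u+mu=|u|^{p-2}u\ \text{ in }\mathbf A_r,\qquad u=0\ \text{ on }\partial\mathbf A_r\qquad(\ast)$$ is $x_1$-$x_2$-nonradial.
   Context: $\mathbf A_r=\{x\in\mathbb R^N:r<|x|<1\}$. $2^*=\frac{2N}{N-2}$ for $N\ge3$, $2^*=\infty$ for $N=2$. $\partial_\theta=x_1\partial_{x_2}-x_2\partial_{x_1}$. Functions are real-valued. For $u\in H_0^1(\mathbf A_r)\setminus\{0\}$, $$R_{\alpha,m,p}(u)=\frac{\int_{\mathbf A_r}(|\nabla u|^2-\alpha^2|\partial_\theta u|^2+mu^2)\,dx}{\bigl(\int_{\mathbf A_r}|u|^p\,dx\bigr)^{2/p}},\qquad\mathscr C_{\alpha,m,p}(\mathbf A_r)=\inf_{u\in H_0^1(\mathbf A_r)\setminus\{0\}}R_{\alpha,m,p}(u).$$ A ground state solution of $(\ast)$ is a weak solution $u\in H_0^1(\mathbf A_r)\setminus\{0\}$ with $R_{\alpha,m,p}(u)=\mathscr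 C_{\alpha,m,p}(\mathbf A_r)$. For $\theta\in\mathbb R$ let $R_\theta(x)=(x_1\cos\theta+x_2\sin\theta,-x_1\sin\theta+x_2\cos\theta,x_3,\dots,x_N)$. A function $u$ on $\mathbf A_r$ is $x_1$-$x_2$-nonradial if $u\circ R_\theta\ne u$ for at least one $\theta\in\mathbb R$. *)

theory Defs
  imports "HOL-Analysis.Analysis" "HOL-Library.Extended_Real"
begin

section \<open>Smooth functions with compact support\<close>

definition partial_deriv :: "'n::finite \<Rightarrow> (real^'n \<Rightarrow> real) \<Rightarrow> real^'n \<Rightarrow> real" where
  "partial_deriv k f x = frechet_derivative f (at x) (axis k 1)"

primrec C_class :: "nat \<Rightarrow> (real^'n::finite \<Rightarrow> real) \<Rightarrow> bool" where
  "C_class 0 f \<longleftrightarrow> continuous_on UNIV f"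
| "C_class (Suc l) f \<longleftrightarrow>
     (\<forall>x. f differentiable (at x)) \<and> (\<forall>k. C_class l (partial_deriv k f))"

definition test_functions :: "(real^'n::finite) set \<Rightarrow> (real^'n \<Rightarrow> real) set" where
  "test_functions S =
     {\<phi>. (\<forall>l. C_class l \<phi>) \<and> compact (closure {x. \<phi> x \<noteq> 0}) \<and> closure {x. \<phi> x \<noteq> 0} \<subseteq> S}"


section \<open>Sobolev spaces\<close>

text \<open>
  Elements of the function spaces on \<open>S\<close> (an open set) are represented by total functions; only
  their values almost everywhere on \<open>S\<close> are relevant, so that equality is equality almost
  everywhere with respect to \<^term>\<open>lebesgue_on S\<close>.
\<close>

definition square_integrable :: "(real^'n::finite) set \<Rightarrow> (real^'n \<Rightarrow> real) \<Rightarrow> bool" where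
  "square_integrable S f \<longleftrightarrow>
     f \<in> borel_measurable (lebesgue_on S) \<and> integrable (lebesgue_on S) (\<lambda>x. (f x)\<^sup>2)"

definition ae_zero :: "(real^'n::finite) set \<Rightarrow> (real^'n \<Rightarrow> real) \<Rightarrow> bool" where
  "ae_zero S u \<longleftrightarrow> (AE x in lebesgue_on S. u x = 0)"

definition has_weak_gradient ::
  "(real^'n::finite) set \<Rightarrow> (real^'n \<Rightarrow> real) \<Rightarrow> (real^'n \<Rightarrow> real^'n) \<Rightarrow> bool" where
  "has_weak_gradient S u g \<longleftrightarrow>
     (\<forall>k. square_integrable S (\<lambda>x. g x $ k)) \<and>
     (\<forall>\<phi>\<in>test_functions S. \<forall>k.
        (LINT x|lebesgue_on S. u x * partial_deriv k \<phi> x) = - (LINT x|lebesgue_on S. g x $ k * \<phi> x))"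

text \<open>The weak gradient is unique only up to null sets; all uses below are insensitive to the choice.\<close>

definition weak_grad :: "(real^'n::finite) set \<Rightarrow> (real^'n \<Rightarrow> real) \<Rightarrow> real^'n \<Rightarrow> real^'n" where
  "weak_grad S u = (SOME g. has_weak_gradient S u g)"

definition H1 :: "(real^'n::finite) set \<Rightarrow> (real^'n \<Rightarrow> real) set" where
  "H1 S = {u. square_integrable S u \<and> (\<exists>g. has_weak_gradient S u g)}"

definition H1_norm :: "(real^'n::finite) set \<Rightarrow> (real^'n \<Rightarrow> real) \<Rightarrow> real" where
  "H1_norm S u = sqrt (LINT x|lebesgue_on S. (u x)\<^sup>2 + (norm (weak_grad S u x))\<^sup>2)"

text \<open>The closure of the test functions in \<^term>\<open>H1 S\<close>.\<close>

definition H10 :: "(real^'n::finite) set \<Rightarrow> (real^'n \<Rightarrow> real) set" where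
  "H10 S = {u \<in> H1 S. \<forall>\<epsilon>>0. \<exists>\<phi>\<in>test_functions S. H1_norm S (\<lambda>x. u x - \<phi> x) < \<epsilon>}"


section \<open>The annulus and rotations\<close>

text \<open>
  The dimension is \<open>N = CARD('n)\<close>. As the index type \<open>'n\<close> is not ordered, two distinct indices
  \<open>i\<close> and \<open>j\<close> play the roles of the first and the second coordinate.
\<close>

definition annulus :: "real \<Rightarrow> (real^'n::finite) set" where
  "annulus r = {x. r < norm x \<and> norm x < 1}"

definition weak_angular_deriv ::
  "'n::finite \<Rightarrow> 'n \<Rightarrow> (real^'n) set \<Rightarrow> (real^'n \<Rightarrow> real) \<Rightarrow> real^'n \<Rightarrow> real" where
  "weak_angular_deriv i j S u x = x $ i * weak_grad S u x $ j - x $ j * weak_grad S u x $ i"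

definition plane_rotation :: "'n::finite \<Rightarrow> 'n \<Rightarrow> real \<Rightarrow> real^'n \<Rightarrow> real^'n" where
  "plane_rotation i j \<theta> x =
     (\<chi> k. if k = i then x $ i * cos \<theta> + x $ j * sin \<theta>
          else if k = j then - x $ i * sin \<theta> + x $ j * cos \<theta>
          else x $ k)"

definition plane_nonradial ::
  "'n::finite \<Rightarrow> 'n \<Rightarrow> (real^'n) set \<Rightarrow> (real^'n \<Rightarrow> real) \<Rightarrow> bool" where
  "plane_nonradial i j S u \<longleftrightarrow>
     (\<exists>\<theta>. \<not> (AE x in lebesgue_on S. u (plane_rotation i j \<theta> x) = u x))"


section \<open>Ground states\<close>

definition rayleigh ::
  "'n::finite \<Rightarrow> 'n \<Rightarrow> (real^'n) set \<Rightarrow> real \<Rightarrow> real \<Rightarrow> real \<Rightarrow> (real^'n \<Rightarrow> real) \<Rightarrow> real" where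
  "rayleigh i j S \<alpha> m p u =
     (LINT x|lebesgue_on S.
        (norm (weak_grad S u x))\<^sup>2 - \<alpha>\<^sup>2 * (weak_angular_deriv i j S u x)\<^sup>2 + m * (u x)\<^sup>2)
     / (LINT x|lebesgue_on S. \<bar>u x\<bar> powr p) powr (2 / p)"

text \<open>
  For \<open>S\<close> an annulus in the unit ball, \<open>\<bar>\<alpha>\<bar> \<le> 1\<close> and \<open>m \<ge> 0\<close>, the quotient is nonnegative, so the
  infimum is taken over a set of reals that is bounded below.
\<close>

definition ground_level ::
  "'n::finite \<Rightarrow> 'n \<Rightarrow> (real^'n) set \<Rightarrow> real \<Rightarrow> real \<Rightarrow> real \<Rightarrow> real" where
  "ground_level i j S \<alpha> m p = (INF u\<in>{u \<in> H10 S. \<not> ae_zero S u}. rayleigh i j S \<alpha> m p u)"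

definition weak_solution ::
  "'n::finite \<Rightarrow> 'n \<Rightarrow> (real^'n) set \<Rightarrow> real \<Rightarrow> real \<Rightarrow> real \<Rightarrow> (real^'n \<Rightarrow> real) \<Rightarrow> bool" where
  "weak_solution i j S \<alpha> m p u \<longleftrightarrow>
     u \<in> H10 S \<and>
     (\<forall>v\<in>H10 S.
        (LINT x|lebesgue_on S.
           weak_grad S u x \<bullet> weak_grad S v x
           - \<alpha>\<^sup>2 * (weak_angular_deriv i j S u x * weak_angular_deriv i j S v x)
           + m * (u x * v x))
        = (LINT x|lebesgue_on S. \<bar>u x\<bar> powr (p - 2) * u x * v x))"

definition ground_state ::
  "'n::finite \<Rightarrow> 'n \<Rightarrow> (real^'n) set \<Rightarrow> real \<Rightarrow> real \<Rightarrow> real \<Rightarrow> (real^'n \<Rightarrow> real) \<Rightarrow> bool" where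
  "ground_state i j S \<alpha> m p u \<longleftrightarrow>
     weak_solution i j S \<alpha> m p u \<and> \<not> ae_zero S u \<and>
     rayleigh i j S \<alpha> m p u = ground_level i j S \<alpha> m p"


section \<open>Exponents\<close>

definition critical_exponent :: "nat \<Rightarrow> ereal" where
  "critical_exponent N = (if N \<ge> 3 then ereal (2 * real N / (real N - 2)) else \<infinity>)"

definition kappa :: "nat \<Rightarrow> real \<Rightarrow> real \<Rightarrow> real" where
  "kappa N r m =
     (if N \<ge> 3
      then m * r\<^sup>2 + max (((real N - 2) / 2)\<^sup>2) ((pi / (1 - r))\<^sup>2 * r ^ (N - 1))
      else m * r\<^sup>2 + (pi / (1 - r))\<^sup>2 * r ^ N)"

end

theory Submission
  imports Defs
begin

text \<open>
  Suppose that a ground state \<open>u\<close> is invariant under all rotations of the \<open>i\<close>-\<open>j\<close>-plane. Write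
  \<open>L\<^sub>a\<^sub>b = x\<^sub>a \<partial>\<^sub>b - x\<^sub>b \<partial>\<^sub>a\<close> for the angular derivative in the \<open>a\<close>-\<open>b\<close>-plane and \<open>Y\<^sub>a = x\<^sub>a / |x|\<close> for the first
  spherical harmonics. The proof derives an upper bound for \<open>p\<close> from the second variation of the
  Rayleigh quotient in the directions \<open>u Y\<^sub>a\<close>.

  Invariance gives \<open>L\<^sub>i\<^sub>j u = 0\<close>, so the term with \<open>\<alpha>\<close> drops out of the quotient of \<open>u\<close>. A permutation of
  the coordinates maps the annulus to itself and turns \<open>L\<^sub>i\<^sub>j\<close> into an arbitrary \<open>L\<^sub>a\<^sub>b\<close>. Therefore
  \<open>u\<close> competes with all quotients in which \<open>L\<^sub>i\<^sub>j\<close> is replaced by \<open>L\<^sub>a\<^sub>b\<close>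
  (\<open>ground_level_le_rayleigh\<close>), and if \<open>L\<^sub>a\<^sub>b u\<close> did not vanish, the \<open>a\<close>-\<open>b\<close>-quotient of \<open>u\<close> would be
  below the minimum. Hence \<open>L\<^sub>a\<^sub>b u = 0\<close> for all \<open>a\<close>, \<open>b\<close> (\<open>ground_state_angular_zero\<close>); this is the
  infinitesimal form of radiality.

  Since \<open>L\<^sub>a\<^sub>b Y\<^sub>b = Y\<^sub>a\<close>, integration by parts shows that \<open>|u|^p\<close> is orthogonal to every \<open>Y\<^sub>a\<close>
  (\<open>abs_powr_pairing\<close>), so the first variation in direction \<open>u Y\<^sub>a\<close> vanishes and the second one is
  nonnegative:
  \<open>(p - 1) \<integral> |u|^p Y\<^sub>a\<^sup>2 \<le> \<integral> |\<nabla>(u Y\<^sub>a)|\<^sup>2 - \<alpha>\<^sup>2 u\<^sup>2 Y\<^sub>b\<^sup>2 + m u\<^sup>2 Y\<^sub>a\<^sup>2\<close> for \<open>a \<noteq> b\<close> (\<open>second_variation\<close>).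
  Summing over all pairs, with \<open>\<Sum> Y\<^sub>a\<^sup>2 = 1\<close>, \<open>\<Sum> |\<nabla>(u Y\<^sub>a)|\<^sup>2 = |\<nabla>u|\<^sup>2 + (N - 1) u\<^sup>2 / |x|\<^sup>2\<close> and the identity
  \<open>\<integral> |u|^p = \<integral> |\<nabla>u|\<^sup>2 + m u\<^sup>2\<close>, yields
  \<open>(p - 2) \<integral> (|\<nabla>u|\<^sup>2 + m u\<^sup>2) \<le> (N - 1) \<integral> u\<^sup>2 / |x|\<^sup>2 - \<alpha>\<^sup>2 \<integral> u\<^sup>2 \<le> (N - 1 - r\<^sup>2 \<alpha>\<^sup>2) \<integral> u\<^sup>2 / |x|\<^sup>2\<close>.
  The number \<open>kappa\<close> is a constant in the Hardy-Poincare inequality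
  \<open>kappa \<integral> u\<^sup>2 / |x|\<^sup>2 \<le> \<integral> |\<nabla>u|\<^sup>2 + m u\<^sup>2\<close> (\<open>H10_kappa\<close>), so \<open>(p - 2) kappa \<le> N - 1 - r\<^sup>2 \<alpha>\<^sup>2\<close>, against the
  hypothesis on \<open>p\<close>.

  The integral of \<open>|u|^p\<close> is finite: otherwise its value as a Bochner integral
  would be \<open>0\<close>; the equation tested with \<open>u\<close> would give
  \<open>\<integral> |\<nabla>u|\<^sup>2 + m u\<^sup>2 = 0\<close>, and \<open>u\<close> would vanish by the Hardy-Poincare inequality.

  Everything that concerns weak gradients rests on two facts about test functions: there are enough of
  them to make weak gradients unique (\<open>fundamental_lemma\<close>), and the integral of a partial derivative of a
  compactly supported function of class \<open>C\<^sup>1\<close> vanishes (\<open>integral_partial_deriv_Cc\<close>).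
\<close>

section \<open>Functions of class C^l on an open set\<close>

text \<open>
  The local version of \<^const>\<open>C_class\<close>. It makes it possible to multiply test functions by functions
  such as \<open>x\<^sub>a / |x|\<close>, which are smooth on the annulus only, and to glue the product with zero.
\<close>

primrec smooth_on :: "nat \<Rightarrow> (real^'n::finite) set \<Rightarrow> (real^'n \<Rightarrow> real) \<Rightarrow> bool" where
  "smooth_on 0 S f \<longleftrightarrow> continuous_on S f"
| "smooth_on (Suc l) S f \<longleftrightarrow>
     (\<forall>x\<in>S. f differentiable (at x)) \<and> (\<forall>k. smooth_on l S (partial_deriv k f))"

lemma C_class_iff_smooth_on: "C_class l f \<longleftrightarrow> smooth_on l UNIV f"
  by (induction l arbitrary: f) auto

definition grad :: "(real^'n::finite \<Rightarrow> real) \<Rightarrow> real^'n \<Rightarrow> real^'n" where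
  "grad f x = (\<chi> k. partial_deriv k f x)"

lemma grad_nth [simp]: "grad f x $ k = partial_deriv k f x"
  by (simp add: grad_def)

lemma partial_deriv_eq:
  "(f has_derivative f') (at x) \<Longrightarrow> partial_deriv k f x = f' (axis k 1)"
  unfolding partial_deriv_def using frechet_derivative_at by metis

lemma grad_eq:
  assumes "(f has_derivative (\<lambda>h. v \<bullet> h)) (at x)"
  shows "grad f x = v" "partial_deriv k f x = v $ k"
  using partial_deriv_eq[OF assms] by (simp_all add: vec_eq_iff inner_axis)

lemma has_derivative_grad:
  assumes "f differentiable (at x)"
  shows "(f has_derivative (\<lambda>h. grad f x \<bullet> h)) (at x)"
proof -
  let ?D = "frechet_derivative f (at x)"
  have D: "(f has_derivative ?D) (at x)"
    using assms by (simp add: frechet_derivative_works)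
  then have lin: "linear ?D" by (rule has_derivative_linear)
  have "?D h = grad f x \<bullet> h" for h
  proof -
    have "?D h = ?D (\<Sum>k\<in>UNIV. (h $ k) *\<^sub>R axis k 1)"
      using basis_expansion[of h] by (simp add: scalar_mult_eq_scaleR)
    also have "\<dots> = (\<Sum>k\<in>UNIV. h $ k * partial_deriv k f x)"
      by (simp add: linear_sum[OF lin] linear_cmul[OF lin] partial_deriv_def)
    also have "\<dots> = grad f x \<bullet> h"
      by (simp add: inner_vec_def mult.commute)
    finally show ?thesis .
  qed
  then have "?D = (\<lambda>h. grad f x \<bullet> h)" by blast
  with D show ?thesis by simp
qed

lemma partial_deriv_cong_open:
  assumes "open S" "x \<in> S" "\<And>y. y \<in> S \<Longrightarrow> f y = g y"
  shows "partial_deriv k f x = partial_deriv k g x"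
    "f differentiable (at x) \<longleftrightarrow> g differentiable (at x)"
proof -
  have *: "(f has_derivative D) (at x) \<longleftrightarrow> (g has_derivative D) (at x)" for D
    using has_derivative_transform_within_open[OF _ assms(1,2), of _ D UNIV] assms(3)
    by (metis)
  show "partial_deriv k f x = partial_deriv k g x"
    unfolding partial_deriv_def frechet_derivative_def using * by simp
  show "f differentiable (at x) \<longleftrightarrow> g differentiable (at x)"
    unfolding differentiable_def using * by simp
qed

lemma smooth_on_cong:
  assumes "open S" "\<And>y. y \<in> S \<Longrightarrow> f y = g y"
  shows "smooth_on l S f \<longleftrightarrow> smooth_on l S g"
  using assms(2)
proof (induction l arbitrary: f g)
  case 0
  then show ?case by (auto cong: continuous_on_cong)
next
  case (Suc l)
  have "smooth_on l S (partial_deriv k f) \<longleftrightarrow> smooth_on l S (partial_deriv k g)" for k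
    by (rule Suc.IH) (rule partial_deriv_cong_open(1)[OF assms(1)], auto intro: Suc.prems)
  moreover have "f differentiable (at x) \<longleftrightarrow> g differentiable (at x)" if "x \<in> S" for x
    by (rule partial_deriv_cong_open(2)[OF assms(1) that]) (rule Suc.prems)
  ultimately show ?case by simp
qed

lemma smooth_on_subset: "smooth_on l S f \<Longrightarrow> T \<subseteq> S \<Longrightarrow> smooth_on l T f"
  by (induction l arbitrary: f) (auto intro: continuous_on_subset)

lemma smooth_on_Un:
  "open S \<Longrightarrow> open T \<Longrightarrow> smooth_on l S f \<Longrightarrow> smooth_on l T f \<Longrightarrow> smooth_on l (S \<union> T) f"
  by (induction l arbitrary: f) (auto intro: continuous_on_open_Un)

lemma smooth_on_SucD: "smooth_on (Suc l) S f \<Longrightarrow> smooth_on l S f"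
proof (induction l arbitrary: f)
  case 0
  then show ?case
    by (auto intro!: continuous_at_imp_continuous_on differentiable_imp_continuous_within)
qed auto

lemma smooth_on_imp_continuous_on: "smooth_on l S f \<Longrightarrow> continuous_on S f"
proof (induction l)
  case (Suc l)
  then show ?case using smooth_on_SucD by blast
qed auto

lemma smooth_on_imp_continuous_partial:
  "smooth_on (Suc l) S f \<Longrightarrow> continuous_on S (partial_deriv k f)"
  using smooth_on_imp_continuous_on[of l S "partial_deriv k f"] by simp

lemma partial_deriv_const [simp]: "partial_deriv k (\<lambda>x. c) = (\<lambda>x. 0)"
  by (simp add: partial_deriv_def fun_eq_iff)

lemma smooth_on_const [simp]: "smooth_on l S (\<lambda>x. c)"
  by (induction l arbitrary: c) auto

lemma has_derivative_component: "((\<lambda>x::real^'n::finite. x $ a) has_derivative (\<lambda>h. axis a 1 \<bullet> h)) (at x)"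
  by (simp add: inner_axis' bounded_linear_imp_has_derivative bounded_linear_vec_nth)

lemma partial_deriv_component [simp]:
  "partial_deriv k (\<lambda>x::real^'n::finite. x $ a) = (\<lambda>x. if k = a then 1 else 0)"
  using grad_eq(2)[OF has_derivative_component, of k a] by (auto simp: fun_eq_iff axis_def)

lemma smooth_on_component [simp]: "smooth_on l S (\<lambda>x. x $ a)"
proof (cases l)
  case (Suc l')
  have "(\<lambda>x::real^'a. x $ a) differentiable (at x)" for x
    using has_derivative_component differentiable_def by blast
  with Suc show ?thesis by simp
qed (auto intro!: continuous_intros)

lemma partial_deriv_add:
  assumes "f differentiable (at x)" "g differentiable (at x)"
  shows "partial_deriv k (\<lambda>x. f x + g x) x = partial_deriv k f x + partial_deriv k g x"
  using partial_deriv_eq[OF has_derivative_add[OF has_derivative_grad[OF assms(1)] has_derivative_grad[OF assms(2)]]]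
  by (simp add: inner_axis)

lemma partial_deriv_mult:
  assumes "f differentiable (at x)" "g differentiable (at x)"
  shows "partial_deriv k (\<lambda>x. f x * g x) x = f x * partial_deriv k g x + partial_deriv k f x * g x"
  using partial_deriv_eq[OF has_derivative_mult[OF has_derivative_grad[OF assms(1)] has_derivative_grad[OF assms(2)]]]
  by (simp add: inner_axis)

lemma smooth_on_add:
  assumes "open S" "smooth_on l S f" "smooth_on l S g"
  shows "smooth_on l S (\<lambda>x. f x + g x)"
  using assms(2,3)
proof (induction l arbitrary: f g)
  case 0
  then show ?case by (auto intro: continuous_intros)
next
  case (Suc l)
  have "smooth_on l S (partial_deriv k (\<lambda>x. f x + g x))" for k
  proof (subst smooth_on_cong[OF assms(1)])
    show "\<And>x. x \<in> S \<Longrightarrow> partial_deriv k (\<lambda>x. f x + g x) x = partial_deriv k f x + partial_deriv k g x"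
      using Suc.prems by (intro partial_deriv_add) auto
    show "smooth_on l S (\<lambda>x. partial_deriv k f x + partial_deriv k g x)"
      using Suc.prems by (intro Suc.IH) auto
  qed
  then show ?case using Suc.prems by auto
qed

lemma smooth_on_mult:
  assumes "open S" "smooth_on l S f" "smooth_on l S g"
  shows "smooth_on l S (\<lambda>x. f x * g x)"
  using assms(2,3)
proof (induction l arbitrary: f g)
  case 0
  then show ?case by (auto intro: continuous_intros)
next
  case (Suc l)
  have "smooth_on l S (partial_deriv k (\<lambda>x. f x * g x))" for k
  proof (subst smooth_on_cong[OF assms(1)])
    show "\<And>x. x \<in> S \<Longrightarrow> partial_deriv k (\<lambda>x. f x * g x) x
            = f x * partial_deriv k g x + partial_deriv k f x * g x"
      using Suc.prems by (intro partial_deriv_mult) auto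
    show "smooth_on l S (\<lambda>x. f x * partial_deriv k g x + partial_deriv k f x * g x)"
      using Suc.prems smooth_on_SucD[OF Suc.prems(1)] smooth_on_SucD[OF Suc.prems(2)]
      by (intro smooth_on_add[OF assms(1)] Suc.IH) auto
  qed
  then show ?case using Suc.prems by auto
qed

lemma smooth_on_uminus:
  assumes "open S" "smooth_on l S f"
  shows "smooth_on l S (\<lambda>x. - f x)"
  using smooth_on_mult[OF assms(1) smooth_on_const[where c = "-1"] assms(2)] by simp

lemma smooth_on_diff:
  assumes "open S" "smooth_on l S f" "smooth_on l S g"
  shows "smooth_on l S (\<lambda>x. f x - g x)"
  using smooth_on_add[OF assms(1,2) smooth_on_uminus[OF assms(1,3)]] by simp

lemma smooth_on_prod:
  assumes "open S" "finite A" "\<And>a. a \<in> A \<Longrightarrow> smooth_on l S (f a)"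
  shows "smooth_on l S (\<lambda>x. \<Prod>a\<in>A. f a x)"
  using assms(2,3) by (induction A) (auto intro: smooth_on_mult[OF assms(1)])

lemma smooth_on_1I:
  assumes "open S" "\<And>x. x \<in> S \<Longrightarrow> (f has_derivative (\<lambda>h. v x \<bullet> h)) (at x)"
    "\<And>k. continuous_on S (\<lambda>x. v x $ k)"
  shows "smooth_on 1 S f"
proof -
  have "smooth_on 0 S (partial_deriv k f)" for k
    using smooth_on_cong[OF assms(1), of "partial_deriv k f" "\<lambda>x. v x $ k" 0] grad_eq(2)[OF assms(2)]
      assms(3) by auto
  then show ?thesis using assms(2) by (auto simp: differentiable_def)
qed

lemma has_derivative_norm_inner:
  fixes x :: "real^'n::finite"
  assumes "x \<noteq> 0"
  shows "(norm has_derivative (\<lambda>h. (x /\<^sub>R norm x) \<bullet> h)) (at x)"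
  using has_derivative_norm[OF assms] by (simp add: sgn_div_norm inner_commute)

lemma has_derivative_radial:
  fixes x :: "real^'n::finite"
  assumes "x \<noteq> 0" "(q has_real_derivative d) (at (norm x))"
  shows "((\<lambda>x. q (norm x)) has_derivative (\<lambda>h. ((d / norm x) *\<^sub>R x) \<bullet> h)) (at x)"
proof -
  have "((\<lambda>x. q (norm x)) has_derivative (\<lambda>h. d * ((x /\<^sub>R norm x) \<bullet> h))) (at x)"
    using has_derivative_compose[OF has_derivative_norm_inner[OF assms(1)], of q "(*) d"] assms(2)
    by (simp add: has_field_derivative_def)
  then show ?thesis by (simp add: divide_inverse mult.assoc)
qed

lemma partial_deriv_inverse_norm:
  fixes x :: "real^'n::finite"
  assumes "x \<noteq> 0"
  shows "(\<lambda>x. inverse (norm x)) differentiable (at x)"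
    "partial_deriv k (\<lambda>x. inverse (norm x)) x = - (x $ k * (inverse (norm x) * (inverse (norm x) * inverse (norm x))))"
proof -
  have "(inverse has_real_derivative - (inverse (norm x) ^ 2)) (at (norm x))"
    using assms by (auto intro!: derivative_eq_intros simp: power2_eq_square)
  note * = has_derivative_radial[OF assms this]
  show "(\<lambda>x. inverse (norm x)) differentiable (at x)"
    using * differentiable_def by blast
  show "partial_deriv k (\<lambda>x. inverse (norm x)) x = - (x $ k * (inverse (norm x) * (inverse (norm x) * inverse (norm x))))"
    using grad_eq(2)[OF *, of k] by (simp add: field_simps power2_eq_square)
qed

text \<open>
  The partial derivatives of \<open>1 / |x|\<close> are polynomials in \<open>1 / |x|\<close> and the coordinates, so the
  order of smoothness can be raised by one at a time.
\<close>

lemma smooth_on_inverse_norm: "smooth_on l (- {0}) (\<lambda>x::real^'n::finite. inverse (norm x))"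
proof (induction l)
  case 0
  then show ?case by (auto intro!: continuous_intros)
next
  case (Suc l)
  have op: "open (- {0::real^'n})" by (simp add: open_Compl)
  have "smooth_on l (- {0}) (partial_deriv k (\<lambda>x::real^'n. inverse (norm x)))" for k
  proof (subst smooth_on_cong[OF op])
    show "\<And>x. x \<in> - {0} \<Longrightarrow> partial_deriv k (\<lambda>x::real^'n. inverse (norm x)) x
      = - (x $ k * (inverse (norm x) * (inverse (norm x) * inverse (norm x))))"
      by (rule partial_deriv_inverse_norm) simp
  qed (intro smooth_on_uminus smooth_on_mult op Suc smooth_on_component)
  then show ?case by (auto intro: partial_deriv_inverse_norm)
qed

section \<open>Bump functions\<close>

text \<open>
  For \<open>n = 0\<close> this is the standard flat function \<open>exp (- 1 / t)\<close>. The factors \<open>t^(-n)\<close> make the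
  family closed under differentiation up to linear combinations.
\<close>

definition flat :: "nat \<Rightarrow> real \<Rightarrow> real" where
  "flat n t = (if t > 0 then inverse t ^ n * exp (- inverse t) else 0)"

lemma flat_tendsto_0: "((\<lambda>t. inverse t ^ n * exp (- inverse t)) \<longlongrightarrow> 0) (at_right (0::real))"
proof -
  have "((\<lambda>s::real. s ^ n / exp s) \<longlongrightarrow> 0) at_top"
    by (rule tendsto_power_div_exp_0)
  from filterlim_compose[OF this filterlim_inverse_at_top_right]
  show ?thesis by (simp add: exp_minus divide_inverse)
qed

lemma flat_has_derivative:
  "(flat n has_real_derivative (flat (n + 2) t - real n * flat (Suc n) t)) (at t)"
proof (cases t "0::real" rule: linorder_cases)
  case less
  have "((\<lambda>_. 0) has_real_derivative 0) (at t)" by simp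
  then have "(flat n has_real_derivative 0) (at t)"
    by (rule has_field_derivative_transform_within_open[of _ _ _ "{..<0}"]) (use less in \<open>auto simp: flat_def\<close>)
  with less show ?thesis by (simp add: flat_def)
next
  case greater
  have "((\<lambda>t. inverse t ^ n * exp (- inverse t)) has_real_derivative
        (flat (n + 2) t - real n * flat (Suc n) t)) (at t)"
  proof (cases n)
    case 0
    with greater show ?thesis
      by (auto intro!: derivative_eq_intros simp: flat_def power2_eq_square)
  next
    case (Suc m)
    have i: "(inverse has_real_derivative - (inverse t ^ 2)) (at t)"
      using greater by (auto intro!: derivative_eq_intros simp: power2_eq_square)
    have "((\<lambda>t. exp (- inverse t)) has_real_derivative exp (- inverse t) * inverse t ^ 2) (at t)"
      using DERIV_fun_exp[OF DERIV_minus[OF i]] by simp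
    from DERIV_mult[OF DERIV_power_Suc[OF i, of m] this] Suc greater
    show ?thesis by (simp add: flat_def power2_eq_square algebra_simps)
  qed
  then show ?thesis
    by (rule has_field_derivative_transform_within_open[of _ _ _ "{0<..}"]) (use greater in \<open>auto simp: flat_def\<close>)
next
  case equal
  have "((\<lambda>y. (flat n y - flat n 0) / (y - 0)) \<longlongrightarrow> 0) (at 0)"
    unfolding filterlim_at_split
  proof
    show "((\<lambda>y. (flat n y - flat n 0) / (y - 0)) \<longlongrightarrow> 0) (at_left 0)"
      by (rule tendsto_eventually) (auto simp: flat_def eventually_at_left_field intro: exI[of _ "-1"])
    show "((\<lambda>y. (flat n y - flat n 0) / (y - 0)) \<longlongrightarrow> 0) (at_right 0)"
    proof (rule Lim_transform_eventually[OF flat_tendsto_0[of "Suc n"]])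
      show "\<forall>\<^sub>F x in at_right 0. inverse x ^ Suc n * exp (- inverse x) = (flat n x - flat n 0) / (x - 0)"
        by (auto simp: flat_def eventually_at_right_field field_simps intro: exI[of _ "1"])
    qed
  qed
  then show ?thesis
    using equal by (simp add: has_field_derivative_iff flat_def)
qed

lemma has_derivative_flat_affine:
  "((\<lambda>x::real^'n::finite. flat n (c * x $ a + d)) has_derivative
     (\<lambda>h. ((flat (n + 2) (c * x $ a + d) - real n * flat (Suc n) (c * x $ a + d)) * c) *\<^sub>R axis a 1 \<bullet> h)) (at x)"
proof -
  have "((\<lambda>x::real^'n. c * x $ a + d) has_derivative (\<lambda>h. c * (axis a 1 \<bullet> h))) (at x)"
    by (auto intro!: derivative_eq_intros has_derivative_component)
  from has_derivative_compose[OF this flat_has_derivative[unfolded has_field_derivative_def]]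
  show ?thesis by (simp add: mult.assoc)
qed

lemma smooth_on_flat_affine: "smooth_on l UNIV (\<lambda>x::real^'n::finite. flat n (c * x $ a + d))"
proof (induction l arbitrary: n)
  case 0
  have "continuous (at x) (\<lambda>x::real^'n. flat n (c * x $ a + d))" for x
    using has_derivative_flat_affine has_derivative_continuous by blast
  then show ?case by (simp add: continuous_at_imp_continuous_on)
next
  case (Suc l)
  have "partial_deriv k (\<lambda>x::real^'n. flat n (c * x $ a + d)) =
    (\<lambda>x. (if k = a then c else 0) * (flat (n + 2) (c * x $ a + d) - real n * flat (Suc n) (c * x $ a + d)))" for k
  proof
    fix x :: "real^'n"
    show "partial_deriv k (\<lambda>x::real^'n. flat n (c * x $ a + d)) x =
      (if k = a then c else 0) * (flat (n + 2) (c * x $ a + d) - real n * flat (Suc n) (c * x $ a + d))"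
      unfolding grad_eq(2)[OF has_derivative_flat_affine] by (simp add: axis_def)
  qed
  moreover have "smooth_on l UNIV (\<lambda>x. (if k = a then c else 0) *
      (flat (n + 2) (c * x $ a + d) - real n * flat (Suc n) (c * x $ a + d)))" for k
    by (intro smooth_on_mult smooth_on_diff smooth_on_const open_UNIV Suc.IH)
  ultimately show ?case
    using differentiableI[OF has_derivative_flat_affine] by auto
qed

text \<open>
  A product of flat functions that is positive exactly on the box with corners \<open>a\<close> and \<open>b\<close>; the
  scaling by \<open>Suc n\<close> makes it converge to the indicator of the open box.
\<close>

definition box_bump :: "nat \<Rightarrow> real^'n::finite \<Rightarrow> real^'n \<Rightarrow> real^'n \<Rightarrow> real" where
  "box_bump n a b x = (\<Prod>k\<in>UNIV. flat 0 (real (Suc n) * x $ k + - (real (Suc n) * a $ k))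
      * flat 0 (- real (Suc n) * x $ k + real (Suc n) * b $ k))"

lemma box_bump_nonzero_iff: "box_bump n a b x \<noteq> 0 \<longleftrightarrow> x \<in> box a b"
proof -
  have "flat 0 (real (Suc n) * x $ k + - (real (Suc n) * a $ k)) \<noteq> 0 \<longleftrightarrow> a $ k < x $ k" for k
  proof -
    have "real (Suc n) * x $ k + - (real (Suc n) * a $ k) = real (Suc n) * (x $ k - a $ k)"
      by (simp add: algebra_simps)
    then show ?thesis by (simp add: flat_def zero_less_mult_iff del: of_nat_Suc)
  qed
  moreover have "flat 0 (- real (Suc n) * x $ k + real (Suc n) * b $ k) \<noteq> 0 \<longleftrightarrow> x $ k < b $ k" for k
  proof -
    have "- real (Suc n) * x $ k + real (Suc n) * b $ k = real (Suc n) * (b $ k - x $ k)"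
      by (simp add: algebra_simps)
    then show ?thesis by (simp add: flat_def zero_less_mult_iff del: of_nat_Suc)
  qed
  ultimately show ?thesis
    by (auto simp: box_bump_def mem_box_cart)
qed

lemma box_bump_bounds: "0 \<le> box_bump n a b x" "box_bump n a b x \<le> 1"
proof -
  have f: "0 \<le> flat 0 t \<and> flat 0 t \<le> 1" for t by (simp add: flat_def)
  show "0 \<le> box_bump n a b x"
    unfolding box_bump_def by (intro prod_nonneg ballI mult_nonneg_nonneg) (use f in auto)
  show "box_bump n a b x \<le> 1"
    unfolding box_bump_def by (intro prod_le_1 ballI conjI mult_nonneg_nonneg mult_le_one) (use f in auto)
qed

lemma flat_scaled_tendsto:
  assumes "t > 0"
  shows "(\<lambda>n. flat 0 (real (Suc n) * t)) \<longlonglongrightarrow> 1"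
proof -
  have "(\<lambda>n. exp (- (inverse t * inverse (real (Suc n))))) \<longlonglongrightarrow> exp (- (inverse t * 0))"
    by (intro tendsto_intros LIMSEQ_inverse_real_of_nat)
  moreover have "flat 0 (real (Suc n) * t) = exp (- (inverse t * inverse (real (Suc n))))" for n
    using assms by (simp add: flat_def)
  ultimately show ?thesis by simp
qed

lemma box_bump_tendsto: "(\<lambda>n. box_bump n a b x) \<longlonglongrightarrow> indicator (box a b) x"
proof (cases "x \<in> box a b")
  case True
  then have pos: "x $ k - a $ k > 0" "b $ k - x $ k > 0" for k by (auto simp: mem_box_cart)
  have "(\<lambda>n. \<Prod>k\<in>(UNIV::'a set). flat 0 (real (Suc n) * (x $ k - a $ k)) * flat 0 (real (Suc n) * (b $ k - x $ k)))
      \<longlonglongrightarrow> (\<Prod>k\<in>(UNIV::'a set). 1 * 1)"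
    by (intro tendsto_prod tendsto_mult flat_scaled_tendsto pos)
  moreover have "box_bump n a b x = (\<Prod>k\<in>(UNIV::'a set). flat 0 (real (Suc n) * (x $ k - a $ k)) * flat 0 (real (Suc n) * (b $ k - x $ k)))" for n
    unfolding box_bump_def by (simp add: algebra_simps)
  ultimately show ?thesis using True by simp
next
  case False
  then have "box_bump n a b x = 0" for n using box_bump_nonzero_iff by blast
  with False show ?thesis by simp
qed

section \<open>Compactly supported functions\<close>

text \<open>
  The test functions are the intersection of these classes. Products with functions of class \<open>C\<^sup>1\<close>
  and compositions lead to the class for \<open>l = 1\<close>.
\<close>

definition Cc :: "nat \<Rightarrow> (real^'n::finite) set \<Rightarrow> (real^'n \<Rightarrow> real) set" where
  "Cc l S = {f. smooth_on l UNIV f \<and> compact (closure {x. f x \<noteq> 0}) \<and> closure {x. f x \<noteq> 0} \<subseteq> S}"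

lemma test_functions_Cc: "\<phi> \<in> test_functions S \<longleftrightarrow> (\<forall>l. \<phi> \<in> Cc l S)"
  by (auto simp: test_functions_def Cc_def C_class_iff_smooth_on)

lemma CcI:
  assumes "smooth_on l UNIV f" "compact K" "K \<subseteq> S" "\<And>x. x \<notin> K \<Longrightarrow> f x = 0"
  shows "f \<in> Cc l S"
proof -
  have sub: "closure {x. f x \<noteq> 0} \<subseteq> K"
    by (rule closure_minimal) (use assms compact_imp_closed in auto)
  then have "compact (closure {x. f x \<noteq> 0})"
    using assms(2) by (meson bounded_subset closed_closure compact_eq_bounded_closed)
  with assms sub show ?thesis by (auto simp: Cc_def)
qed

lemma CcE:
  assumes "f \<in> Cc l S"
  obtains K where "smooth_on l UNIV f" "compact K" "K \<subseteq> S" "\<And>x. x \<notin> K \<Longrightarrow> f x = 0"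
  using assms closure_subset[of "{x. f x \<noteq> 0}"] unfolding Cc_def by blast

lemma Cc_Suc_D: "f \<in> Cc (Suc l) S \<Longrightarrow> f \<in> Cc l S"
  using smooth_on_SucD unfolding Cc_def by blast

lemma Cc_partial:
  assumes "f \<in> Cc (Suc l) S"
  shows "partial_deriv k f \<in> Cc l S"
proof -
  obtain K where K: "smooth_on (Suc l) UNIV f" "compact K" "K \<subseteq> S" "\<And>x. x \<notin> K \<Longrightarrow> f x = 0"
    using CcE[OF assms] by blast
  show ?thesis
  proof (rule CcI[OF _ K(2,3)])
    show "smooth_on l UNIV (partial_deriv k f)" using K(1) by simp
    fix x assume "x \<notin> K"
    then have "partial_deriv k f x = partial_deriv k (\<lambda>x. 0) x"
      by (intro partial_deriv_cong_open(1)[of "- K"]) (use K compact_imp_closed in auto)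
    then show "partial_deriv k f x = 0" by simp
  qed
qed

text \<open>
  Near the boundary of \<open>S\<close> and outside of it the product is zero, whatever \<open>\<eta>\<close> does there.
\<close>

lemma Cc_mult:
  assumes "f \<in> Cc l S" "smooth_on l S \<eta>" "open S"
  shows "(\<lambda>x. \<eta> x * f x) \<in> Cc l S"
proof -
  obtain K where K: "smooth_on l UNIV f" "compact K" "K \<subseteq> S" "\<And>x. x \<notin> K \<Longrightarrow> f x = 0"
    using CcE[OF assms(1)] by blast
  have op: "open (- K)" using K(2) compact_imp_closed by auto
  have "smooth_on l S (\<lambda>x. \<eta> x * f x)"
    by (intro smooth_on_mult assms smooth_on_subset[OF K(1)]) auto
  moreover have "smooth_on l (- K) (\<lambda>x. \<eta> x * f x)"
    by (subst smooth_on_cong[OF op, of _ "\<lambda>x. 0"]) (use K(4) in auto)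
  ultimately have "smooth_on l (S \<union> - K) (\<lambda>x. \<eta> x * f x)"
    by (intro smooth_on_Un assms op)
  moreover have "S \<union> - K = UNIV" using K(3) by auto
  ultimately show ?thesis using K by (intro CcI[OF _ K(2,3)]) auto
qed

lemma test_functions_mult:
  assumes "\<phi> \<in> test_functions S" "\<And>l. smooth_on l S \<eta>" "open S"
  shows "(\<lambda>x. \<eta> x * \<phi> x) \<in> test_functions S"
  using assms by (auto simp: test_functions_Cc intro: Cc_mult)

lemma box_bump_test:
  assumes "cbox a b \<subseteq> S"
  shows "box_bump n a b \<in> test_functions S"
  unfolding test_functions_Cc
proof (intro allI CcI[OF _ compact_cbox assms])
  fix l show "smooth_on l UNIV (box_bump n a b)"
    unfolding box_bump_def[abs_def]
    by (intro smooth_on_prod smooth_on_mult smooth_on_flat_affine) auto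
  fix x show "x \<notin> cbox a b \<Longrightarrow> box_bump n a b x = 0"
    using box_bump_nonzero_iff[of n a b x] box_subset_cbox by blast
qed

lemma Cc_bounded:
  assumes "f \<in> Cc l S"
  obtains B where "B > 0" "\<And>x. \<bar>f x\<bar> \<le> B"
proof -
  obtain K where K: "smooth_on l UNIV f" "compact K" "K \<subseteq> S" "\<And>x. x \<notin> K \<Longrightarrow> f x = 0"
    using CcE[OF assms] by blast
  have "continuous_on K f"
    using smooth_on_imp_continuous_on[OF K(1)] continuous_on_subset by blast
  then have "bounded (f ` K)"
    using K(2) compact_continuous_image compact_imp_bounded by blast
  then obtain B where B: "B > 0" "\<And>x. x \<in> K \<Longrightarrow> \<bar>f x\<bar> \<le> B"
    by (auto simp: bounded_pos)
  have "\<bar>f x\<bar> \<le> B" for x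
    using B K(4)[of x] by (cases "x \<in> K") auto
  with B show ?thesis using that by blast
qed

lemma Cc_integrable_lborel:
  assumes "f \<in> Cc l S"
  shows "integrable lborel f"
proof -
  obtain K where K: "smooth_on l UNIV f" "compact K" "K \<subseteq> S" "\<And>x. x \<notin> K \<Longrightarrow> f x = 0"
    using CcE[OF assms] by blast
  have "integrable lborel (\<lambda>x. indicator K x *\<^sub>R f x)"
    using smooth_on_imp_continuous_on[OF K(1)] continuous_on_subset
    by (intro borel_integrable_compact K(2)) auto
  moreover have "(\<lambda>x. indicator K x *\<^sub>R f x) = f"
    using K(4) by (auto simp: indicator_def fun_eq_iff)
  ultimately show ?thesis by simp
qed

lemma Cc_lebesgue_on:
  assumes "f \<in> Cc l S" "open S"
  shows "integrable (lebesgue_on S) f" "(LINT x|lebesgue_on S. f x) = (LINT x|lborel. f x)"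
proof -
  obtain K where K: "smooth_on l UNIV f" "compact K" "K \<subseteq> S" "\<And>x. x \<notin> K \<Longrightarrow> f x = 0"
    using CcE[OF assms(1)] by blast
  have f: "integrable lborel f" by (rule Cc_integrable_lborel[OF assms(1)])
  then have m: "f \<in> borel_measurable lborel" by auto
  have eq: "(\<lambda>x. indicator S x *\<^sub>R f x) = f"
    using K(3,4) by (auto simp: indicator_def fun_eq_iff)
  have S: "S \<inter> space lebesgue \<in> sets lebesgue" using assms(2) by auto
  show "integrable (lebesgue_on S) f"
    by (simp only: integrable_restrict_space[OF S] eq integrable_completion[OF m] f)
  show "(LINT x|lebesgue_on S. f x) = (LINT x|lborel. f x)"
    by (simp only: integral_restrict_space[OF S] eq integral_completion[OF m])
qed

lemma has_line_derivative:
  assumes "smooth_on (Suc l) UNIV f"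
  shows "((\<lambda>s. f (x + s *\<^sub>R axis k 1)) has_real_derivative partial_deriv k f (x + s *\<^sub>R axis k 1)) (at s)"
proof -
  have d: "f differentiable (at (x + s *\<^sub>R axis k 1))" using assms by simp
  have "((\<lambda>s. x + s *\<^sub>R axis k 1) has_derivative (\<lambda>h. h *\<^sub>R axis k 1)) (at s)"
    by (auto intro!: derivative_eq_intros)
  from has_derivative_compose[OF this has_derivative_grad[OF d]]
  show ?thesis by (simp add: has_field_derivative_def inner_axis mult.commute[of _ "partial_deriv k f _"])
qed

text \<open>
  The difference quotients in direction \<open>k\<close> have integral zero because Lebesgue measure is
  invariant under translations, and they converge to the partial derivative under a common bound.
\<close>

lemma integral_partial_deriv_Cc:
  assumes "f \<in> Cc (Suc 0) S" "open S"
  shows "(LINT x|lebesgue_on S. partial_deriv k f x) = 0"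
proof -
  obtain K where K: "smooth_on (Suc 0) UNIV f" "compact K" "K \<subseteq> S" "\<And>x. x \<notin> K \<Longrightarrow> f x = 0"
    using CcE[OF assms(1)] by blast
  obtain R where R: "\<And>x. x \<in> K \<Longrightarrow> norm x \<le> R"
    using compact_imp_bounded[OF K(2)] bounded_iff by blast
  note pC = Cc_partial[OF assms(1), of k]
  obtain B where B: "B > 0" "\<And>x. \<bar>partial_deriv k f x\<bar> \<le> B" using Cc_bounded[OF pC] by blast
  define h where "h n = inverse (real (Suc n))" for n
  have h: "0 < h n" "h n \<le> 1" for n by (auto simp: h_def field_simps)
  define D where "D n x = (f (x + h n *\<^sub>R axis k 1) - f x) / h n" for n x
  have fi: "integrable lborel f" by (rule Cc_integrable_lborel[OF assms(1)])
  then have fm: "f \<in> borel_measurable borel" by auto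
  have shift: "integrable lborel (\<lambda>x. f (c + x))" "(LINT x|lborel. f (c + x)) = (LINT x|lborel. f x)" for c
  proof -
    have eq: "distr lborel borel ((+) c) = (lborel :: (real^'a) measure)" by (rule lborel_distr_plus)
    have m: "(+) c \<in> measurable lborel (borel :: (real^'a) measure)" by simp
    show "integrable lborel (\<lambda>x. f (c + x))"
      using integrable_distr_eq[OF m fm] fi eq by simp
    show "(LINT x|lborel. f (c + x)) = (LINT x|lborel. f x)"
      using integral_distr[OF m fm] eq by simp
  qed
  have D0: "(LINT x|lborel. D n x) = 0" for n
  proof -
    have "(LINT x|lborel. f (x + h n *\<^sub>R axis k 1) - f x) = 0"
      using shift[of "h n *\<^sub>R axis k 1"] fi by (subst Bochner_Integration.integral_diff) (auto simp: add.commute)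
    then show ?thesis unfolding D_def by simp
  qed
  have Dm: "D n \<in> borel_measurable lborel" for n
    unfolding D_def using shift(1)[of "h n *\<^sub>R axis k 1"] fi by (auto simp: add.commute)
  have lim: "(\<lambda>n. D n x) \<longlonglongrightarrow> partial_deriv k f x" for x
  proof -
    have "((\<lambda>s. (f (x + (0 + s) *\<^sub>R axis k 1) - f (x + 0 *\<^sub>R axis k 1)) / s) \<longlongrightarrow> partial_deriv k f (x + 0 *\<^sub>R axis k 1)) (at 0)"
      using has_line_derivative[OF K(1), of x k 0] unfolding DERIV_def .
    then have L: "((\<lambda>s. (f (x + s *\<^sub>R axis k 1) - f x) / s) \<longlongrightarrow> partial_deriv k f x) (at 0)" by simp
    have "filterlim h (at 0) sequentially"
      unfolding h_def filterlim_at using LIMSEQ_inverse_real_of_nat by auto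
    from filterlim_compose[OF L this] show ?thesis unfolding D_def .
  qed
  have bound: "norm (D n x) \<le> B * indicator (cball 0 (R + 1)) x" for n x
  proof (cases "x \<in> cball 0 (R + 1)")
    case True
    obtain z where "f (x + h n *\<^sub>R axis k 1) - f (x + 0 *\<^sub>R axis k 1) = (h n - 0) * partial_deriv k f (x + z *\<^sub>R axis k 1)"
      using MVT2[of 0 "h n" "\<lambda>s. f (x + s *\<^sub>R axis k 1)" "\<lambda>s. partial_deriv k f (x + s *\<^sub>R axis k 1)"]
        has_line_derivative[OF K(1), of x k] h[of n] by blast
    then have "D n x = partial_deriv k f (x + z *\<^sub>R axis k 1)" using h[of n] by (simp add: D_def)
    with True B show ?thesis by simp
  next
    case False
    then have nx: "norm x > R + 1" by simp
    have "norm (h n *\<^sub>R axis k (1::real)) \<le> 1" using h[of n] by (simp add: norm_axis_1)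
    then have "norm (x + h n *\<^sub>R axis k 1) > R"
      using nx norm_triangle_ineq4[of "x + h n *\<^sub>R axis k 1" "h n *\<^sub>R axis k 1"] by simp
    then have "f x = 0" "f (x + h n *\<^sub>R axis k 1) = 0" using K(4) R nx by fastforce+
    with False show ?thesis by (simp add: D_def)
  qed
  have "integrable lborel (\<lambda>x::real^'a. B * indicator (cball 0 (R + 1)) x :: real)"
    using emeasure_lborel_cball_finite[of "0::real^'a" "R+1"] by (intro integrable_mult_right integrable_real_indicator) auto
  from integral_dominated_convergence[OF _ Dm this, of "partial_deriv k f"] lim bound
    Cc_integrable_lborel[OF pC]
  have "(\<lambda>n. LINT x|lborel. D n x) \<longlonglongrightarrow> (LINT x|lborel. partial_deriv k f x)" by auto
  then have "(LINT x|lborel. partial_deriv k f x) = 0"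
    using D0 LIMSEQ_unique[of "\<lambda>n. 0::real"] by simp
  with Cc_lebesgue_on(2)[OF pC assms(2)] show ?thesis by simp
qed

section \<open>Square integrable functions\<close>

lemma sqint_measurable: "square_integrable S f \<Longrightarrow> f \<in> borel_measurable (lebesgue_on S)"
  and sqint_square: "square_integrable S f \<Longrightarrow> integrable (lebesgue_on S) (\<lambda>x. (f x)\<^sup>2)"
  by (simp_all add: square_integrable_def)

lemma integrable_of_bound:
  fixes f g :: "_ \<Rightarrow> real"
  assumes "integrable M g" "f \<in> borel_measurable M" "\<And>x. x \<in> space M \<Longrightarrow> \<bar>f x\<bar> \<le> g x"
  shows "integrable M f"
  using assms(1,2) by (rule Bochner_Integration.integrable_bound)
    (auto intro!: AE_I2 order_trans[OF assms(3)])

lemma sqint_mult_integrable: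
  assumes "square_integrable S f" "square_integrable S g"
  shows "integrable (lebesgue_on S) (\<lambda>x. f x * g x)"
proof (rule integrable_of_bound)
  show "integrable (lebesgue_on S) (\<lambda>x. (f x)\<^sup>2 + (g x)\<^sup>2)"
    by (intro Bochner_Integration.integrable_add assms sqint_square)
  show "(\<lambda>x. f x * g x) \<in> borel_measurable (lebesgue_on S)"
    by (intro borel_measurable_times assms sqint_measurable)
  fix x show "\<bar>f x * g x\<bar> \<le> (f x)\<^sup>2 + (g x)\<^sup>2"
    using sum_squares_bound[of "\<bar>f x\<bar>" "\<bar>g x\<bar>"] abs_ge_zero[of "f x * g x"]
    by (simp only: abs_mult power2_abs mult.assoc)
qed

lemma sqint_bounded_mult:
  assumes "square_integrable S f" "b \<in> borel_measurable (lebesgue_on S)" "\<And>x. x \<in> S \<Longrightarrow> \<bar>b x\<bar> \<le> C"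
  shows "square_integrable S (\<lambda>x. b x * f x)"
  unfolding square_integrable_def
proof
  show m: "(\<lambda>x. b x * f x) \<in> borel_measurable (lebesgue_on S)"
    by (intro borel_measurable_times assms sqint_measurable)
  show "integrable (lebesgue_on S) (\<lambda>x. (b x * f x)\<^sup>2)"
  proof (rule integrable_of_bound)
    show "integrable (lebesgue_on S) (\<lambda>x. C\<^sup>2 * (f x)\<^sup>2)"
      using sqint_square[OF assms(1)] by auto
    show "(\<lambda>x. (b x * f x)\<^sup>2) \<in> borel_measurable (lebesgue_on S)" using m by auto
    fix x assume "x \<in> space (lebesgue_on S)"
    then have "(b x)\<^sup>2 \<le> C\<^sup>2" using assms(3)[of x] by (intro abs_le_square_iff[THEN iffD1]) auto
    then show "\<bar>(b x * f x)\<^sup>2\<bar> \<le> C\<^sup>2 * (f x)\<^sup>2"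
      by (simp add: power_mult_distrib mult_right_mono)
  qed
qed

lemma sqint_cmult: "square_integrable S f \<Longrightarrow> square_integrable S (\<lambda>x. c * f x)"
  by (rule sqint_bounded_mult[where C = "\<bar>c\<bar>"]) auto

lemma sqint_add:
  assumes "square_integrable S f" "square_integrable S g"
  shows "square_integrable S (\<lambda>x. f x + g x)"
  using assms sqint_mult_integrable[OF assms]
  by (auto simp: square_integrable_def power2_sum mult.assoc)

lemma sqint_diff:
  assumes "square_integrable S f" "square_integrable S g"
  shows "square_integrable S (\<lambda>x. f x - g x)"
  using sqint_add[OF assms(1) sqint_cmult[OF assms(2), of "-1"]] by simp

lemma sqint_Cc:
  assumes "f \<in> Cc l S" "open S"
  shows "square_integrable S f"
proof -
  have f: "integrable (lebesgue_on S) f" by (rule Cc_lebesgue_on[OF assms])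
  obtain B where B: "B > 0" "\<And>x. \<bar>f x\<bar> \<le> B" using Cc_bounded[OF assms(1)] by blast
  have "integrable (lebesgue_on S) (\<lambda>x. (f x)\<^sup>2)"
  proof (rule integrable_of_bound)
    show "integrable (lebesgue_on S) (\<lambda>x. B * \<bar>f x\<bar>)" using f by auto
    show "(\<lambda>x. (f x)\<^sup>2) \<in> borel_measurable (lebesgue_on S)" using f by auto
    fix x show "\<bar>(f x)\<^sup>2\<bar> \<le> B * \<bar>f x\<bar>"
      using mult_right_mono[OF B(2), of "\<bar>f x\<bar>" x] by (simp add: power2_eq_square abs_mult)
  qed
  with f show ?thesis by (auto simp: square_integrable_def)
qed

lemma sqint_const: "S \<in> lmeasurable \<Longrightarrow> square_integrable S (\<lambda>x. c)"
  using finite_measure_lebesgue_on[of S]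
  by (auto simp: square_integrable_def intro: finite_measure.integrable_const)

lemma sqint_integrable: "S \<in> lmeasurable \<Longrightarrow> square_integrable S f \<Longrightarrow> integrable (lebesgue_on S) f"
  using sqint_mult_integrable[OF _ sqint_const[where c = 1], of S f] by simp

lemma integrable_inner_components:
  fixes g h :: "real^'n::finite \<Rightarrow> real^'n"
  assumes "\<And>k. square_integrable S (\<lambda>x. g x $ k)" "\<And>k. square_integrable S (\<lambda>x. h x $ k)"
  shows "integrable (lebesgue_on S) (\<lambda>x. g x \<bullet> h x)"
  unfolding inner_vec_def using sqint_mult_integrable[OF assms] by auto

lemma integrable_norm2_components:
  fixes g :: "real^'n::finite \<Rightarrow> real^'n"
  assumes "\<And>k. square_integrable S (\<lambda>x. g x $ k)"
  shows "integrable (lebesgue_on S) (\<lambda>x. (norm (g x))\<^sup>2)"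
  unfolding power2_norm_eq_inner by (intro integrable_inner_components assms)

section \<open>The fundamental lemma of the calculus of variations\<close>

lemma integrable_lebesgue_on_subset:
  fixes f :: "_ \<Rightarrow> real"
  assumes "integrable (lebesgue_on S) f" "T \<subseteq> S" "T \<in> sets lebesgue" "S \<in> sets lebesgue"
  shows "integrable (lebesgue_on T) f"
proof -
  have "integrable lebesgue (\<lambda>x. indicator T x *\<^sub>R (indicator S x *\<^sub>R f x))"
    by (rule integrable_mult_indicator) (use assms in \<open>auto simp: integrable_restrict_space\<close>)
  moreover have "(\<lambda>x. indicator T x *\<^sub>R (indicator S x *\<^sub>R f x)) = (\<lambda>x. indicator T x *\<^sub>R f x)"
    using assms(2) by (auto simp: fun_eq_iff indicator_def)
  ultimately have "integrable lebesgue (\<lambda>x. indicator T x *\<^sub>R f x)" by (simp only:)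
  then show ?thesis using assms(3) by (simp add: integrable_restrict_space)
qed

text \<open>
  The bump functions of the box are test functions that converge to the indicator of its interior.
\<close>

lemma integral_box_zero:
  fixes S :: "(real^'n::finite) set"
  assumes S: "open S" and f: "square_integrable S f"
    and 0: "\<And>\<phi>. \<phi> \<in> test_functions S \<Longrightarrow> (LINT x|lebesgue_on S. f x * \<phi> x) = 0"
    and ab: "cbox a b \<subseteq> S"
  shows "integrable (lebesgue_on (cbox a b)) f" "integral (cbox a b) f = 0"
proof -
  have Sm: "S \<in> sets lebesgue" using S by auto
  have fm: "f \<in> borel_measurable (lebesgue_on S)" using f sqint_measurable by auto
  have ind: "integrable (lebesgue_on S) (\<lambda>x. indicator (cbox a b) x :: real)"
    using ab Sm lmeasurable_cbox[of a b]
    by (auto intro!: integrable_real_indicator simp: emeasure_restrict_space sets_restrict_space_iff fmeasurable_def)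
  have int: "integrable (lebesgue_on S) (\<lambda>x. \<bar>f x\<bar> * indicator (cbox a b) x)"
  proof (rule integrable_of_bound)
    show "integrable (lebesgue_on S) (\<lambda>x. (f x)\<^sup>2 + indicator (cbox a b) x)"
      using sqint_square[OF f] ind by auto
    show "(\<lambda>x. \<bar>f x\<bar> * indicator (cbox a b) x) \<in> borel_measurable (lebesgue_on S)"
      using fm ind by auto
    fix x show "\<bar>\<bar>f x\<bar> * indicator (cbox a b) x\<bar> \<le> (f x)\<^sup>2 + indicator (cbox a b) x"
      using sum_squares_bound[of "\<bar>f x\<bar>" 1] by (auto simp: indicator_def)
  qed
  have int': "integrable (lebesgue_on S) (\<lambda>x. f x * indicator (cbox a b) x)"
    by (rule Bochner_Integration.integrable_bound[OF int]) (use fm ind in \<open>auto simp: abs_mult\<close>)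
  have eqi: "(\<lambda>x. indicator S x *\<^sub>R (f x * indicator X x)) = (\<lambda>x. indicator X x *\<^sub>R f x)" if "X \<subseteq> S" for X
    using that by (auto simp: fun_eq_iff indicator_def)
  show I: "integrable (lebesgue_on (cbox a b)) f"
    using int' Sm eqi[OF ab] by (simp add: integrable_restrict_space)
  have "(\<lambda>n. LINT x|lebesgue_on S. f x * box_bump n a b x) \<longlonglongrightarrow> (LINT x|lebesgue_on S. f x * indicator (box a b) x)"
  proof (rule integral_dominated_convergence[OF _ _ int])
    show "(\<lambda>x. f x * indicator (box a b) x) \<in> borel_measurable (lebesgue_on S)"
      using fm Sm ab box_subset_cbox[of a b]
      by (intro borel_measurable_times borel_measurable_indicator) (auto simp: sets_restrict_space_iff)
    show "(\<lambda>x. f x * box_bump n a b x) \<in> borel_measurable (lebesgue_on S)" for n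
      using fm sqint_measurable[OF sqint_Cc[of _ 0, OF _ S]] box_bump_test[OF ab] 
      by (intro borel_measurable_times) (auto simp: test_functions_Cc)
    show "AE x in lebesgue_on S. (\<lambda>n. f x * box_bump n a b x) \<longlonglongrightarrow> f x * indicator (box a b) x"
      by (auto intro!: tendsto_intros box_bump_tendsto)
    show "AE x in lebesgue_on S. norm (f x * box_bump n a b x) \<le> \<bar>f x\<bar> * indicator (cbox a b) x" for n
    proof (rule AE_I2)
      fix x
      show "norm (f x * box_bump n a b x) \<le> \<bar>f x\<bar> * indicator (cbox a b) x"
        using box_bump_nonzero_iff[of n a b x] box_bump_bounds[of n a b x] box_subset_cbox[of a b]
        by (cases "x \<in> cbox a b") (auto simp: abs_mult mult_left_le)
    qed
  qed
  then have "(LINT x|lebesgue_on S. f x * indicator (box a b) x) = 0"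
    using 0[OF box_bump_test[OF ab]] LIMSEQ_unique[of "\<lambda>n. 0::real"] by simp
  moreover have "box a b \<subseteq> S" using ab box_subset_cbox by blast
  ultimately have z: "(LINT x|lebesgue_on (box a b). f x) = 0"
    using Sm eqi[of "box a b"] by (simp add: integral_restrict_space)
  have "integrable (lebesgue_on (box a b)) f"
    by (rule integrable_lebesgue_on_subset[OF I box_subset_cbox]) auto
  then have "integral (box a b) f = 0"
    using z lebesgue_integral_eq_integral[of "box a b" f] by simp
  then show "integral (cbox a b) f = 0" by (simp add: integral_open_interval)
qed

text \<open>
  On a closed box inside \<open>S\<close> all integrals over subboxes vanish, so the function vanishes almost
  everywhere there by Lebesgue differentiation. Countably many such boxes cover \<open>S\<close>.
\<close>

lemma fundamental_lemma:
  fixes S :: "(real^'n::finite) set"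
  assumes S: "open S" and f: "square_integrable S f"
    and 0: "\<And>\<phi>. \<phi> \<in> test_functions S \<Longrightarrow> (LINT x|lebesgue_on S. f x * \<phi> x) = 0"
  shows "AE x in lebesgue_on S. f x = 0"
proof -
  have boxes: "AE x in lebesgue. x \<in> cbox a b \<longrightarrow> f x = 0" if ab: "cbox a b \<subseteq> S" for a b
  proof -
    define F where "F x = (if x \<in> cbox a b then f x else 0)" for x
    have Z: "F integrable_on cbox c d \<and> integral (cbox c d) F = 0" for c d
    proof -
      obtain c' d' where cd: "cbox a b \<inter> cbox c d = cbox c' d'"
        using Int_interval by blast
      then have sub: "cbox c' d' \<subseteq> S" using ab by blast
      note B = integral_box_zero[OF S f 0 sub]
      have eq: "(\<lambda>x. if x \<in> cbox c d then F x else 0) = (\<lambda>x. if x \<in> cbox c' d' then f x else 0)"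
        using cd by (auto simp: F_def fun_eq_iff)
      have "f integrable_on cbox c' d'"
        using B(1) by (intro integrable_on_lebesgue_on) auto
      then have "F integrable_on cbox c d"
        using integrable_restrict_UNIV[of "cbox c d" F] integrable_restrict_UNIV[of "cbox c' d'" f] eq by simp
      moreover have "integral (cbox c d) F = 0"
        using B(2) integral_restrict_UNIV[of "cbox c d" F] integral_restrict_UNIV[of "cbox c' d'" f] eq by simp
      ultimately show ?thesis by simp
    qed
    then have FI: "\<And>c d. F integrable_on cbox c d" by blast
    obtain N where N: "negligible N" "\<And>x e. \<lbrakk>x \<notin> N; 0 < e\<rbrakk> \<Longrightarrow>
        \<exists>d>0. \<forall>h. 0 < h \<and> h < d \<longrightarrow>
           norm (integral (cbox x (x + h *\<^sub>R One)) F /\<^sub>R h ^ DIM(real^'n) - F x) < e"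
      using integrable_ccontinuous_explicit[OF FI] by blast
    have "F x = 0" if xN: "x \<notin> N" for x
    proof (rule ccontr)
      assume "F x \<noteq> 0"
      then obtain d where d: "d > 0" "\<And>h. 0 < h \<and> h < d \<Longrightarrow>
           norm (integral (cbox x (x + h *\<^sub>R One)) F /\<^sub>R h ^ DIM(real^'n) - F x) < \<bar>F x\<bar>"
        using N(2)[OF xN, of "\<bar>F x\<bar>"] by auto
      then have "norm (integral (cbox x (x + (d/2) *\<^sub>R One)) F /\<^sub>R (d/2) ^ DIM(real^'n) - F x) < \<bar>F x\<bar>"
        by (intro d(2)) (use d(1) in auto)
      then show False using Z by simp
    qed
    moreover have "AE x in lebesgue. x \<notin> N"
      using N(1) by (simp add: negligible_iff_null_sets AE_not_in)
    ultimately show ?thesis unfolding F_def by (elim eventually_mono) metis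
  qed
  obtain \<D> where D: "countable \<D>" "\<D> \<subseteq> Pow S" "\<And>X. X \<in> \<D> \<Longrightarrow> \<exists>a b. X = cbox a b" "\<Union>\<D> = S"
    using open_countable_Union_open_cbox[OF S] by metis
  have "AE x in lebesgue. \<forall>X\<in>\<D>. x \<in> X \<longrightarrow> f x = 0"
  proof (subst AE_ball_countable[OF D(1)], rule ballI)
    fix X assume "X \<in> \<D>"
    then show "AE x in lebesgue. x \<in> X \<longrightarrow> f x = 0" using D(2,3) boxes by blast
  qed
  then have "AE x in lebesgue. x \<in> S \<longrightarrow> f x = 0"
    by (rule eventually_mono) (use D(4) in auto)
  then show ?thesis using S by (subst AE_restrict_space_iff) auto
qed

section \<open>Weak gradients\<close>

lemma has_weak_gradient_sqint: "has_weak_gradient S u g \<Longrightarrow> square_integrable S (\<lambda>x. g x $ k)"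
  by (simp add: has_weak_gradient_def)

lemma has_weak_gradient_eq:
  "has_weak_gradient S u g \<Longrightarrow> \<phi> \<in> test_functions S \<Longrightarrow>
   (LINT x|lebesgue_on S. u x * partial_deriv k \<phi> x) = - (LINT x|lebesgue_on S. g x $ k * \<phi> x)"
  by (simp add: has_weak_gradient_def)

lemma test_sqint:
  assumes "open S" "\<phi> \<in> test_functions S"
  shows "square_integrable S \<phi>" "square_integrable S (partial_deriv k \<phi>)"
  using assms sqint_Cc[of _ 0 S] sqint_Cc[OF Cc_partial, of _ 0 S]
  by (auto simp: test_functions_Cc)

lemma weak_gradient_unique:
  assumes "open S" "has_weak_gradient S u g" "has_weak_gradient S u h"
  shows "AE x in lebesgue_on S. g x = h x"
proof -
  have "AE x in lebesgue_on S. g x $ k - h x $ k = 0" for k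
  proof (rule fundamental_lemma[OF assms(1)])
    show "square_integrable S (\<lambda>x. g x $ k - h x $ k)"
      by (intro sqint_diff has_weak_gradient_sqint[OF assms(2)] has_weak_gradient_sqint[OF assms(3)])
    fix \<phi> assume \<phi>: "\<phi> \<in> test_functions S"
    have "(LINT x|lebesgue_on S. g x $ k * \<phi> x) = (LINT x|lebesgue_on S. h x $ k * \<phi> x)"
      using has_weak_gradient_eq[OF assms(2) \<phi>, of k] has_weak_gradient_eq[OF assms(3) \<phi>, of k]
      by linarith
    moreover have "integrable (lebesgue_on S) (\<lambda>x. g x $ k * \<phi> x)" "integrable (lebesgue_on S) (\<lambda>x. h x $ k * \<phi> x)"
      by (rule sqint_mult_integrable[OF has_weak_gradient_sqint[OF assms(2)] test_sqint(1)[OF assms(1) \<phi>]],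
          rule sqint_mult_integrable[OF has_weak_gradient_sqint[OF assms(3)] test_sqint(1)[OF assms(1) \<phi>]])
    ultimately show "(LINT x|lebesgue_on S. (g x $ k - h x $ k) * \<phi> x) = 0"
      by (simp add: left_diff_distrib)
  qed
  then have "AE x in lebesgue_on S. \<forall>k. g x $ k - h x $ k = 0"
    by (simp add: AE_all_countable)
  then show ?thesis by (rule eventually_mono) (auto simp: vec_eq_iff)
qed

lemma H1I: "square_integrable S u \<Longrightarrow> has_weak_gradient S u g \<Longrightarrow> u \<in> H1 S"
  by (auto simp: H1_def)

lemma H1_weak_grad: "u \<in> H1 S \<Longrightarrow> has_weak_gradient S u (weak_grad S u)"
  unfolding H1_def weak_grad_def using someI_ex[of "has_weak_gradient S u"] by simp

lemma H1_sqint: "u \<in> H1 S \<Longrightarrow> square_integrable S u"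
  by (auto simp: H1_def)

lemma weak_grad_AE:
  assumes "open S" "has_weak_gradient S u g"
  shows "AE x in lebesgue_on S. weak_grad S u x = g x"
proof -
  have "has_weak_gradient S u (weak_grad S u)"
    unfolding weak_grad_def using assms(2) by (rule someI[of "has_weak_gradient S u"])
  from weak_gradient_unique[OF assms(1) this assms(2)] show ?thesis .
qed

lemma has_weak_gradient_lincomb:
  assumes S: "open S" and u: "square_integrable S u" and v: "square_integrable S v"
    and g: "has_weak_gradient S u g" and h: "has_weak_gradient S v h"
  shows "has_weak_gradient S (\<lambda>x. a * u x + b * v x) (\<lambda>x. a *\<^sub>R g x + b *\<^sub>R h x)"
  unfolding has_weak_gradient_def
proof (intro conjI allI ballI)
  fix k
  show "square_integrable S (\<lambda>x. (a *\<^sub>R g x + b *\<^sub>R h x) $ k)"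
    using sqint_add[OF sqint_cmult[OF has_weak_gradient_sqint[OF g]] sqint_cmult[OF has_weak_gradient_sqint[OF h]]]
    by simp
next
  fix \<phi> k assume \<phi>: "\<phi> \<in> test_functions S"
  have i: "integrable (lebesgue_on S) (\<lambda>x. u x * partial_deriv k \<phi> x)"
    "integrable (lebesgue_on S) (\<lambda>x. v x * partial_deriv k \<phi> x)"
    "integrable (lebesgue_on S) (\<lambda>x. g x $ k * \<phi> x)" "integrable (lebesgue_on S) (\<lambda>x. h x $ k * \<phi> x)"
    by (intro sqint_mult_integrable has_weak_gradient_sqint[OF g] has_weak_gradient_sqint[OF h] test_sqint S u v \<phi>)+
  have "(LINT x|lebesgue_on S. (a * u x + b * v x) * partial_deriv k \<phi> x)
    = a * (LINT x|lebesgue_on S. u x * partial_deriv k \<phi> x) + b * (LINT x|lebesgue_on S. v x * partial_deriv k \<phi> x)"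
    using i by (simp add: distrib_right mult.assoc)
  also have "\<dots> = - (a * (LINT x|lebesgue_on S. g x $ k * \<phi> x) + b * (LINT x|lebesgue_on S. h x $ k * \<phi> x))"
    by (simp add: has_weak_gradient_eq[OF g \<phi>] has_weak_gradient_eq[OF h \<phi>])
  also have "\<dots> = - (LINT x|lebesgue_on S. (a *\<^sub>R g x + b *\<^sub>R h x) $ k * \<phi> x)"
    using i by (simp add: distrib_right mult.assoc)
  finally show "(LINT x|lebesgue_on S. (a * u x + b * v x) * partial_deriv k \<phi> x)
    = - (LINT x|lebesgue_on S. (a *\<^sub>R g x + b *\<^sub>R h x) $ k * \<phi> x)" .
qed

lemma has_weak_gradient_Cc:
  assumes S: "open S" and c: "c \<in> Cc (Suc 0) S"
  shows "has_weak_gradient S c (grad c)"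
  unfolding has_weak_gradient_def
proof (intro conjI allI ballI)
  fix k show "square_integrable S (\<lambda>x. grad c x $ k)"
    using sqint_Cc[OF Cc_partial[OF c] S] by simp
next
  fix \<phi> k assume \<phi>: "\<phi> \<in> test_functions S"
  have c1: "smooth_on (Suc 0) UNIV c" using c by (simp add: Cc_def)
  have \<phi>1: "\<phi> \<in> Cc (Suc 0) S" using \<phi> by (simp add: test_functions_Cc)
  then have \<phi>2: "smooth_on (Suc 0) UNIV \<phi>" by (simp add: Cc_def)
  have "(\<lambda>x. c x * \<phi> x) \<in> Cc (Suc 0) S"
    using smooth_on_subset[OF c1] by (intro Cc_mult[OF \<phi>1 _ S]) auto
  from integral_partial_deriv_Cc[OF this S, of k]
  have "(LINT x|lebesgue_on S. c x * partial_deriv k \<phi> x + partial_deriv k c x * \<phi> x) = 0"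
    using c1 \<phi>2 by (simp add: partial_deriv_mult)
  moreover have "integrable (lebesgue_on S) (\<lambda>x. c x * partial_deriv k \<phi> x)"
    by (intro sqint_mult_integrable sqint_Cc[OF c S] test_sqint S \<phi>)
  moreover have "integrable (lebesgue_on S) (\<lambda>x. partial_deriv k c x * \<phi> x)"
    by (intro sqint_mult_integrable sqint_Cc[OF Cc_partial[OF c] S] test_sqint S \<phi>)
  ultimately show "(LINT x|lebesgue_on S. c x * partial_deriv k \<phi> x) = - (LINT x|lebesgue_on S. grad c x $ k * \<phi> x)"
    by simp
qed

lemma has_weak_gradient_test:
  "open S \<Longrightarrow> \<phi> \<in> test_functions S \<Longrightarrow> has_weak_gradient S \<phi> (grad \<phi>)"
  by (intro has_weak_gradient_Cc) (auto simp: test_functions_Cc)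

lemma has_weak_gradient_minus_test:
  assumes "open S" "square_integrable S u" "has_weak_gradient S u g" "\<phi> \<in> test_functions S"
  shows "has_weak_gradient S (\<lambda>x. u x - \<phi> x) (\<lambda>x. g x - grad \<phi> x)"
  using has_weak_gradient_lincomb[OF assms(1,2) test_sqint(1)[OF assms(1,4)] assms(3)
      has_weak_gradient_test[OF assms(1,4)], of 1 "-1"] by simp

text \<open>
  The square of the \<open>H\<^sup>1\<close> norm with an explicit weak gradient, so that no chosen representative
  has to be carried along.
\<close>

definition H1_energy :: "(real^'n::finite) set \<Rightarrow> (real^'n \<Rightarrow> real) \<Rightarrow> (real^'n \<Rightarrow> real^'n) \<Rightarrow> real" where
  "H1_energy S u g = (LINT x|lebesgue_on S. (u x)\<^sup>2 + (norm (g x))\<^sup>2)"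

lemma weak_gradient_measurable:
  fixes g :: "real^'n::finite \<Rightarrow> real^'n"
  assumes "has_weak_gradient S u g"
  shows "g \<in> borel_measurable (lebesgue_on S)"
proof (rule borel_measurable_euclidean_space[THEN iffD2, rule_format])
  fix i :: "real^'n" assume "i \<in> Basis"
  then obtain k where "i = axis k 1" by (auto simp: Basis_vec_def)
  then show "(\<lambda>x. g x \<bullet> i) \<in> borel_measurable (lebesgue_on S)"
    using sqint_measurable[OF has_weak_gradient_sqint[OF assms, of k]] by (simp add: inner_axis)
qed

lemma H1_norm_eq:
  assumes "open S" "square_integrable S u" "has_weak_gradient S u g"
  shows "H1_norm S u = sqrt (H1_energy S u g)"
proof -
  have w: "has_weak_gradient S u (weak_grad S u)" 
    using H1_weak_grad H1I assms(2,3) by blast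
  have "(LINT x|lebesgue_on S. (u x)\<^sup>2 + (norm (weak_grad S u x))\<^sup>2) = H1_energy S u g"
    unfolding H1_energy_def
  proof (rule integral_cong_AE)
    show "AE x in lebesgue_on S. (u x)\<^sup>2 + (norm (weak_grad S u x))\<^sup>2 = (u x)\<^sup>2 + (norm (g x))\<^sup>2"
      using weak_grad_AE[OF assms(1,3)] by (rule eventually_mono) simp
  qed (use sqint_measurable[OF assms(2)] weak_gradient_measurable[OF w] weak_gradient_measurable[OF assms(3)] in measurable)
  then show ?thesis unfolding H1_norm_def by simp
qed

lemma H1_energy_integrable:
  assumes "square_integrable S u" "has_weak_gradient S u g"
  shows "integrable (lebesgue_on S) (\<lambda>x. (u x)\<^sup>2 + (norm (g x))\<^sup>2)"
  by (intro Bochner_Integration.integrable_add sqint_square assms integrable_norm2_components has_weak_gradient_sqint[OF assms(2)])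

lemma H10_approx:
  assumes S: "open S" and u: "u \<in> H10 S" "has_weak_gradient S u g" and e: "\<epsilon> > 0"
  obtains \<phi> where "\<phi> \<in> test_functions S"
    "H1_energy S (\<lambda>x. u x - \<phi> x) (\<lambda>x. g x - grad \<phi> x) < \<epsilon>"
proof -
  have sq: "square_integrable S u" using u(1) by (simp add: H10_def H1_def)
  obtain \<phi> where \<phi>: "\<phi> \<in> test_functions S" "H1_norm S (\<lambda>x. u x - \<phi> x) < sqrt \<epsilon>"
    using u(1) e unfolding H10_def by (auto dest: spec[of _ "sqrt \<epsilon>"])
  have "H1_norm S (\<lambda>x. u x - \<phi> x) = sqrt (H1_energy S (\<lambda>x. u x - \<phi> x) (\<lambda>x. g x - grad \<phi> x))"
    by (intro H1_norm_eq S sqint_diff sq test_sqint \<phi> has_weak_gradient_minus_test u)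
  with \<phi> that show ?thesis by simp
qed

lemma H10_I:
  assumes S: "open S" and u: "square_integrable S u" "has_weak_gradient S u g"
    and app: "\<And>\<epsilon>. \<epsilon> > 0 \<Longrightarrow> \<exists>\<phi>\<in>test_functions S. H1_energy S (\<lambda>x. u x - \<phi> x) (\<lambda>x. g x - grad \<phi> x) < \<epsilon>"
  shows "u \<in> H10 S"
  unfolding H10_def
proof (intro CollectI conjI allI impI)
  show "u \<in> H1 S" using H1I[OF u] .
  fix \<epsilon> :: real assume e: "\<epsilon> > 0"
  then obtain \<phi> where \<phi>: "\<phi> \<in> test_functions S" "H1_energy S (\<lambda>x. u x - \<phi> x) (\<lambda>x. g x - grad \<phi> x) < \<epsilon>\<^sup>2"
    using app[of "\<epsilon>\<^sup>2"] by auto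
  have "H1_norm S (\<lambda>x. u x - \<phi> x) = sqrt (H1_energy S (\<lambda>x. u x - \<phi> x) (\<lambda>x. g x - grad \<phi> x))"
    by (intro H1_norm_eq S sqint_diff u test_sqint \<phi> has_weak_gradient_minus_test)
  also have "\<dots> < \<epsilon>" using \<phi>(2) e by (simp add: real_less_lsqrt)
  finally show "\<exists>\<phi>\<in>test_functions S. H1_norm S (\<lambda>x. u x - \<phi> x) < \<epsilon>" using \<phi>(1) by blast
qed

lemma H10_H1: "u \<in> H10 S \<Longrightarrow> u \<in> H1 S"
  by (simp add: H10_def)

section \<open>Multiplication by smooth functions\<close>

lemma smooth_measurable:
  assumes "open S" "smooth_on l S \<eta>"
  shows "\<eta> \<in> borel_measurable (lebesgue_on S)"
  using assms smooth_on_imp_continuous_on by (intro continuous_imp_measurable_on_sets_lebesgue) auto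

text \<open>
  The product rule holds because \<open>\<eta> \<phi>\<close> is again a test function.
\<close>

lemma has_weak_gradient_mult:
  assumes S: "open S" and u: "square_integrable S u" and g: "has_weak_gradient S u g"
    and sm: "\<And>l. smooth_on l S \<eta>"
    and bd: "\<And>x. x \<in> S \<Longrightarrow> \<bar>\<eta> x\<bar> \<le> C" "\<And>x k. x \<in> S \<Longrightarrow> \<bar>partial_deriv k \<eta> x\<bar> \<le> C"
  shows "square_integrable S (\<lambda>x. \<eta> x * u x)"
    "has_weak_gradient S (\<lambda>x. \<eta> x * u x) (\<lambda>x. \<eta> x *\<^sub>R g x + u x *\<^sub>R grad \<eta> x)"
proof -
  have sm': "smooth_on l S (partial_deriv k \<eta>)" for k l using sm[of "Suc l"] by simp
  note m = smooth_measurable[OF S sm[of 0]] smooth_measurable[OF S sm'[of 0]]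
  show "square_integrable S (\<lambda>x. \<eta> x * u x)" by (rule sqint_bounded_mult[OF u m(1) bd(1)])
  have i1: "square_integrable S (\<lambda>x. \<eta> x * g x $ k)" for k
    by (rule sqint_bounded_mult[OF has_weak_gradient_sqint[OF g] m(1) bd(1)])
  have i2: "square_integrable S (\<lambda>x. partial_deriv k \<eta> x * u x)" for k
    by (rule sqint_bounded_mult[OF u m(2) bd(2)])
  show "has_weak_gradient S (\<lambda>x. \<eta> x * u x) (\<lambda>x. \<eta> x *\<^sub>R g x + u x *\<^sub>R grad \<eta> x)"
    unfolding has_weak_gradient_def
  proof (intro conjI allI ballI)
    fix k
    show "square_integrable S (\<lambda>x. (\<eta> x *\<^sub>R g x + u x *\<^sub>R grad \<eta> x) $ k)"
      using sqint_add[OF i1[of k] i2[of k]] by (simp add: mult.commute)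
  next
    fix \<phi> k assume \<phi>: "\<phi> \<in> test_functions S"
    have \<eta>\<phi>: "(\<lambda>x. \<eta> x * \<phi> x) \<in> test_functions S" by (intro test_functions_mult \<phi> sm S)
    have "smooth_on (Suc 0) UNIV \<phi>" using \<phi> unfolding test_functions_Cc Cc_def by blast
    then have d: "partial_deriv k (\<lambda>x. \<eta> x * \<phi> x) x = \<eta> x * partial_deriv k \<phi> x + partial_deriv k \<eta> x * \<phi> x"
      if "x \<in> S" for x
      using that sm[of "Suc 0"] by (intro partial_deriv_mult) auto
    have "(LINT x|lebesgue_on S. \<eta> x * u x * partial_deriv k \<phi> x)
      = (LINT x|lebesgue_on S. u x * partial_deriv k (\<lambda>x. \<eta> x * \<phi> x) x - partial_deriv k \<eta> x * u x * \<phi> x)"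
      by (rule Bochner_Integration.integral_cong) (auto simp: d algebra_simps)
    also have "\<dots> = (LINT x|lebesgue_on S. u x * partial_deriv k (\<lambda>x. \<eta> x * \<phi> x) x)
         - (LINT x|lebesgue_on S. partial_deriv k \<eta> x * u x * \<phi> x)"
      by (intro Bochner_Integration.integral_diff sqint_mult_integrable test_sqint u S i2 \<phi> \<eta>\<phi>)
    also have "(LINT x|lebesgue_on S. u x * partial_deriv k (\<lambda>x. \<eta> x * \<phi> x) x)
      = - (LINT x|lebesgue_on S. \<eta> x * g x $ k * \<phi> x)"
      by (subst has_weak_gradient_eq[OF g \<eta>\<phi>]) (simp add: mult_ac)
    also have "- (LINT x|lebesgue_on S. \<eta> x * g x $ k * \<phi> x) - (LINT x|lebesgue_on S. partial_deriv k \<eta> x * u x * \<phi> x)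
      = - (LINT x|lebesgue_on S. \<eta> x * g x $ k * \<phi> x + partial_deriv k \<eta> x * u x * \<phi> x)"
      by (subst Bochner_Integration.integral_add) (auto intro!: sqint_mult_integrable i1 i2 test_sqint S \<phi>)
    also have "(\<lambda>x. \<eta> x * g x $ k * \<phi> x + partial_deriv k \<eta> x * u x * \<phi> x)
      = (\<lambda>x. (\<eta> x *\<^sub>R g x + u x *\<^sub>R grad \<eta> x) $ k * \<phi> x)"
      by (simp add: fun_eq_iff algebra_simps)
    finally show "(LINT x|lebesgue_on S. \<eta> x * u x * partial_deriv k \<phi> x)
      = - (LINT x|lebesgue_on S. (\<eta> x *\<^sub>R g x + u x *\<^sub>R grad \<eta> x) $ k * \<phi> x)"
      .
  qed
qed

text \<open>
  Used with \<open>\<delta> = 1\<close> for crude bounds, and with \<open>\<delta>\<close> tending to zero to pass to limits in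
  inequalities between quadratic integrals.
\<close>

lemma norm_add_square_le_weighted:
  fixes a b :: "'a::real_inner"
  assumes "\<delta> > 0"
  shows "(norm (a + b))\<^sup>2 \<le> (1 + \<delta>) * (norm a)\<^sup>2 + (1 + 1 / \<delta>) * (norm b)\<^sup>2"
proof -
  define s where "s = sqrt \<delta>"
  have s: "s > 0" "s\<^sup>2 = \<delta>" using assms by (auto simp: s_def)
  have "0 \<le> (norm (s *\<^sub>R a - inverse s *\<^sub>R b))\<^sup>2" by simp
  also have "\<dots> = \<delta> * (norm a)\<^sup>2 + (1 / \<delta>) * (norm b)\<^sup>2 - 2 * (a \<bullet> b)"
    unfolding power2_norm_eq_inner using s
    by (simp add: inner_diff_left inner_diff_right inner_commute power2_eq_square field_simps)
  finally have "2 * (a \<bullet> b) \<le> \<delta> * (norm a)\<^sup>2 + (1 / \<delta>) * (norm b)\<^sup>2" by simp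
  moreover have "(norm (a + b))\<^sup>2 = (norm a)\<^sup>2 + (norm b)\<^sup>2 + 2 * (a \<bullet> b)"
    unfolding power2_norm_eq_inner by (simp add: inner_add_left inner_add_right inner_commute)
  ultimately show ?thesis by (simp add: distrib_right)
qed

lemma H10_mult:
  assumes S: "open S" and u: "u \<in> H10 S"
    and sm: "\<And>l. smooth_on l S \<eta>"
    and bd: "\<And>x. x \<in> S \<Longrightarrow> \<bar>\<eta> x\<bar> \<le> C" "\<And>x k. x \<in> S \<Longrightarrow> \<bar>partial_deriv k \<eta> x\<bar> \<le> C"
  shows "(\<lambda>x. \<eta> x * u x) \<in> H10 S"
proof -
  define g where "g = weak_grad S u"
  have sq: "square_integrable S u" and g: "has_weak_gradient S u g"
    using u H1_sqint H1_weak_grad H10_H1 unfolding g_def by blast+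
  note * = has_weak_gradient_mult[OF S sq g sm bd]
  define N where "N = real CARD('a)"
  \<comment> \<open>Any bound for the square of the norm of multiplication by \<open>\<eta>\<close> on \<open>H\<^sup>1\<close> would do; the \<open>1\<close> makes it positive.\<close>
  define D where "D = 3 * C\<^sup>2 + 2 * N * C\<^sup>2 + 1"
  have D: "D > 0" by (simp add: D_def N_def add_nonneg_pos)
  show ?thesis
  proof (rule H10_I[OF S *])
    fix \<epsilon> :: real assume "\<epsilon> > 0"
    then obtain \<phi> where \<phi>: "\<phi> \<in> test_functions S"
      "H1_energy S (\<lambda>x. u x - \<phi> x) (\<lambda>x. g x - grad \<phi> x) < \<epsilon> / D"
      using H10_approx[OF S u g, of "\<epsilon> / D"] D by auto
    define w where "w x = u x - \<phi> x" for x
    define h where "h x = g x - grad \<phi> x" for x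
    have wsq: "square_integrable S w" and h: "has_weak_gradient S w h"
      unfolding w_def h_def by (intro sqint_diff has_weak_gradient_minus_test S sq g test_sqint \<phi>)+
    have \<eta>\<phi>: "(\<lambda>x. \<eta> x * \<phi> x) \<in> test_functions S" by (intro test_functions_mult \<phi> sm S)
    have "smooth_on (Suc 0) UNIV \<phi>" using \<phi> unfolding test_functions_Cc Cc_def by blast
    then have d: "grad (\<lambda>x. \<eta> x * \<phi> x) x = \<eta> x *\<^sub>R grad \<phi> x + \<phi> x *\<^sub>R grad \<eta> x"
      if "x \<in> S" for x
      using that sm[of "Suc 0"] by (auto simp: vec_eq_iff partial_deriv_mult)
    have pt: "(\<eta> x * u x - \<eta> x * \<phi> x)\<^sup>2 + (norm ((\<eta> x *\<^sub>R g x + u x *\<^sub>R grad \<eta> x) - grad (\<lambda>x. \<eta> x * \<phi> x) x))\<^sup>2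
        \<le> D * ((w x)\<^sup>2 + (norm (h x))\<^sup>2)" if x: "x \<in> S" for x
    proof -
      have c: "(\<eta> x)\<^sup>2 \<le> C\<^sup>2" using bd(1)[OF x] by (intro abs_le_square_iff[THEN iffD1]) auto
      have "(norm (grad \<eta> x))\<^sup>2 = (\<Sum>k\<in>UNIV. (partial_deriv k \<eta> x)\<^sup>2)"
        unfolding power2_norm_eq_inner inner_vec_def by (simp add: power2_eq_square)
      also have "\<dots> \<le> (\<Sum>k\<in>(UNIV::'a set). C\<^sup>2)"
        by (intro sum_mono abs_le_square_iff[THEN iffD1]) (use bd(2)[OF x] in \<open>auto intro: order_trans[OF _ abs_ge_self]\<close>)
      finally have gb: "(norm (grad \<eta> x))\<^sup>2 \<le> N * C\<^sup>2" by (simp add: N_def)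
      have "(\<eta> x * u x - \<eta> x * \<phi> x)\<^sup>2 = (\<eta> x)\<^sup>2 * (w x)\<^sup>2"
        by (simp add: w_def power_mult_distrib[symmetric] right_diff_distrib)
      also have "\<dots> \<le> C\<^sup>2 * (w x)\<^sup>2" by (intro mult_right_mono c) auto
      finally have 1: "(\<eta> x * u x - \<eta> x * \<phi> x)\<^sup>2 \<le> C\<^sup>2 * (w x)\<^sup>2" .
      have "(\<eta> x *\<^sub>R g x + u x *\<^sub>R grad \<eta> x) - grad (\<lambda>x. \<eta> x * \<phi> x) x = \<eta> x *\<^sub>R h x + w x *\<^sub>R grad \<eta> x"
        by (simp add: d[OF x] w_def h_def algebra_simps)
      then have "(norm ((\<eta> x *\<^sub>R g x + u x *\<^sub>R grad \<eta> x) - grad (\<lambda>x. \<eta> x * \<phi> x) x))\<^sup>2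
        \<le> 2 * ((\<eta> x)\<^sup>2 * (norm (h x))\<^sup>2) + 2 * ((w x)\<^sup>2 * (norm (grad \<eta> x))\<^sup>2)"
        using norm_add_square_le_weighted[of 1 "\<eta> x *\<^sub>R h x" "w x *\<^sub>R grad \<eta> x"] by (simp add: power_mult_distrib)
      also have "\<dots> \<le> 2 * (C\<^sup>2 * (norm (h x))\<^sup>2) + 2 * ((w x)\<^sup>2 * (N * C\<^sup>2))"
        by (intro add_mono mult_left_mono mult_right_mono c gb) auto
      finally have "(\<eta> x * u x - \<eta> x * \<phi> x)\<^sup>2 + (norm ((\<eta> x *\<^sub>R g x + u x *\<^sub>R grad \<eta> x) - grad (\<lambda>x. \<eta> x * \<phi> x) x))\<^sup>2
        \<le> C\<^sup>2 * (w x)\<^sup>2 + (2 * (C\<^sup>2 * (norm (h x))\<^sup>2) + 2 * ((w x)\<^sup>2 * (N * C\<^sup>2)))"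
        using 1 by simp
      also have "\<dots> \<le> D * ((w x)\<^sup>2 + (norm (h x))\<^sup>2)"
      proof -
        have "D * ((w x)\<^sup>2 + (norm (h x))\<^sup>2) - (C\<^sup>2 * (w x)\<^sup>2 + (2 * (C\<^sup>2 * (norm (h x))\<^sup>2) + 2 * ((w x)\<^sup>2 * (N * C\<^sup>2))))
          = (2 * C\<^sup>2 + 1) * (w x)\<^sup>2 + (C\<^sup>2 + 2 * N * C\<^sup>2 + 1) * (norm (h x))\<^sup>2"
          by (simp add: D_def algebra_simps)
        also have "\<dots> \<ge> 0" by (intro add_nonneg_nonneg mult_nonneg_nonneg) (auto simp: N_def)
        finally show ?thesis by simp
      qed
      finally show ?thesis .
    qed
    have "H1_energy S (\<lambda>x. \<eta> x * u x - \<eta> x * \<phi> x) (\<lambda>x. (\<eta> x *\<^sub>R g x + u x *\<^sub>R grad \<eta> x) - grad (\<lambda>x. \<eta> x * \<phi> x) x)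
      \<le> (LINT x|lebesgue_on S. D * ((w x)\<^sup>2 + (norm (h x))\<^sup>2))"
      unfolding H1_energy_def
      by (intro integral_mono H1_energy_integrable sqint_diff * test_sqint[OF S \<eta>\<phi>]
           has_weak_gradient_minus_test[OF S * \<eta>\<phi>] integrable_mult_right h wsq) (use pt in auto)
    also have "\<dots> = D * H1_energy S w h" by (simp add: H1_energy_def)
    also have "\<dots> < \<epsilon>" using \<phi>(2) D by (simp add: w_def[abs_def] h_def[abs_def] field_simps)
    finally have E: "H1_energy S (\<lambda>x. \<eta> x * u x - \<eta> x * \<phi> x)
        (\<lambda>x. (\<eta> x *\<^sub>R g x + u x *\<^sub>R grad \<eta> x) - grad (\<lambda>x. \<eta> x * \<phi> x) x) < \<epsilon>" .
    show "\<exists>\<phi>\<in>test_functions S. H1_energy S (\<lambda>x. \<eta> x * u x - \<phi> x) (\<lambda>x. (\<eta> x *\<^sub>R g x + u x *\<^sub>R grad \<eta> x) - grad \<phi> x) < \<epsilon>"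
    proof (rule bexI[where x = "\<lambda>x. \<eta> x * \<phi> x"])
      show "H1_energy S (\<lambda>x. \<eta> x * u x - \<eta> x * \<phi> x)
        (\<lambda>x. (\<eta> x *\<^sub>R g x + u x *\<^sub>R grad \<eta> x) - grad (\<lambda>x. \<eta> x * \<phi> x) x) < \<epsilon>" by (rule E)
    qed (rule \<eta>\<phi>)
  qed
qed

section \<open>Invariance of Lebesgue measure under isometries\<close>

text \<open>
  A well-ordered copy of a finite type. That isometries preserve Lebesgue measure is a theorem
  about coordinates with a well-ordered index type; the copy transports it to all finite index
  types.
\<close>

typedef (overloaded) 'a ranked = "UNIV :: 'a::finite set" by simp

instance ranked :: (finite) finite
proof
  show "finite (UNIV :: 'a ranked set)"
    by (rule finite_imageD[of Rep_ranked]) (auto simp: inj_on_def Rep_ranked_inject)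
qed

instantiation ranked :: (finite) wellorder
begin

definition less_eq_ranked :: "'a ranked \<Rightarrow> 'a ranked \<Rightarrow> bool" where
  "a \<le> b \<longleftrightarrow> to_nat (Rep_ranked a) \<le> to_nat (Rep_ranked b)"

definition less_ranked :: "'a ranked \<Rightarrow> 'a ranked \<Rightarrow> bool" where
  "a < b \<longleftrightarrow> to_nat (Rep_ranked a) < to_nat (Rep_ranked b)"

instance
proof
  fix a b :: "'a ranked"
  show "a \<le> b \<Longrightarrow> b \<le> a \<Longrightarrow> a = b"
    by (simp add: less_eq_ranked_def Rep_ranked_inject)
next
  fix P and a :: "'a ranked"
  assume step: "\<And>x :: 'a ranked. (\<And>y. y < x \<Longrightarrow> P y) \<Longrightarrow> P x"
  show "P a"
  proof (induction a rule: measure_induct_rule[of "\<lambda>a. to_nat (Rep_ranked a)"])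
    case (less a)
    show ?case by (rule step, rule less) (simp add: less_ranked_def)
  qed
qed (auto simp: less_eq_ranked_def less_ranked_def)

end

definition reindex :: "('m \<Rightarrow> 'n) \<Rightarrow> real^'n::finite \<Rightarrow> real^'m::finite" where
  "reindex \<pi> x = (\<chi> k. x $ \<pi> k)"

lemma reindex_nth [simp]: "reindex \<pi> x $ k = x $ \<pi> k"
  by (simp add: reindex_def)

lemma linear_reindex: "linear (reindex \<pi>)"
  by (rule linearI) (auto simp: vec_eq_iff)

lemma bounded_linear_reindex: "bounded_linear (reindex \<pi>)"
  using linear_reindex linear_conv_bounded_linear by blast

lemma reindex_measurable: "reindex \<pi> \<in> borel_measurable borel"
  by (intro borel_measurable_continuous_onI linear_continuous_on bounded_linear_reindex)

lemma reindex_inverse: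
  assumes "bij \<pi>"
  shows "reindex (inv \<pi>) (reindex \<pi> x) = x" "reindex \<pi> (reindex (inv \<pi>) y) = y"
  using assms by (simp_all add: vec_eq_iff surj_f_inv_f[OF bij_is_surj] inv_f_f[OF bij_is_inj])

lemma inner_reindex:
  assumes "bij \<pi>"
  shows "reindex \<pi> x \<bullet> reindex \<pi> y = x \<bullet> y"
  using sum.reindex_bij_betw[of \<pi> UNIV UNIV "\<lambda>k. x $ k * y $ k"] assms
  by (simp add: inner_vec_def)

lemma norm_reindex: "bij \<pi> \<Longrightarrow> norm (reindex \<pi> x) = norm x"
  by (simp add: norm_eq_sqrt_inner inner_reindex)

lemma prod_Basis_cart:
  fixes x :: "real^'n::finite"
  shows "(\<Prod>b\<in>Basis. x \<bullet> b) = (\<Prod>k\<in>UNIV. x $ k)"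
proof -
  have B: "(Basis :: (real^'n) set) = (\<lambda>k. axis k 1) ` UNIV" by (auto simp: Basis_vec_def)
  have "inj (\<lambda>k::'n. axis k (1::real))" by (auto simp: inj_def axis_eq_axis)
  then show ?thesis unfolding B by (subst prod.reindex) (auto simp: inner_axis)
qed

lemma distr_lborel_reindex:
  assumes "bij (\<pi> :: 'm::finite \<Rightarrow> 'n::finite)"
  shows "distr lborel borel (reindex \<pi>) = (lborel :: (real^'m) measure)"
proof (rule lborel_eqI[symmetric])
  fix l u :: "real^'m"
  assume "\<And>b. b \<in> Basis \<Longrightarrow> l \<bullet> b \<le> u \<bullet> b"
  from this[of "axis _ 1"] have lu: "l $ k \<le> u $ k" for k
    by (simp add: inner_axis)
  let ?l = "reindex (inv \<pi>) l" and ?u = "reindex (inv \<pi>) u"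
  have pre: "reindex \<pi> -` box l u = box ?l ?u"
  proof (intro set_eqI)
    fix x
    have "(\<forall>k. Q k (\<pi> k)) \<longleftrightarrow> (\<forall>k. Q (inv \<pi> k) k)" for Q
    proof (intro iffI allI)
      fix k assume "\<forall>k. Q k (\<pi> k)"
      then have "Q (inv \<pi> k) (\<pi> (inv \<pi> k))" by blast
      then show "Q (inv \<pi> k) k" using surj_f_inv_f[OF bij_is_surj[OF assms], of k] by simp
    next
      fix k assume "\<forall>k. Q (inv \<pi> k) k"
      then have "Q (inv \<pi> (\<pi> k)) (\<pi> k)" by blast
      then show "Q k (\<pi> k)" using inv_f_f[OF bij_is_inj[OF assms], of k] by simp
    qed
    from this[of "\<lambda>k k'. l $ k < x $ k' \<and> x $ k' < u $ k"]
    show "x \<in> reindex \<pi> -` box l u \<longleftrightarrow> x \<in> box ?l ?u" by (simp add: mem_box_cart)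
  qed
  have "emeasure (distr lborel borel (reindex \<pi>)) (box l u) = emeasure lborel (box ?l ?u)"
    using reindex_measurable by (subst emeasure_distr) (auto simp: pre)
  also have "\<dots> = (\<Prod>b\<in>Basis. (?u - ?l) \<bullet> b)"
    using lu by (intro emeasure_lborel_box) (auto simp: Basis_vec_def inner_axis)
  also have "(\<Prod>b\<in>Basis. (?u - ?l) \<bullet> b) = (\<Prod>k\<in>UNIV. (u - l) $ k)"
    unfolding prod_Basis_cart
    using prod.reindex_bij_betw[of "inv \<pi>" UNIV UNIV "\<lambda>k. (u - l) $ k"] bij_imp_bij_inv[OF assms] by simp
  finally show "emeasure (distr lborel borel (reindex \<pi>)) (box l u) = (\<Prod>b\<in>Basis. (u - l) \<bullet> b)"
    by (simp add: prod_Basis_cart)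
qed simp

lemma orthogonal_borel_measurable:
  fixes f :: "real^'n::finite \<Rightarrow> real^'n"
  assumes "orthogonal_transformation f"
  shows "f \<in> borel_measurable borel"
  using orthogonal_transformation_linear[OF assms] linear_continuous_on[of f UNIV]
  by (intro borel_measurable_continuous_onI) (simp add: linear_conv_bounded_linear)

lemma distr_lborel_orthogonal_wellorder:
  fixes f :: "real^'n::{finite,wellorder} \<Rightarrow> real^'n::_"
  assumes f: "orthogonal_transformation f"
  shows "distr lborel borel f = lborel"
proof (rule lborel_eqI[symmetric])
  fix l u :: "real^'n::_"
  assume lu: "\<And>b. b \<in> Basis \<Longrightarrow> l \<bullet> b \<le> u \<bullet> b"
  have fm: "f \<in> borel_measurable borel" by (rule orthogonal_borel_measurable[OF f])
  have vim: "f -` box l u = inv f ` box l u"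
    using orthogonal_transformation_bij[OF f] by (simp add: bij_vimage_eq_inv_image)
  have fi: "orthogonal_transformation (inv f)" by (rule orthogonal_transformation_inv[OF f])
  have "measure lebesgue (f -` box l u) = measure lebesgue (box l u)"
    unfolding vim by (rule measure_orthogonal_image[OF fi]) simp
  moreover have "f -` box l u \<in> lmeasurable"
    unfolding vim by (rule measurable_orthogonal_image[OF fi]) simp
  ultimately have "emeasure lebesgue (f -` box l u) = emeasure lebesgue (box l u)"
    using emeasure_eq_measure2[of "f -` box l u" lebesgue] emeasure_eq_measure2[of "box l u" lebesgue] by simp
  moreover have "f -` box l u \<in> sets borel" using measurable_sets[OF fm, of "box l u"] by simp
  ultimately have "emeasure lborel (f -` box l u) = emeasure lborel (box l u)"
    by simp
  then show "emeasure (distr lborel borel f) (box l u) = (\<Prod>b\<in>Basis. (u - l) \<bullet> b)"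
    using fm lu by (subst emeasure_distr) auto
qed simp

text \<open>
  Conjugate the isometry to one on a space with well-ordered coordinates.
\<close>

lemma distr_lborel_orthogonal:
  fixes f :: "real^'n::finite \<Rightarrow> real^'n"
  assumes f: "orthogonal_transformation f"
  shows "distr lborel borel f = lborel"
proof -
  define \<rho> :: "'n ranked \<Rightarrow> 'n" where "\<rho> = Rep_ranked"
  have \<rho>: "bij \<rho>" unfolding \<rho>_def
    by (rule bij_betw_byWitness[where f' = Abs_ranked]) (auto simp: Rep_ranked_inverse Abs_ranked_inverse)
  define F where "F = reindex \<rho> \<circ> f \<circ> reindex (inv \<rho>)"
  have lf: "linear f" by (rule orthogonal_transformation_linear[OF f])
  have fm: "f \<in> borel_measurable borel" by (rule orthogonal_borel_measurable[OF f])
  have "linear F" unfolding F_def by (intro linear_compose linear_reindex lf)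
  moreover have "norm (F x) = norm x" for x
    using f \<rho> bij_imp_bij_inv[OF \<rho>] by (simp add: F_def norm_reindex orthogonal_transformation)
  ultimately have oF: "orthogonal_transformation F" by (simp add: orthogonal_transformation)
  have feq: "f = reindex (inv \<rho>) \<circ> (F \<circ> reindex \<rho>)"
    by (simp add: F_def fun_eq_iff reindex_inverse[OF \<rho>])
  have Fm: "F \<in> borel_measurable borel"
    unfolding F_def by (intro measurable_comp[OF reindex_measurable measurable_comp[OF fm reindex_measurable]])
  have Fr: "F \<circ> reindex \<rho> \<in> borel_measurable borel"
    by (rule measurable_comp[OF reindex_measurable Fm])
  have "distr lborel borel f = distr (distr (distr lborel borel (reindex \<rho>)) borel F) borel (reindex (inv \<rho>))"
    by (simp add: feq distr_distr reindex_measurable Fm Fr comp_assoc)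
  also have "\<dots> = lborel"
    by (simp add: distr_lborel_reindex[OF \<rho>] distr_lborel_orthogonal_wellorder[OF oF] distr_lborel_reindex[OF bij_imp_bij_inv[OF \<rho>]])
  finally show ?thesis .
qed

definition isometry_of :: "(real^'n::finite) set \<Rightarrow> (real^'n \<Rightarrow> real^'n) \<Rightarrow> bool" where
  "isometry_of S f \<longleftrightarrow> orthogonal_transformation f \<and> (\<forall>x. f x \<in> S \<longleftrightarrow> x \<in> S)"

lemma distr_lebesgue_on_isometry:
  assumes f: "isometry_of S f" and S: "S \<in> sets lebesgue"
  shows "f \<in> measurable (lebesgue_on S) (lebesgue_on S)" "distr (lebesgue_on S) (lebesgue_on S) f = lebesgue_on S"
proof -
  have of: "orthogonal_transformation f" and fS: "\<And>x. f x \<in> S \<longleftrightarrow> x \<in> S"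
    using f by (auto simp: isometry_of_def)
  have fm: "f \<in> borel_measurable borel" by (rule orthogonal_borel_measurable[OF of])
  have fm': "f \<in> measurable lebesgue lborel" using fm by (simp add: measurable_completion)
  have d: "distr lebesgue lborel f = lborel"
    using distr_lborel_orthogonal[OF of] fm distr_completion[of f lborel lborel] by (simp cong: distr_cong)
  have m: "f \<in> measurable lebesgue lebesgue"
    using completion.measurable_completion2[OF fm'] d by simp
  have dl: "distr lebesgue lebesgue f = lebesgue"
    using completion.completion_distr_eq[OF fm'] d by simp
  show mS: "f \<in> measurable (lebesgue_on S) (lebesgue_on S)"
    by (rule measurable_restrict_space3[OF m]) (use fS in auto)
  show "distr (lebesgue_on S) (lebesgue_on S) f = lebesgue_on S"
  proof (rule measure_eqI)
    fix A assume "A \<in> sets (distr (lebesgue_on S) (lebesgue_on S) f)"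
    then have A: "A \<in> sets lebesgue" "A \<subseteq> S" using S by (auto simp: sets_restrict_space_iff)
    have pre: "f -` A \<inter> S = f -` A \<inter> space lebesgue" using A fS by auto
    have pA: "f -` A \<inter> space lebesgue \<in> sets lebesgue" by (rule measurable_sets[OF m A(1)])
    have "emeasure (distr (lebesgue_on S) (lebesgue_on S) f) A = emeasure lebesgue (f -` A \<inter> space lebesgue)"
    proof -
      have "f -` A \<subseteq> S" using A(2) fS by blast
      then have "emeasure (lebesgue_on S) (f -` A) = emeasure lebesgue (f -` A)"
        using S by (intro emeasure_restrict_space) auto
      moreover have "f -` A \<inter> S = f -` A" using \<open>f -` A \<subseteq> S\<close> by blast
      ultimately show ?thesis
        using A S mS by (subst emeasure_distr) (simp_all add: sets_restrict_space_iff del: emeasure_completion)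
    qed
    also have "\<dots> = emeasure (distr lebesgue lebesgue f) A" using m A by (simp add: emeasure_distr)
    also have "\<dots> = emeasure (lebesgue_on S) A" using A S by (simp add: dl emeasure_restrict_space)
    finally show "emeasure (distr (lebesgue_on S) (lebesgue_on S) f) A = emeasure (lebesgue_on S) A" .
  qed simp
qed

lemma isometry_integral:
  fixes h :: "real^'n::finite \<Rightarrow> real"
  assumes f: "isometry_of S f" and S: "S \<in> sets lebesgue" and h: "h \<in> borel_measurable (lebesgue_on S)"
  shows "(LINT x|lebesgue_on S. h (f x)) = (LINT x|lebesgue_on S. h x)"
    "integrable (lebesgue_on S) (\<lambda>x. h (f x)) \<longleftrightarrow> integrable (lebesgue_on S) h"
    "(\<lambda>x. h (f x)) \<in> borel_measurable (lebesgue_on S)"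
  using integral_distr[OF distr_lebesgue_on_isometry(1)[OF f S] h]
    integrable_distr_eq[OF distr_lebesgue_on_isometry(1)[OF f S] h]
    measurable_compose[OF distr_lebesgue_on_isometry(1)[OF f S] h]
    distr_lebesgue_on_isometry(2)[OF f S] by simp_all

lemma isometry_AE:
  assumes f: "isometry_of S f" and S: "S \<in> sets lebesgue" and P: "AE x in lebesgue_on S. P x"
  shows "AE x in lebesgue_on S. P (f x)"
  by (rule AE_distrD[OF distr_lebesgue_on_isometry(1)[OF f S], of P])
    (simp only: distr_lebesgue_on_isometry(2)[OF f S] P)

lemma isometry_sqint:
  assumes f: "isometry_of S f" and S: "S \<in> sets lebesgue" and h: "square_integrable S h"
  shows "square_integrable S (\<lambda>x. h (f x))"
  using isometry_integral(3)[OF f S sqint_measurable[OF h]] h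
    isometry_integral(2)[OF f S borel_measurable_power[OF sqint_measurable[OF h]], of 2]
  by (simp add: square_integrable_def)

section \<open>Coordinate permutations\<close>

definition perm_invariant :: "(real^'n::finite) set \<Rightarrow> bool" where
  "perm_invariant S \<longleftrightarrow> (\<forall>\<pi> x. bij \<pi> \<longrightarrow> (reindex \<pi> x \<in> S \<longleftrightarrow> x \<in> S))"

lemma isometry_reindex: "perm_invariant S \<Longrightarrow> bij \<pi> \<Longrightarrow> isometry_of S (reindex \<pi>)"
  by (auto simp: isometry_of_def perm_invariant_def orthogonal_transformation norm_reindex linear_reindex)

lemma has_derivative_reindex_comp:
  assumes "bij (\<pi> :: 'n::finite \<Rightarrow> 'n)" "f differentiable (at (reindex \<pi> x))"
  shows "((\<lambda>x. f (reindex \<pi> x)) has_derivative (\<lambda>h. reindex (inv \<pi>) (grad f (reindex \<pi> x)) \<bullet> h)) (at x)"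
proof -
  have "(reindex \<pi> has_derivative reindex \<pi>) (at x)"
    by (rule bounded_linear_imp_has_derivative[OF bounded_linear_reindex])
  from has_derivative_compose[OF this has_derivative_grad[OF assms(2)]]
  have "((\<lambda>x. f (reindex \<pi> x)) has_derivative (\<lambda>h. grad f (reindex \<pi> x) \<bullet> reindex \<pi> h)) (at x)" .
  moreover have "grad f (reindex \<pi> x) \<bullet> reindex \<pi> h = reindex (inv \<pi>) (grad f (reindex \<pi> x)) \<bullet> h" for h
    using inner_reindex[OF bij_imp_bij_inv[OF assms(1)], of "grad f (reindex \<pi> x)" "reindex \<pi> h"]
    by (simp add: reindex_inverse[OF assms(1)])
  ultimately show ?thesis by simp
qed

lemma smooth_on_reindex:
  assumes "bij (\<pi> :: 'n::finite \<Rightarrow> 'n)"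
  shows "smooth_on l UNIV f \<Longrightarrow> smooth_on l UNIV (\<lambda>x. f (reindex \<pi> x))"
proof (induction l arbitrary: f)
  case 0
  have "continuous_on UNIV (reindex \<pi> :: real^'n \<Rightarrow> real^'n)"
    by (rule linear_continuous_on[OF bounded_linear_reindex])
  with 0 show ?case using continuous_on_compose2[of UNIV f UNIV "reindex \<pi>"] by simp
next
  case (Suc l)
  have "partial_deriv k (\<lambda>x. f (reindex \<pi> x)) = (\<lambda>x. partial_deriv (inv \<pi> k) f (reindex \<pi> x))" for k
    using grad_eq(2)[OF has_derivative_reindex_comp[OF assms]] Suc.prems by (auto simp: fun_eq_iff)
  then show ?case
    using Suc differentiableI[OF has_derivative_reindex_comp[OF assms]] by auto
qed

lemma test_functions_reindex:
  assumes S: "perm_invariant S" and p: "bij \<pi>" and \<phi>: "\<phi> \<in> test_functions S"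
  shows "(\<lambda>x. \<phi> (reindex \<pi> x)) \<in> test_functions S"
    "grad (\<lambda>x. \<phi> (reindex \<pi> x)) x = reindex (inv \<pi>) (grad \<phi> (reindex \<pi> x))"
proof -
  show "(\<lambda>x. \<phi> (reindex \<pi> x)) \<in> test_functions S"
    unfolding test_functions_Cc
  proof
    fix l
    have "\<phi> \<in> Cc l S" using \<phi> by (simp add: test_functions_Cc)
    then obtain K where K: "smooth_on l UNIV \<phi>" "compact K" "K \<subseteq> S" "\<And>x. x \<notin> K \<Longrightarrow> \<phi> x = 0"
      using CcE by blast
    show "(\<lambda>x. \<phi> (reindex \<pi> x)) \<in> Cc l S"
    proof (rule CcI[where K = "reindex (inv \<pi>) ` K"])
      show "smooth_on l UNIV (\<lambda>x. \<phi> (reindex \<pi> x))" by (rule smooth_on_reindex[OF p K(1)])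
      show "compact (reindex (inv \<pi>) ` K)"
        by (intro compact_continuous_image linear_continuous_on bounded_linear_reindex K)
      show "reindex (inv \<pi>) ` K \<subseteq> S"
        using S K(3) bij_imp_bij_inv[OF p] unfolding perm_invariant_def by blast
      fix x assume "x \<notin> reindex (inv \<pi>) ` K"
      then have "reindex \<pi> x \<notin> K" using reindex_inverse(1)[OF p, of x] by force
      then show "\<phi> (reindex \<pi> x) = 0" by (rule K(4))
    qed
  qed
  have "\<phi> \<in> Cc (Suc 0) S" using \<phi> by (simp add: test_functions_Cc)
  then have "\<phi> differentiable (at (reindex \<pi> x))" by (simp add: Cc_def)
  from grad_eq(1)[OF has_derivative_reindex_comp[OF p this]]
  show "grad (\<lambda>x. \<phi> (reindex \<pi> x)) x = reindex (inv \<pi>) (grad \<phi> (reindex \<pi> x))" .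
qed

text \<open>
  Change variables so that the permutation acts on the test function instead of \<open>u\<close>.
\<close>

lemma has_weak_gradient_reindex:
  assumes o: "open S" and S: "perm_invariant S" and p: "bij \<pi>" and u: "square_integrable S u" and g: "has_weak_gradient S u g"
  shows "has_weak_gradient S (\<lambda>x. u (reindex \<pi> x)) (\<lambda>x. reindex (inv \<pi>) (g (reindex \<pi> x)))"
  unfolding has_weak_gradient_def
proof (intro conjI allI ballI)
  have Sm: "S \<in> sets lebesgue" using o by auto
  note iso = isometry_reindex[OF S p]
  fix k show "square_integrable S (\<lambda>x. reindex (inv \<pi>) (g (reindex \<pi> x)) $ k)"
    using isometry_sqint[OF iso Sm has_weak_gradient_sqint[OF g]] by simp
next
  have Sm: "S \<in> sets lebesgue" using o by auto
  note iso = isometry_reindex[OF S p]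
  fix \<phi> k assume \<phi>: "\<phi> \<in> test_functions S"
  define \<psi> where "\<psi> = (\<lambda>x. \<phi> (reindex (inv \<pi>) x))"
  have \<psi>: "\<psi> \<in> test_functions S" unfolding \<psi>_def by (intro test_functions_reindex S bij_imp_bij_inv p \<phi>)
  have \<phi>\<psi>: "\<phi> x = \<psi> (reindex \<pi> x)" for x by (simp add: \<psi>_def reindex_inverse[OF p])
  have d: "partial_deriv k \<phi> x = partial_deriv (inv \<pi> k) \<psi> (reindex \<pi> x)" for x
    using test_functions_reindex(2)[OF S p \<psi>, of x]
    by (simp add: \<phi>\<psi>[symmetric] vec_eq_iff)
  have "(LINT x|lebesgue_on S. u (reindex \<pi> x) * partial_deriv k \<phi> x)
    = (LINT x|lebesgue_on S. u x * partial_deriv (inv \<pi> k) \<psi> x)"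
    unfolding d using isometry_integral(1)[OF iso Sm, of "\<lambda>x. u x * partial_deriv (inv \<pi> k) \<psi> x"]
      sqint_measurable[OF u] sqint_measurable[OF test_sqint(2)[OF o \<psi>]] by simp
  also have "\<dots> = - (LINT x|lebesgue_on S. g x $ inv \<pi> k * \<psi> x)"
    by (rule has_weak_gradient_eq[OF g \<psi>])
  also have "(LINT x|lebesgue_on S. g x $ inv \<pi> k * \<psi> x) = (LINT x|lebesgue_on S. reindex (inv \<pi>) (g (reindex \<pi> x)) $ k * \<phi> x)"
    unfolding \<phi>\<psi> using isometry_integral(1)[OF iso Sm, of "\<lambda>x. g x $ inv \<pi> k * \<psi> x"]
      sqint_measurable[OF has_weak_gradient_sqint[OF g]] sqint_measurable[OF test_sqint(1)[OF o \<psi>]] by simp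
  finally show "(LINT x|lebesgue_on S. u (reindex \<pi> x) * partial_deriv k \<phi> x)
    = - (LINT x|lebesgue_on S. reindex (inv \<pi>) (g (reindex \<pi> x)) $ k * \<phi> x)" .
qed

lemma H10_reindex:
  assumes o: "open S" and S: "perm_invariant S" and p: "bij \<pi>" and u: "u \<in> H10 S"
  shows "(\<lambda>x. u (reindex \<pi> x)) \<in> H10 S"
proof -
  have Sm: "S \<in> sets lebesgue" using o by auto
  note iso = isometry_reindex[OF S p]
  define g where "g = weak_grad S u"
  have sq: "square_integrable S u" and g: "has_weak_gradient S u g"
    using u H1_sqint H1_weak_grad H10_H1 unfolding g_def by blast+
  show ?thesis
  proof (rule H10_I[OF o isometry_sqint[OF iso Sm sq] has_weak_gradient_reindex[OF o S p sq g]])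
    fix \<epsilon> :: real assume "\<epsilon> > 0"
    then obtain \<phi> where \<phi>: "\<phi> \<in> test_functions S"
      "H1_energy S (\<lambda>x. u x - \<phi> x) (\<lambda>x. g x - grad \<phi> x) < \<epsilon>"
      using H10_approx[OF o u g] by auto
    have m: "(\<lambda>x. (u x - \<phi> x)\<^sup>2 + (norm (g x - grad \<phi> x))\<^sup>2) \<in> borel_measurable (lebesgue_on S)"
      using H1_energy_integrable[OF sqint_diff[OF sq test_sqint(1)[OF o \<phi>(1)]] has_weak_gradient_minus_test[OF o sq g \<phi>(1)]]
      by auto
    have n: "norm (reindex (inv \<pi>) (g (reindex \<pi> x)) - grad (\<lambda>x. \<phi> (reindex \<pi> x)) x) = norm (g (reindex \<pi> x) - grad \<phi> (reindex \<pi> x))" for x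
      unfolding test_functions_reindex(2)[OF S p \<phi>(1)]
      by (metis linear_diff linear_reindex norm_reindex bij_imp_bij_inv p)
    have "H1_energy S (\<lambda>x. u (reindex \<pi> x) - \<phi> (reindex \<pi> x)) (\<lambda>x. reindex (inv \<pi>) (g (reindex \<pi> x)) - grad (\<lambda>x. \<phi> (reindex \<pi> x)) x) < \<epsilon>"
      using isometry_integral(1)[OF iso Sm m] \<phi>(2) by (simp add: H1_energy_def n)
    then show "\<exists>\<phi>\<in>test_functions S. H1_energy S (\<lambda>x. u (reindex \<pi> x) - \<phi> x) (\<lambda>x. reindex (inv \<pi>) (g (reindex \<pi> x)) - grad \<phi> x) < \<epsilon>"
      using test_functions_reindex(1)[OF S p \<phi>(1)] by (intro bexI[where x = "\<lambda>x. \<phi> (reindex \<pi> x)"])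
  qed
qed

section \<open>The annulus\<close>

lemma annulus_geometry:
  fixes r :: real
  shows "open (annulus r :: (real^'n::finite) set)" "(annulus r :: (real^'n) set) \<in> lmeasurable"
    "perm_invariant (annulus r :: (real^'n) set)"
proof -
  have "annulus r = norm -` {r<..<1} \<inter> (UNIV :: (real^'n) set)" by (auto simp: annulus_def)
  then show o: "open (annulus r :: (real^'n) set)"
    using open_vimage[of "{r<..<1}" "norm :: real^'n \<Rightarrow> real"] by (simp add: continuous_on_norm continuous_on_id)
  have "bounded (annulus r :: (real^'n) set)"
    by (rule bounded_subset[OF bounded_ball[of 0 1]]) (auto simp: annulus_def)
  then show "(annulus r :: (real^'n) set) \<in> lmeasurable" using o by (rule lmeasurable_open)
  show "perm_invariant (annulus r :: (real^'n) set)"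
    by (auto simp: perm_invariant_def annulus_def norm_reindex)
qed

lemma annulus_pos: "0 < r \<Longrightarrow> x \<in> annulus r \<Longrightarrow> norm x > 0 \<and> x \<noteq> 0"
  by (auto simp: annulus_def)

lemma measurable_on_annulus:
  "continuous_on (annulus r) f \<Longrightarrow> f \<in> borel_measurable (lebesgue_on (annulus r))"
  using annulus_geometry(2) by (intro continuous_imp_measurable_on_sets_lebesgue) auto

lemma sqint_div_norm:
  fixes u :: "real^'n::finite \<Rightarrow> real"
  assumes "0 < r" "square_integrable (annulus r) u"
  shows "square_integrable (annulus r) (\<lambda>x. u x / norm x)"
proof -
  have "square_integrable (annulus r) (\<lambda>x. inverse (norm x) * u x)"
  proof (rule sqint_bounded_mult[OF assms(2)])
    show "(\<lambda>x::real^'n. inverse (norm x)) \<in> borel_measurable (lebesgue_on (annulus r))"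
      by (intro measurable_on_annulus continuous_intros) (use assms(1) in \<open>auto simp: annulus_def\<close>)
    show "\<bar>inverse (norm x)\<bar> \<le> inverse r" if "x \<in> annulus r" for x :: "real^'n"
      using that assms(1) by (auto simp: annulus_def intro!: le_imp_inverse_le)
  qed
  then show ?thesis by (simp add: divide_inverse mult.commute)
qed

lemma inverse_square_weight_le:
  fixes u :: "real^'n::finite \<Rightarrow> real"
  assumes r: "0 < r" and u: "square_integrable (annulus r) u"
  shows "r\<^sup>2 * (LINT x|lebesgue_on (annulus r). (u x / norm x)\<^sup>2) \<le> (LINT x|lebesgue_on (annulus r). (u x)\<^sup>2)"
proof -
  have "r\<^sup>2 * (LINT x|lebesgue_on (annulus r). (u x / norm x)\<^sup>2) = (LINT x|lebesgue_on (annulus r). r\<^sup>2 * (u x / norm x)\<^sup>2)"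
    by simp
  also have "\<dots> \<le> (LINT x|lebesgue_on (annulus r). (u x)\<^sup>2)"
  proof (rule integral_mono)
    show "integrable (lebesgue_on (annulus r)) (\<lambda>x. r\<^sup>2 * (u x / norm x)\<^sup>2)"
      using sqint_square[OF sqint_div_norm[OF r u]] by simp
    show "integrable (lebesgue_on (annulus r)) (\<lambda>x. (u x)\<^sup>2)" by (rule sqint_square[OF u])
    fix x :: "real^'n" assume "x \<in> space (lebesgue_on (annulus r))"
    then have x: "r < norm x" by (simp add: annulus_def)
    then have "(r / norm x)\<^sup>2 \<le> 1" using r by (intro power_le_one) (auto simp: divide_le_eq_1)
    then have "(r / norm x)\<^sup>2 * (u x)\<^sup>2 \<le> 1 * (u x)\<^sup>2" by (rule mult_right_mono) simp
    then show "r\<^sup>2 * (u x / norm x)\<^sup>2 \<le> (u x)\<^sup>2" by (simp add: power_divide)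
  qed
  finally show ?thesis .
qed

section \<open>The Hardy-Poincare inequality on the annulus\<close>

text \<open>
  Barta's method. For the radial field \<open>F x = q |x| x\<close> the inequality \<open>0 \<le> |\<nabla>\<phi> + \<phi> F|\<^sup>2\<close> and the
  divergence theorem for \<open>\<phi>\<^sup>2 F\<close> give \<open>\<integral> (div F - |F|\<^sup>2) \<phi>\<^sup>2 \<le> \<integral> |\<nabla>\<phi>|\<^sup>2\<close>, and
  \<open>div F = N q + \<rho> q'\<close>. Thus a pointwise lower bound for the bracket suffices.
\<close>

lemma test_barta_inequality:
  fixes \<phi> :: "real^'n::finite \<Rightarrow> real" and q q' :: "real \<Rightarrow> real"
  assumes r: "0 < r" and \<phi>: "\<phi> \<in> test_functions (annulus r)"
    and q: "\<And>\<rho>. r < \<rho> \<Longrightarrow> \<rho> < 1 \<Longrightarrow> (q has_real_derivative q' \<rho>) (at \<rho>)"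
    and q': "continuous_on {r<..<1} q'"
    and K: "\<And>\<rho>. r < \<rho> \<Longrightarrow> \<rho> < 1 \<Longrightarrow> K / \<rho>\<^sup>2 \<le> real CARD('n) * q \<rho> + \<rho> * q' \<rho> - (\<rho> * q \<rho>)\<^sup>2"
  shows "K * (LINT x|lebesgue_on (annulus r). (\<phi> x / norm x)\<^sup>2) \<le> (LINT x|lebesgue_on (annulus r). (norm (grad \<phi> x))\<^sup>2)"
proof -
  let ?S = "annulus r :: (real^'n) set"
  have o: "open ?S" by (rule annulus_geometry)
  have pos: "0 < norm x" "x \<noteq> 0" "r < norm x" "norm x < 1" if "x \<in> ?S" for x
    using that r by (auto simp: annulus_def)
  define F where "F k x = q (norm x) * x $ k" for k and x :: "real^'n"
  define v where "v k x = q (norm x) *\<^sub>R axis k 1 + (x $ k * (q' (norm x) / norm x)) *\<^sub>R x" for k and x :: "real^'n"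
  have qc: "continuous_on {r<..<1} q"
    by (intro continuous_at_imp_continuous_on ballI DERIV_isCont[OF q]) auto
  have dF: "(F k has_derivative (\<lambda>h. v k x \<bullet> h)) (at x)" if x: "x \<in> ?S" for k x
    using has_derivative_mult[OF has_derivative_radial[OF pos(2)[OF x] q[OF pos(3,4)[OF x]]] has_derivative_component[of k x]]
    unfolding F_def[abs_def] v_def by (simp add: inner_add_left algebra_simps)
  have sF: "smooth_on 1 ?S (F k)" for k
  proof (rule smooth_on_1I[OF o dF])
    have n: "continuous_on ?S norm" "norm ` ?S \<subseteq> {r<..<1}"
      by (auto intro: continuous_intros simp: annulus_def)
    note c = continuous_on_compose2[OF qc n] continuous_on_compose2[OF q' n]
    show "continuous_on ?S (\<lambda>x. v k x $ k')" for k'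
      unfolding v_def by (auto intro!: continuous_intros c dest: pos(2))
  qed
  \<comment> \<open>The components of the field \<open>\<phi>\<^sup>2 F\<close>.\<close>
  define G where "G k x = F k x * (\<phi> x * \<phi> x)" for k x
  have \<phi>1: "\<phi> \<in> Cc (Suc 0) ?S" using \<phi> by (simp add: test_functions_Cc)
  then have s\<phi>: "smooth_on (Suc 0) UNIV \<phi>" by (simp add: Cc_def)
  have \<phi>2: "(\<lambda>x. \<phi> x * \<phi> x) \<in> Cc (Suc 0) ?S"
    using smooth_on_subset[OF s\<phi>] by (intro Cc_mult[OF \<phi>1 _ o]) auto
  have G: "G k \<in> Cc (Suc 0) ?S" for k
    unfolding G_def using sF by (intro Cc_mult[OF \<phi>2 _ o]) simp
  have dG: "partial_deriv k (G k) x = 2 * \<phi> x * q (norm x) * (x $ k * grad \<phi> x $ k)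
      + (\<phi> x)\<^sup>2 * (q (norm x) + (x $ k * x $ k) * (q' (norm x) / norm x))" if x: "x \<in> ?S" for k x
  proof -
    have d: "\<phi> differentiable (at x)" using s\<phi> by simp
    have "partial_deriv k (F k) x = q (norm x) + (x $ k * x $ k) * (q' (norm x) / norm x)"
      using grad_eq(2)[OF dF[OF x]] by (simp add: v_def mult_ac)
    moreover have "F k differentiable (at x)" using dF[OF x] by (rule differentiableI)
    ultimately show ?thesis
      unfolding G_def partial_deriv_mult[OF \<open>F k differentiable (at x)\<close> differentiable_mult[OF d d]]
        partial_deriv_mult[OF d d]
      by (simp add: F_def power2_eq_square algebra_simps)
  qed
  have sG: "(\<Sum>k\<in>UNIV. partial_deriv k (G k) x) = 2 * \<phi> x * q (norm x) * (x \<bullet> grad \<phi> x)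
      + (\<phi> x)\<^sup>2 * (real CARD('n) * q (norm x) + norm x * q' (norm x))" if x: "x \<in> ?S" for x
  proof -
    have "(\<Sum>k\<in>UNIV. x $ k * x $ k) = norm x * norm x"
      using power2_norm_eq_inner[of x] by (simp add: inner_vec_def power2_eq_square)
    then have "(\<Sum>k\<in>UNIV. (x $ k * x $ k) * (q' (norm x) / norm x)) = norm x * q' (norm x)"
      using pos(1)[OF x] by (simp only: sum_distrib_right[symmetric]) simp
    then show ?thesis
      by (simp add: dG[OF x] sum.distrib sum_distrib_left[symmetric] inner_vec_def)
  qed
  have iG: "integrable (lebesgue_on ?S) (\<lambda>x. \<Sum>k\<in>UNIV. partial_deriv k (G k) x)"
    by (intro Bochner_Integration.integrable_sum Cc_lebesgue_on[OF Cc_partial[OF G] o])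
  have "(LINT x|lebesgue_on ?S. (\<Sum>k\<in>UNIV. partial_deriv k (G k) x)) = 0"
    using integral_partial_deriv_Cc[OF G o] Cc_lebesgue_on(1)[OF Cc_partial[OF G] o]
    by (subst Bochner_Integration.integral_sum) auto
  moreover have i1: "integrable (lebesgue_on ?S) (\<lambda>x. (norm (grad \<phi> x))\<^sup>2)"
    by (intro integrable_norm2_components has_weak_gradient_sqint[OF has_weak_gradient_test] o \<phi>)
  moreover have i2: "integrable (lebesgue_on ?S) (\<lambda>x. (\<phi> x / norm x)\<^sup>2)"
    by (intro sqint_square sqint_div_norm r test_sqint o \<phi>)
  moreover have "(LINT x|lebesgue_on ?S. K * (\<phi> x / norm x)\<^sup>2)
    \<le> (LINT x|lebesgue_on ?S. (norm (grad \<phi> x))\<^sup>2 + (\<Sum>k\<in>UNIV. partial_deriv k (G k) x))"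
  proof (rule integral_mono)
    show "integrable (lebesgue_on ?S) (\<lambda>x. K * (\<phi> x / norm x)\<^sup>2)" using i2 by simp
    show "integrable (lebesgue_on ?S) (\<lambda>x. (norm (grad \<phi> x))\<^sup>2 + (\<Sum>k\<in>UNIV. partial_deriv k (G k) x))"
      using i1 iG by simp
    fix x assume "x \<in> space (lebesgue_on ?S)"
    then have x: "x \<in> ?S" by simp
    have "0 \<le> (norm (grad \<phi> x + (q (norm x) * \<phi> x) *\<^sub>R x))\<^sup>2" by simp
    also have "\<dots> = (norm (grad \<phi> x))\<^sup>2 + 2 * \<phi> x * q (norm x) * (x \<bullet> grad \<phi> x) + (\<phi> x)\<^sup>2 * (norm x * q (norm x))\<^sup>2"
    proof -
      have "(norm (a + s *\<^sub>R x))\<^sup>2 = (norm a)\<^sup>2 + 2 * s * (x \<bullet> a) + s\<^sup>2 * (norm x)\<^sup>2" for a s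
        unfolding power2_norm_eq_inner
        by (simp add: inner_add_left inner_add_right inner_commute power2_eq_square algebra_simps)
      from this[of "grad \<phi> x" "q (norm x) * \<phi> x"] show ?thesis
        by (simp add: power_mult_distrib mult_ac)
    qed
    finally have 1: "0 \<le> (norm (grad \<phi> x))\<^sup>2 + 2 * \<phi> x * q (norm x) * (x \<bullet> grad \<phi> x) + (\<phi> x)\<^sup>2 * (norm x * q (norm x))\<^sup>2" .
    have "(\<phi> x)\<^sup>2 * (K / (norm x)\<^sup>2) \<le> (\<phi> x)\<^sup>2 * (real CARD('n) * q (norm x) + norm x * q' (norm x) - (norm x * q (norm x))\<^sup>2)"
      by (intro mult_left_mono K pos x) simp
    then have "K * (\<phi> x / norm x)\<^sup>2 \<le> (\<phi> x)\<^sup>2 * (real CARD('n) * q (norm x) + norm x * q' (norm x)) - (\<phi> x)\<^sup>2 * (norm x * q (norm x))\<^sup>2"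
      by (simp add: power_divide right_diff_distrib mult.commute)
    with 1 show "K * (\<phi> x / norm x)\<^sup>2 \<le> (norm (grad \<phi> x))\<^sup>2 + (\<Sum>k\<in>UNIV. partial_deriv k (G k) x)"
      unfolding sG[OF x] by linarith
  qed
  ultimately show ?thesis using iG by simp
qed

text \<open>
  Both sides are continuous in the \<open>H\<^sup>1\<close> norm, since \<open>1 / |x|\<close> is bounded on the annulus.
\<close>

lemma H10_hardy_of_test:
  fixes u :: "real^'n::finite \<Rightarrow> real"
  assumes r: "0 < r" and u: "u \<in> H10 (annulus r)" "has_weak_gradient (annulus r) u g" and K: "K \<ge> 0"
    and test: "\<And>\<phi> :: real^'n \<Rightarrow> real. \<phi> \<in> test_functions (annulus r) \<Longrightarrow>
      K * (LINT x|lebesgue_on (annulus r). (\<phi> x / norm x)\<^sup>2) \<le> (LINT x|lebesgue_on (annulus r). (norm (grad \<phi> x))\<^sup>2)"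
  shows "K * (LINT x|lebesgue_on (annulus r). (u x / norm x)\<^sup>2) \<le> (LINT x|lebesgue_on (annulus r). (norm (g x))\<^sup>2)"
    (is "K * ?X \<le> ?G")
proof -
  let ?S = "annulus r :: (real^'n) set"
  have o: "open ?S" by (rule annulus_geometry)
  have sq: "square_integrable ?S u" using u H1_sqint H10_H1 by blast
  have main: "K * ?X \<le> (1 + \<delta>) * ((1 + \<delta>) * ?G)" if \<delta>: "\<delta> > 0" for \<delta>
  proof (rule field_le_epsilon)
    fix e :: real assume e: "e > 0"
    \<comment> \<open>The factor by which the \<open>H\<^sup>1\<close> distance of \<open>u\<close> and \<open>\<phi>\<close> enters the final estimate.\<close>
    define C where "C = (1 + \<delta>) * (1 + 1 / \<delta>) + K * (1 + 1 / \<delta>) * (1 / r)\<^sup>2"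
    have C: "C > 0" unfolding C_def using \<delta> K by (intro add_pos_nonneg mult_pos_pos mult_nonneg_nonneg) (auto intro: add_pos_pos)
    obtain \<phi> where \<phi>: "\<phi> \<in> test_functions ?S" "H1_energy ?S (\<lambda>x. u x - \<phi> x) (\<lambda>x. g x - grad \<phi> x) < e / C"
      using H10_approx[OF o u, of "e / C"] e C by auto
    define w where "w x = u x - \<phi> x" for x
    define h where "h x = g x - grad \<phi> x" for x
    have wsq: "square_integrable ?S w" and hw: "has_weak_gradient ?S w h"
      unfolding w_def h_def by (intro sqint_diff has_weak_gradient_minus_test o sq u test_sqint \<phi>)+
    have gt: "has_weak_gradient ?S \<phi> (grad \<phi>)" by (intro has_weak_gradient_test o \<phi>)
    have iu: "integrable (lebesgue_on ?S) (\<lambda>x. (u x / norm x)\<^sup>2)"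
      and i\<phi>: "integrable (lebesgue_on ?S) (\<lambda>x. (\<phi> x / norm x)\<^sup>2)"
      and iw: "integrable (lebesgue_on ?S) (\<lambda>x. (w x / norm x)\<^sup>2)"
      by (intro sqint_square sqint_div_norm r sq wsq test_sqint o \<phi>)+
    have ig: "integrable (lebesgue_on ?S) (\<lambda>x. (norm (g x))\<^sup>2)"
      and igp: "integrable (lebesgue_on ?S) (\<lambda>x. (norm (grad \<phi> x))\<^sup>2)"
      and ih: "integrable (lebesgue_on ?S) (\<lambda>x. (norm (h x))\<^sup>2)"
      by (intro integrable_norm2_components has_weak_gradient_sqint[OF u(2)] has_weak_gradient_sqint[OF gt] has_weak_gradient_sqint[OF hw])+
    define E where "E = H1_energy ?S w h"
    have E: "E < e / C" using \<phi>(2) by (simp add: E_def w_def[abs_def] h_def[abs_def])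
    have Eeq: "E = (LINT x|lebesgue_on ?S. (w x)\<^sup>2) + (LINT x|lebesgue_on ?S. (norm (h x))\<^sup>2)"
      unfolding E_def H1_energy_def by (intro Bochner_Integration.integral_add sqint_square wsq ih)
    have hE: "(LINT x|lebesgue_on ?S. (norm (h x))\<^sup>2) \<le> E" and wE: "(LINT x|lebesgue_on ?S. (w x)\<^sup>2) \<le> E"
      unfolding Eeq by (auto intro: Bochner_Integration.integral_nonneg)
    have "(LINT x|lebesgue_on ?S. (w x / norm x)\<^sup>2) \<le> (LINT x|lebesgue_on ?S. (1 / r)\<^sup>2 * (w x)\<^sup>2)"
    proof (rule integral_mono[OF iw])
      show "integrable (lebesgue_on ?S) (\<lambda>x. (1 / r)\<^sup>2 * (w x)\<^sup>2)" using sqint_square[OF wsq] by simp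
      fix x assume "x \<in> space (lebesgue_on ?S)"
      then have "r \<le> norm x" by (simp add: annulus_def)
      then have "(1 / norm x)\<^sup>2 \<le> (1 / r)\<^sup>2" using r by (intro power_mono frac_le) auto
      then have "(1 / norm x)\<^sup>2 * (w x)\<^sup>2 \<le> (1 / r)\<^sup>2 * (w x)\<^sup>2" by (rule mult_right_mono) simp
      then show "(w x / norm x)\<^sup>2 \<le> (1 / r)\<^sup>2 * (w x)\<^sup>2" by (simp add: power_divide)
    qed
    also have "\<dots> \<le> (1 / r)\<^sup>2 * E" using wE by (simp add: mult_left_mono)
    finally have wE': "(LINT x|lebesgue_on ?S. (w x / norm x)\<^sup>2) \<le> (1 / r)\<^sup>2 * E" .
    have "?X \<le> (LINT x|lebesgue_on ?S. (1 + \<delta>) * (\<phi> x / norm x)\<^sup>2 + (1 + 1 / \<delta>) * (w x / norm x)\<^sup>2)"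
    proof (rule integral_mono[OF iu])
      show "integrable (lebesgue_on ?S) (\<lambda>x. (1 + \<delta>) * (\<phi> x / norm x)\<^sup>2 + (1 + 1 / \<delta>) * (w x / norm x)\<^sup>2)"
        using i\<phi> iw by simp
      show "(u x / norm x)\<^sup>2 \<le> (1 + \<delta>) * (\<phi> x / norm x)\<^sup>2 + (1 + 1 / \<delta>) * (w x / norm x)\<^sup>2" for x
        using norm_add_square_le_weighted[OF \<delta>, of "\<phi> x / norm x" "w x / norm x"]
        by (simp only: w_def add_divide_distrib[symmetric] real_norm_def power2_abs) simp
    qed
    also have "\<dots> = (1 + \<delta>) * (LINT x|lebesgue_on ?S. (\<phi> x / norm x)\<^sup>2) + (1 + 1 / \<delta>) * (LINT x|lebesgue_on ?S. (w x / norm x)\<^sup>2)"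
      using i\<phi> iw by simp
    also have "\<dots> \<le> (1 + \<delta>) * (LINT x|lebesgue_on ?S. (\<phi> x / norm x)\<^sup>2) + (1 + 1 / \<delta>) * ((1 / r)\<^sup>2 * E)"
      using \<delta> by (intro add_left_mono mult_left_mono wE') simp
    finally have "K * ?X \<le> K * ((1 + \<delta>) * (LINT x|lebesgue_on ?S. (\<phi> x / norm x)\<^sup>2) + (1 + 1 / \<delta>) * ((1 / r)\<^sup>2 * E))"
      using K by (rule mult_left_mono)
    also have "\<dots> = (1 + \<delta>) * (K * (LINT x|lebesgue_on ?S. (\<phi> x / norm x)\<^sup>2)) + K * (1 + 1 / \<delta>) * (1 / r)\<^sup>2 * E"
    proof -
      have "K * (a * P + d * (s * E)) = a * (K * P) + K * d * s * E" for a d P s :: real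
        by (simp add: algebra_simps)
      then show ?thesis .
    qed
    also have "\<dots> \<le> (1 + \<delta>) * (LINT x|lebesgue_on ?S. (norm (grad \<phi> x))\<^sup>2) + K * (1 + 1 / \<delta>) * (1 / r)\<^sup>2 * E"
      using \<delta> by (intro add_right_mono mult_left_mono[OF test[OF \<phi>(1)]]) simp
    also have "(LINT x|lebesgue_on ?S. (norm (grad \<phi> x))\<^sup>2) \<le> (LINT x|lebesgue_on ?S. (1 + \<delta>) * (norm (g x))\<^sup>2 + (1 + 1 / \<delta>) * (norm (h x))\<^sup>2)"
    proof (rule integral_mono[OF igp])
      show "integrable (lebesgue_on ?S) (\<lambda>x. (1 + \<delta>) * (norm (g x))\<^sup>2 + (1 + 1 / \<delta>) * (norm (h x))\<^sup>2)"
        using ig ih by simp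
      show "(norm (grad \<phi> x))\<^sup>2 \<le> (1 + \<delta>) * (norm (g x))\<^sup>2 + (1 + 1 / \<delta>) * (norm (h x))\<^sup>2" for x
        using norm_add_square_le_weighted[OF \<delta>, of "g x" "- h x"]
        by (simp add: h_def norm_minus_commute)
    qed
    also have "\<dots> = (1 + \<delta>) * ?G + (1 + 1 / \<delta>) * (LINT x|lebesgue_on ?S. (norm (h x))\<^sup>2)"
      using ig ih by simp
    also have "\<dots> \<le> (1 + \<delta>) * ?G + (1 + 1 / \<delta>) * E"
      using \<delta> by (intro add_left_mono mult_left_mono hE) simp
    finally have "K * ?X \<le> (1 + \<delta>) * ((1 + \<delta>) * ?G + (1 + 1 / \<delta>) * E) + K * (1 + 1 / \<delta>) * (1 / r)\<^sup>2 * E"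
      using \<delta> by (simp add: mult_left_mono)
    also have "\<dots> = (1 + \<delta>) * ((1 + \<delta>) * ?G) + C * E"
      by (simp add: C_def algebra_simps)
    also have "C * E \<le> e" using E C by (simp add: field_simps)
    finally show "K * ?X \<le> (1 + \<delta>) * ((1 + \<delta>) * ?G) + e" by simp
  qed
  have "((\<lambda>\<delta>. (1 + \<delta>) * ((1 + \<delta>) * ?G)) \<longlongrightarrow> (1 + 0) * ((1 + 0) * ?G)) (at_right 0)"
    by (intro tendsto_intros)
  then have "((\<lambda>\<delta>. (1 + \<delta>) * ((1 + \<delta>) * ?G)) \<longlongrightarrow> ?G) (at_right 0)" by simp
  then show ?thesis
    by (rule tendsto_lowerbound) (auto simp: eventually_at_right_less intro!: eventually_mono[OF eventually_at_right_less[of 0]] main)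
qed

text \<open>
  The field \<open>F x = c x / |x|\<^sup>2\<close> with the optimal \<open>c = (N - 2) / 2\<close>.
\<close>

lemma test_hardy:
  fixes \<phi> :: "real^'n::finite \<Rightarrow> real"
  assumes r: "0 < r" and \<phi>: "\<phi> \<in> test_functions (annulus r)"
  shows "((real CARD('n) - 2) / 2)\<^sup>2 * (LINT x|lebesgue_on (annulus r). (\<phi> x / norm x)\<^sup>2)
     \<le> (LINT x|lebesgue_on (annulus r). (norm (grad \<phi> x))\<^sup>2)"
proof (rule test_barta_inequality[OF r \<phi>])
  define c where "c = (real CARD('n) - 2) / 2"
  fix \<rho> :: real assume \<rho>: "r < \<rho>" "\<rho> < 1"
  with r have p: "\<rho> > 0" by simp
  show "((\<lambda>\<rho>. c / \<rho>\<^sup>2) has_real_derivative - 2 * c / \<rho>^3) (at \<rho>)"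
    using p by (auto intro!: derivative_eq_intros simp: field_simps power2_eq_square power3_eq_cube)
  have "real CARD('n) = 2 * c + 2" by (simp add: c_def diff_divide_distrib)
  then have "real CARD('n) * (c / \<rho>\<^sup>2) + \<rho> * (- 2 * c / \<rho>^3) - (\<rho> * (c / \<rho>\<^sup>2))\<^sup>2 = c\<^sup>2 / \<rho>\<^sup>2"
    using p by (simp add: field_simps power2_eq_square power3_eq_cube)
  then show "((real CARD('n) - 2) / 2)\<^sup>2 / \<rho>\<^sup>2
    \<le> real CARD('n) * (c / \<rho>\<^sup>2) + \<rho> * (- 2 * c / \<rho>^3) - (\<rho> * (c / \<rho>\<^sup>2))\<^sup>2"
    by (simp add: c_def)
next
  show "continuous_on {r<..<1} (\<lambda>\<rho>. - 2 * ((real CARD('n) - 2) / 2) / \<rho>^3)"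
    using r by (auto intro!: continuous_intros)
qed

text \<open>
  The first Dirichlet eigenfunction of the interval from \<open>r\<close> to \<open>1\<close> is \<open>sin (l (\<rho> - r))\<close> with
  \<open>l = \<pi> / (1 - r)\<close>, and minus its logarithmic derivative is \<open>f \<rho> = - l cot (l (\<rho> - r))\<close>. With the
  factor \<open>r^(N-1) / \<rho>^N\<close> it becomes a radial field whose divergence contains only the derivative
  of \<open>f\<close>; the numerator \<open>r^(N-1)\<close> is the minimum on the annulus of the weight \<open>\<rho>^(N-1)\<close> of polar
  coordinates. It remains to compare \<open>\<rho>^(1-N)\<close> with \<open>\<rho>^(-2)\<close>, which costs another factor \<open>r\<close> for
  \<open>N = 2\<close> and nothing for \<open>N \<ge> 3\<close>.
\<close>

lemma test_poincare:
  fixes \<phi> :: "real^'n::finite \<Rightarrow> real"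
  assumes r: "0 < r" "r < 1" and \<phi>: "\<phi> \<in> test_functions (annulus r)" and N: "CARD('n) \<ge> 2"
  shows "(pi / (1 - r))\<^sup>2 * r ^ (if CARD('n) = 2 then 2 else CARD('n) - 1) * (LINT x|lebesgue_on (annulus r). (\<phi> x / norm x)\<^sup>2)
     \<le> (LINT x|lebesgue_on (annulus r). (norm (grad \<phi> x))\<^sup>2)"
proof -
  define M where "M = CARD('n) - 1"
  have CN: "CARD('n) = Suc M" and M: "M \<ge> 1" using N by (auto simp: M_def)
  define l where "l = pi / (1 - r)"
  have l: "l > 0" using r by (simp add: l_def)
  define c where "c \<rho> = l * cot (l * (\<rho> - r))" for \<rho>
  define w where "w \<rho> = r ^ M * inverse \<rho> ^ Suc M" for \<rho> :: real
  define q where "q \<rho> = - (c \<rho> * w \<rho>)" for \<rho>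
  define q' where "q' \<rho> = l\<^sup>2 * inverse ((sin (l * (\<rho> - r)))\<^sup>2) * w \<rho> + c \<rho> * (real (Suc M) * w \<rho> * inverse \<rho>)" for \<rho>
  have s: "sin (l * (\<rho> - r)) > 0" if "r < \<rho>" "\<rho> < 1" for \<rho>
  proof (rule sin_gt_zero)
    show "0 < l * (\<rho> - r)" using l that by simp
    have "l * (\<rho> - r) < l * (1 - r)" using l that by (intro mult_strict_left_mono) auto
    also have "\<dots> = pi" using r by (simp add: l_def)
    finally show "l * (\<rho> - r) < pi" .
  qed
  show ?thesis
  proof (rule test_barta_inequality[OF r(1) \<phi>, where q = q and q' = q'])
    fix \<rho> :: real assume \<rho>: "r < \<rho>" "\<rho> < 1"
    with r have p: "\<rho> > 0" by simp
    have "(cot has_real_derivative - inverse ((sin (l * (\<rho> - r)))\<^sup>2)) (at (l * (\<rho> - r)))"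
      using DERIV_cot s[OF \<rho>] by force
    moreover have "((\<lambda>\<rho>. l * (\<rho> - r)) has_real_derivative l) (at \<rho>)"
      by (auto intro!: derivative_eq_intros)
    ultimately have "((\<lambda>\<rho>. cot (l * (\<rho> - r))) has_real_derivative - inverse ((sin (l * (\<rho> - r)))\<^sup>2) * l) (at \<rho>)"
      by (rule DERIV_chain2)
    from DERIV_cmult[OF this, of l] have c': "(c has_real_derivative - (l\<^sup>2 * inverse ((sin (l * (\<rho> - r)))\<^sup>2))) (at \<rho>)"
      unfolding c_def[abs_def] by (simp add: power2_eq_square mult_ac)
    have i: "(inverse has_real_derivative - (inverse \<rho> ^ 2)) (at \<rho>)"
      using DERIV_inverse[of \<rho> UNIV] p by (simp add: power2_eq_square)
    from DERIV_cmult[OF DERIV_power_Suc[OF i, of M], of "r ^ M"]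
    have w': "(w has_real_derivative - (real (Suc M) * w \<rho> * inverse \<rho>)) (at \<rho>)"
      unfolding w_def[abs_def] by (simp add: power2_eq_square algebra_simps)
    show "(q has_real_derivative q' \<rho>) (at \<rho>)"
      using DERIV_minus[OF DERIV_mult[OF c' w']] unfolding q_def[abs_def] q'_def by (simp add: algebra_simps)
    \<comment> \<open>The inequality reduces to \<open>l\<^sup>2 (t A - (t - 1) A\<^sup>2) \<ge> l\<^sup>2 A\<close>, where \<open>t = 1 / sin\<^sup>2\<close>, \<open>t - 1 = cot\<^sup>2\<close> and \<open>A \<le> 1\<close>.\<close>
    define A where "A = (r / \<rho>) ^ M"
    have A: "0 < A" "A \<le> 1" using r \<rho> p unfolding A_def by (auto intro!: power_le_one zero_less_power)
    have wA: "\<rho> * w \<rho> = A" using p by (simp add: w_def A_def power_divide field_simps)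
    define t where "t = inverse ((sin (l * (\<rho> - r)))\<^sup>2)"
    have ct: "(c \<rho>)\<^sup>2 = l\<^sup>2 * (t - 1)"
    proof -
      have "(cot (l * (\<rho> - r)))\<^sup>2 = (1 - (sin (l * (\<rho> - r)))\<^sup>2) / (sin (l * (\<rho> - r)))\<^sup>2"
        by (simp only: cot_def power_divide cos_squared_eq)
      also have "\<dots> = t - 1" using s[OF \<rho>] by (simp add: t_def diff_divide_distrib inverse_eq_divide)
      finally show ?thesis by (simp add: c_def power_mult_distrib)
    qed
    have t: "t \<ge> 1"
    proof -
      have "(c \<rho>)\<^sup>2 \<ge> 0" by simp
      then have "0 \<le> l\<^sup>2 * (t - 1)" unfolding ct .
      then show ?thesis using l by (simp add: zero_le_mult_iff)
    qed
    have e1: "real CARD('n) * q \<rho> + \<rho> * q' \<rho> = l\<^sup>2 * t * A"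
    proof -
      have "\<rho> * inverse \<rho> = 1" using p by simp
      then have "\<rho> * (c \<rho> * (real (Suc M) * w \<rho> * inverse \<rho>)) = real (Suc M) * (c \<rho> * w \<rho>)"
        by (metis mult.assoc mult.commute mult.right_neutral)
      then show ?thesis
        unfolding CN q_def q'_def t_def[symmetric] wA[symmetric] distrib_left by simp
    qed
    have e2: "(\<rho> * q \<rho>)\<^sup>2 = l\<^sup>2 * (t - 1) * A\<^sup>2"
      unfolding q_def wA[symmetric] ct[symmetric] by (simp add: power2_eq_square algebra_simps)
    have "A\<^sup>2 \<le> A" using A by (simp add: power2_eq_square mult_left_le)
    then have "l\<^sup>2 * (t - 1) * A\<^sup>2 \<le> l\<^sup>2 * (t - 1) * A" using t by (intro mult_left_mono) auto
    then have "l\<^sup>2 * A \<le> real CARD('n) * q \<rho> + \<rho> * q' \<rho> - (\<rho> * q \<rho>)\<^sup>2"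
      unfolding e1 e2 by (simp add: algebra_simps)
    moreover have "r ^ (if CARD('n) = 2 then 2 else CARD('n) - 1) / \<rho>\<^sup>2 \<le> A"
    proof (cases "M = 1")
      case True
      have "r * r \<le> r * \<rho>" using r \<rho> by (intro mult_left_mono) auto
      then have "r * r / (\<rho> * \<rho>) \<le> r * \<rho> / (\<rho> * \<rho>)" using p by (intro divide_right_mono) auto
      then show ?thesis using True p by (simp add: CN A_def power2_eq_square)
    next
      case False
      then have "\<rho> ^ M \<le> \<rho>\<^sup>2" using M p \<rho> by (intro power_decreasing) auto
      then have "r ^ M / \<rho>\<^sup>2 \<le> r ^ M / \<rho> ^ M" using r p by (intro divide_left_mono) auto
      then show ?thesis using False by (simp add: CN A_def power_divide)
    qed
    then have "l\<^sup>2 * (r ^ (if CARD('n) = 2 then 2 else CARD('n) - 1) / \<rho>\<^sup>2) \<le> l\<^sup>2 * A"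
      by (rule mult_left_mono) simp
    ultimately show "(pi / (1 - r))\<^sup>2 * r ^ (if CARD('n) = 2 then 2 else CARD('n) - 1) / \<rho>\<^sup>2
      \<le> real CARD('n) * q \<rho> + \<rho> * q' \<rho> - (\<rho> * q \<rho>)\<^sup>2"
      unfolding l_def[symmetric] by simp
  next
    have s': "sin (l * (\<rho> - r)) \<noteq> 0" if "\<rho> \<in> {r<..<1}" for \<rho> using s[of \<rho>] that by auto
    show "continuous_on {r<..<1} q'"
      unfolding q'_def w_def c_def cot_def using r s' by (auto intro!: continuous_intros)
  qed
qed

text \<open>
  The constant \<^const>\<open>kappa\<close> collects the two lower bounds for the gradient term and \<open>r\<^sup>2 / |x|\<^sup>2 \<le> 1\<close>
  for the term with \<open>m\<close>.
\<close>

lemma H10_kappa: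
  fixes u :: "real^'n::finite \<Rightarrow> real"
  assumes N: "CARD('n) \<ge> 2" and r: "0 < r" "r < 1" and m: "m \<ge> 0"
    and u: "u \<in> H10 (annulus r)" "has_weak_gradient (annulus r) u g"
  shows "kappa CARD('n) r m * (LINT x|lebesgue_on (annulus r). (u x / norm x)\<^sup>2)
     \<le> (LINT x|lebesgue_on (annulus r). (norm (g x))\<^sup>2) + m * (LINT x|lebesgue_on (annulus r). (u x)\<^sup>2)"
    (is "_ * ?X \<le> ?G + m * ?U")
proof -
  have sq: "square_integrable (annulus r) u" using u H1_sqint H10_H1 by blast
  have 1: "((real CARD('n) - 2) / 2)\<^sup>2 * ?X \<le> ?G"
    by (rule H10_hardy_of_test[OF r(1) u _ test_hardy[OF r(1)]]) simp
  have 2: "(pi / (1 - r))\<^sup>2 * r ^ (if CARD('n) = 2 then 2 else CARD('n) - 1) * ?X \<le> ?G"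
    using r by (intro H10_hardy_of_test[OF r(1) u _ test_poincare[OF r]] N) auto
  have 3: "m * (r\<^sup>2 * ?X) \<le> m * ?U" by (rule mult_left_mono[OF inverse_square_weight_le[OF r(1) sq] m])
  show ?thesis
  proof (cases "CARD('n) = 2")
    case True
    then show ?thesis using 2 3 by (simp add: kappa_def algebra_simps)
  next
    case False
    with N have N3: "CARD('n) \<ge> 3" by simp
    have "max (((real CARD('n) - 2) / 2)\<^sup>2) ((pi / (1 - r))\<^sup>2 * r ^ (CARD('n) - 1)) * ?X \<le> ?G"
      using 1 2 False by (auto simp: max_def)
    then show ?thesis using 3 N3 by (simp add: kappa_def distrib_right mult.assoc)
  qed
qed

section \<open>Plane rotations\<close>

lemma plane_rotation_eq:
  assumes "i \<noteq> j"
  shows "plane_rotation i j \<theta> x = x + ((cos \<theta> - 1) * x $ i + sin \<theta> * x $ j) *\<^sub>R axis i 1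
    + ((cos \<theta> - 1) * x $ j - sin \<theta> * x $ i) *\<^sub>R axis j 1"
  using assms by (auto simp: plane_rotation_def vec_eq_iff axis_def algebra_simps)

lemma isometry_plane_rotation:
  fixes i j :: "'n::finite"
  assumes "i \<noteq> j"
  shows "isometry_of (annulus r) (plane_rotation i j \<theta>)"
proof -
  have "linear (plane_rotation i j \<theta>)"
    by (rule linearI) (auto simp: plane_rotation_def vec_eq_iff algebra_simps)
  moreover have n: "norm (plane_rotation i j \<theta> x) = norm x" for x :: "real^'n"
  proof -
    define a where "a = (cos \<theta> - 1) * x $ i + sin \<theta> * x $ j"
    define b where "b = (cos \<theta> - 1) * x $ j - sin \<theta> * x $ i"
    have "plane_rotation i j \<theta> x \<bullet> plane_rotation i j \<theta> x = x \<bullet> x + (2 * a * x $ i + 2 * b * x $ j + a\<^sup>2 + b\<^sup>2)"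
      unfolding plane_rotation_eq[OF assms] a_def[symmetric] b_def[symmetric] using assms
      by (simp add: inner_add_left inner_add_right inner_axis inner_axis' power2_eq_square algebra_simps)
        (simp add: axis_def)
    also have "2 * a * x $ i + 2 * b * x $ j + a\<^sup>2 + b\<^sup>2 = ((sin \<theta>)\<^sup>2 + (cos \<theta>)\<^sup>2 - 1) * ((x $ i)\<^sup>2 + (x $ j)\<^sup>2)"
    proof -
      have "2 * ((c - 1) * X + s * Y) * X + 2 * ((c - 1) * Y - s * X) * Y + ((c - 1) * X + s * Y)\<^sup>2 + ((c - 1) * Y - s * X)\<^sup>2
        = (s\<^sup>2 + c\<^sup>2 - 1) * (X\<^sup>2 + Y\<^sup>2)" for c s X Y :: real
        by (simp add: power2_eq_square algebra_simps)
      then show ?thesis unfolding a_def b_def .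
    qed
    also have "\<dots> = 0" by simp
    finally show ?thesis by (simp add: norm_eq_sqrt_inner)
  qed
  ultimately show ?thesis
    by (auto simp: isometry_of_def orthogonal_transformation annulus_def)
qed

text \<open>
  A linear bound in \<open>\<theta>\<close>, which dominates the difference quotients of a test function along the
  rotation; the factor \<open>4\<close> is generous.
\<close>

lemma plane_rotation_displacement:
  assumes "i \<noteq> j"
  shows "norm (plane_rotation i j \<theta> x - x) \<le> 4 * \<bar>\<theta>\<bar> * norm x"
proof -
  have s: "\<bar>sin \<theta>\<bar> \<le> \<bar>\<theta>\<bar>" by (rule abs_sin_x_le_abs_x)
  have "cos (2 * (\<theta> / 2)) = 1 - 2 * (sin (\<theta> / 2))\<^sup>2" by (rule cos_double_sin)
  then have c1: "\<bar>cos \<theta> - 1\<bar> = 2 * (sin (\<theta> / 2))\<^sup>2" by simp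
  have "(sin (\<theta> / 2))\<^sup>2 = \<bar>sin (\<theta> / 2)\<bar> * \<bar>sin (\<theta> / 2)\<bar>" by (simp add: power2_eq_square)
  also have "\<dots> \<le> 1 * \<bar>\<theta> / 2\<bar>" by (intro mult_mono abs_sin_x_le_abs_x abs_sin_le_one) auto
  finally have c: "\<bar>cos \<theta> - 1\<bar> \<le> \<bar>\<theta>\<bar>" using c1 by simp
  have comp: "\<bar>x $ k\<bar> \<le> norm x" for k by (rule component_le_norm_cart)
  have 1: "\<bar>(cos \<theta> - 1) * x $ i + sin \<theta> * x $ j\<bar> \<le> 2 * \<bar>\<theta>\<bar> * norm x"
  proof -
    have "\<bar>(cos \<theta> - 1) * x $ i\<bar> \<le> \<bar>\<theta>\<bar> * norm x" "\<bar>sin \<theta> * x $ j\<bar> \<le> \<bar>\<theta>\<bar> * norm x"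
      unfolding abs_mult by (intro mult_mono c s comp; simp)+
    then show ?thesis by linarith
  qed
  have 2: "\<bar>(cos \<theta> - 1) * x $ j - sin \<theta> * x $ i\<bar> \<le> 2 * \<bar>\<theta>\<bar> * norm x"
  proof -
    have "\<bar>(cos \<theta> - 1) * x $ j\<bar> \<le> \<bar>\<theta>\<bar> * norm x" "\<bar>sin \<theta> * x $ i\<bar> \<le> \<bar>\<theta>\<bar> * norm x"
      unfolding abs_mult by (intro mult_mono c s comp; simp)+
    then show ?thesis by linarith
  qed
  have "norm (plane_rotation i j \<theta> x - x) = norm (((cos \<theta> - 1) * x $ i + sin \<theta> * x $ j) *\<^sub>R axis i (1::real)
    + ((cos \<theta> - 1) * x $ j - sin \<theta> * x $ i) *\<^sub>R axis j 1)"
    by (simp add: plane_rotation_eq[OF assms])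
  also have "\<dots> \<le> \<bar>(cos \<theta> - 1) * x $ i + sin \<theta> * x $ j\<bar> + \<bar>(cos \<theta> - 1) * x $ j - sin \<theta> * x $ i\<bar>"
    by (rule order_trans[OF norm_triangle_ineq]) (simp add: norm_axis_1)
  finally show ?thesis using 1 2 by simp
qed

lemma Cc_lipschitz:
  assumes "f \<in> Cc (Suc 0) S"
  obtains L where "L \<ge> 0" "\<And>x y. \<bar>f x - f y\<bar> \<le> L * norm (x - y)"
proof -
  have d: "(f has_derivative (\<lambda>h. grad f x \<bullet> h)) (at x within UNIV)" for x
    using assms by (auto simp: Cc_def intro!: has_derivative_grad)
  have "\<exists>B. B > 0 \<and> (\<forall>x. \<bar>partial_deriv k f x\<bar> \<le> B)" for k
    using Cc_bounded[OF Cc_partial[OF assms]] by metis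
  then obtain B where B: "\<And>k. B k > 0" "\<And>k x. \<bar>partial_deriv k f x\<bar> \<le> B k" by metis
  define L where "L = (\<Sum>k\<in>UNIV. B k)"
  have L: "L \<ge> 0" unfolding L_def using B(1) by (simp add: sum_nonneg less_imp_le)
  have "norm (grad f x) \<le> L" for x
    using norm_le_l1_cart[of "grad f x"] sum_mono[of UNIV "\<lambda>k. \<bar>partial_deriv k f x\<bar>" B] B(2) by (auto simp: L_def)
  then have o: "onorm (\<lambda>h. grad f x \<bullet> h) \<le> L" for x
    by (intro onorm_bound L) (metis Cauchy_Schwarz_ineq2 mult_right_mono norm_ge_zero order_trans real_norm_def)
  have "\<bar>f x - f y\<bar> \<le> L * norm (x - y)" for x y
    using differentiable_bound[OF convex_UNIV d o, of x y] by simp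
  with L that show ?thesis by blast
qed

text \<open>
  By invariance of \<open>u\<close> and of Lebesgue measure, the integral of \<open>u\<close> against \<open>\<phi> \<circ> R\<^sub>\<theta>\<close> does not
  depend on \<open>\<theta>\<close>. Its derivative at \<open>\<theta> = 0\<close> is, up to the sign, the integral of \<open>u\<close> against the
  angular derivative of \<open>\<phi>\<close>.
\<close>

lemma angular_derivative_zero_if_rotation_invariant:
  fixes i j :: "'n::finite" and u :: "real^'n \<Rightarrow> real"
  assumes ij: "i \<noteq> j"
    and u: "square_integrable (annulus r) u" and g: "has_weak_gradient (annulus r) u g"
    and inv: "\<And>\<theta>. AE x in lebesgue_on (annulus r). u (plane_rotation i j \<theta> x) = u x"
  shows "AE x in lebesgue_on (annulus r). x $ i * g x $ j - x $ j * g x $ i = 0"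
proof (rule fundamental_lemma)
  let ?S = "annulus r :: (real^'n) set"
  let ?M = "lebesgue_on ?S"
  show o: "open ?S" by (rule annulus_geometry)
  have Sl: "?S \<in> lmeasurable" by (rule annulus_geometry)
  then have Sm: "?S \<in> sets lebesgue" by auto
  have cm: "(\<lambda>x::real^'n. x $ k) \<in> borel_measurable ?M" for k
    by (intro measurable_on_annulus continuous_intros)
  have cb: "\<bar>x $ k\<bar> \<le> 1" if "x \<in> ?S" for x k
    using component_le_norm_cart[of x k] that by (simp add: annulus_def)
  have xg: "square_integrable ?S (\<lambda>x. x $ k * g x $ k')" for k k'
    by (rule sqint_bounded_mult[OF has_weak_gradient_sqint[OF g] cm cb])
  show "square_integrable ?S (\<lambda>x. x $ i * g x $ j - x $ j * g x $ i)"
    by (intro sqint_diff xg)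
  fix \<phi> assume \<phi>: "\<phi> \<in> test_functions ?S"
  have \<phi>1: "\<phi> \<in> Cc (Suc 0) ?S" using \<phi> by (simp add: test_functions_Cc)
  then have d\<phi>: "\<phi> differentiable (at x)" for x by (simp add: Cc_def)
  obtain L where L: "L \<ge> 0" "\<And>x y. \<bar>\<phi> x - \<phi> y\<bar> \<le> L * norm (x - y)" using Cc_lipschitz[OF \<phi>1] by blast
  let ?R = "plane_rotation i j :: real \<Rightarrow> real^'n \<Rightarrow> real^'n"
  note iso = isometry_plane_rotation[OF ij, of r]
  define h where "h n = inverse (real (Suc n))" for n
  have h: "0 < h n" for n by (auto simp: h_def field_simps)
  define D where "D n x = u x * ((\<phi> (?R (h n) x) - \<phi> x) / h n)" for n x
  have um: "u \<in> borel_measurable ?M" and \<phi>m: "\<phi> \<in> borel_measurable ?M"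
    by (intro sqint_measurable u test_sqint o \<phi>)+
  have u\<phi>: "integrable ?M (\<lambda>x. u x * \<phi> x)" by (intro sqint_mult_integrable u test_sqint o \<phi>)
  have \<phi>R: "square_integrable ?S (\<lambda>x. \<phi> (?R \<theta> x))" for \<theta>
    by (rule isometry_sqint[OF iso Sm test_sqint(1)[OF o \<phi>]])
  have u\<phi>R: "integrable ?M (\<lambda>x. u x * \<phi> (?R \<theta> x))" for \<theta>
    by (intro sqint_mult_integrable u \<phi>R)
  have eq: "(LINT x|?M. u x * \<phi> (?R \<theta> x)) = (LINT x|?M. u x * \<phi> x)" for \<theta>
  proof -
    have m: "(\<lambda>x. u x * \<phi> x) \<in> borel_measurable ?M" using u\<phi> by auto
    have "(LINT x|?M. u x * \<phi> (?R \<theta> x)) = (LINT x|?M. u (?R \<theta> x) * \<phi> (?R \<theta> x))"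
    proof (rule integral_cong_AE)
      show "(\<lambda>x. u x * \<phi> (?R \<theta> x)) \<in> borel_measurable ?M" using u\<phi>R by auto
      show "(\<lambda>x. u (?R \<theta> x) * \<phi> (?R \<theta> x)) \<in> borel_measurable ?M"
        using isometry_integral(3)[OF iso Sm m] .
      show "AE x in ?M. u x * \<phi> (?R \<theta> x) = u (?R \<theta> x) * \<phi> (?R \<theta> x)"
        using inv[of \<theta>] by (rule eventually_mono) simp
    qed
    also have "\<dots> = (LINT x|?M. u x * \<phi> x)" by (rule isometry_integral(1)[OF iso Sm m])
    finally show ?thesis .
  qed
  have D0: "(LINT x|?M. D n x) = 0" for n
  proof -
    have "D n = (\<lambda>x. (u x * \<phi> (?R (h n) x) - u x * \<phi> x) / h n)"
      by (simp add: D_def fun_eq_iff right_diff_distrib)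
    then show ?thesis using u\<phi>R[of "h n"] u\<phi> eq[of "h n"] by simp
  qed
  define P where "P x = x $ j * partial_deriv i \<phi> x - x $ i * partial_deriv j \<phi> x" for x
  have lim: "(\<lambda>n. D n x) \<longlonglongrightarrow> u x * P x" for x
  proof -
    have "((\<lambda>\<theta>. ?R \<theta> x) has_derivative (\<lambda>s. (s * x $ j) *\<^sub>R axis i 1 - (s * x $ i) *\<^sub>R axis j 1)) (at 0)"
      unfolding plane_rotation_eq[OF ij] by (auto intro!: derivative_eq_intros simp: scaleR_diff_left)
    moreover have R0: "?R 0 x = x" by (simp add: plane_rotation_eq[OF ij])
    ultimately have "((\<lambda>\<theta>. \<phi> (?R \<theta> x)) has_derivative (\<lambda>s. grad \<phi> x \<bullet> ((s * x $ j) *\<^sub>R axis i 1 - (s * x $ i) *\<^sub>R axis j 1))) (at 0)"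
      using has_derivative_compose[of "\<lambda>\<theta>. ?R \<theta> x" _ 0 UNIV \<phi>] has_derivative_grad[OF d\<phi>, of x] by simp
    moreover have "(\<lambda>s. grad \<phi> x \<bullet> ((s * x $ j) *\<^sub>R axis i 1 - (s * x $ i) *\<^sub>R axis j 1)) = (*) (P x)"
      by (auto simp: P_def inner_diff_right inner_axis algebra_simps)
    ultimately have "((\<lambda>\<theta>. \<phi> (?R \<theta> x)) has_real_derivative P x) (at 0)"
      by (simp add: has_field_derivative_def)
    then have Lm: "((\<lambda>s. (\<phi> (?R s x) - \<phi> x) / s) \<longlongrightarrow> P x) (at 0)"
      unfolding DERIV_def by (simp add: R0)
    have "filterlim h (at 0) sequentially"
      unfolding h_def filterlim_at using LIMSEQ_inverse_real_of_nat by auto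
    from filterlim_compose[OF Lm this] show ?thesis unfolding D_def by (intro tendsto_intros)
  qed
  have bound: "norm (D n x) \<le> 4 * L * \<bar>u x\<bar>" if x: "x \<in> ?S" for n x
  proof -
    have "\<bar>\<phi> (?R (h n) x) - \<phi> x\<bar> \<le> L * (4 * \<bar>h n\<bar> * norm x)"
      by (rule order_trans[OF L(2)]) (intro mult_left_mono plane_rotation_displacement ij L(1))
    also have "\<dots> \<le> L * (4 * \<bar>h n\<bar> * 1)"
      using x L(1) by (intro mult_left_mono) (auto simp: annulus_def)
    finally have "\<bar>\<phi> (?R (h n) x) - \<phi> x\<bar> / h n \<le> 4 * L"
      using h[of n] by (simp add: field_simps)
    then have "\<bar>u x\<bar> * (\<bar>\<phi> (?R (h n) x) - \<phi> x\<bar> / h n) \<le> \<bar>u x\<bar> * (4 * L)"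
      by (rule mult_left_mono) simp
    then show ?thesis using h[of n] by (simp add: D_def abs_mult mult_ac)
  qed
  have "integrable ?M (\<lambda>x. 4 * L * \<bar>u x\<bar>)" using sqint_integrable[OF Sl u] by simp
  moreover have "D n \<in> borel_measurable ?M" for n
  proof -
    have "(\<lambda>x. \<phi> (?R (h n) x)) \<in> borel_measurable ?M" by (rule sqint_measurable[OF \<phi>R])
    then show ?thesis unfolding D_def[abs_def] using um \<phi>m by simp
  qed
  moreover have Pm: "P \<in> borel_measurable ?M"
    unfolding P_def[abs_def] using cm sqint_measurable[OF test_sqint(2)[OF o \<phi>]] by simp
  ultimately have "(\<lambda>n. LINT x|?M. D n x) \<longlonglongrightarrow> (LINT x|?M. u x * P x)"
    using um lim bound by (intro integral_dominated_convergence[where w = "\<lambda>x. 4 * L * \<bar>u x\<bar>"]) auto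
  then have uP: "(LINT x|?M. u x * P x) = 0"
    using D0 LIMSEQ_unique[of "\<lambda>n. 0::real"] by simp
  have x\<phi>: "(\<lambda>x. x $ k * \<phi> x) \<in> test_functions ?S" for k
    by (intro test_functions_mult[OF \<phi> _ o] smooth_on_component)
  have dx: "partial_deriv k (\<lambda>x. x $ k' * \<phi> x) x = x $ k' * partial_deriv k \<phi> x" if "k \<noteq> k'" for k k' and x :: "real^'n"
  proof -
    have "(\<lambda>x::real^'n. x $ k') differentiable (at x)" by (rule differentiableI[OF has_derivative_component])
    from partial_deriv_mult[OF this d\<phi>, of k] show ?thesis using that by simp
  qed
  have I: "(LINT x|?M. u x * (x $ k' * partial_deriv k \<phi> x)) = - (LINT x|?M. x $ k' * g x $ k * \<phi> x)" if "k \<noteq> k'" for k k'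
    using has_weak_gradient_eq[OF g x\<phi>[of k'], of k] unfolding dx[OF that] by (simp add: mult_ac)
  have iu: "integrable ?M (\<lambda>x. u x * (x $ k' * partial_deriv k \<phi> x))" for k k'
    by (intro sqint_mult_integrable u sqint_bounded_mult[OF test_sqint(2)[OF o \<phi>] cm cb])
  have ig: "integrable ?M (\<lambda>x. x $ k' * g x $ k * \<phi> x)" for k k'
    by (intro sqint_mult_integrable xg test_sqint o \<phi>)
  have "0 = (LINT x|?M. u x * (x $ j * partial_deriv i \<phi> x)) - (LINT x|?M. u x * (x $ i * partial_deriv j \<phi> x))"
    using uP iu by (simp add: P_def right_diff_distrib)
  also have "\<dots> = (LINT x|?M. x $ i * g x $ j * \<phi> x) - (LINT x|?M. x $ j * g x $ i * \<phi> x)"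
    using I[of i j] I[of j i] ij by simp
  also have "\<dots> = (LINT x|?M. (x $ i * g x $ j - x $ j * g x $ i) * \<phi> x)"
    using ig by (simp add: left_diff_distrib)
  finally show "(LINT x|?M. (x $ i * g x $ j - x $ j * g x $ i) * \<phi> x) = 0" by simp
qed

section \<open>The Rayleigh quotient\<close>

text \<open>
  The derivative along rotations of the \<open>a\<close>-\<open>b\<close>-plane of a function with gradient \<open>v\<close> at \<open>x\<close>.
\<close>

definition angular :: "'n::finite \<Rightarrow> 'n \<Rightarrow> real^'n \<Rightarrow> real^'n \<Rightarrow> real" where
  "angular a b x v = x $ a * v $ b - x $ b * v $ a"

lemma angular_add: "angular a b x (v + w) = angular a b x v + angular a b x w"
  and angular_diff: "angular a b x (v - w) = angular a b x v - angular a b x w"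
  and angular_scaleR: "angular a b x (c *\<^sub>R v) = c * angular a b x v"
  by (simp_all add: angular_def algebra_simps)

lemma sum_two_squares_le_norm:
  fixes x :: "real^'n::finite"
  assumes "a \<noteq> b"
  shows "(x $ a)\<^sup>2 + (x $ b)\<^sup>2 \<le> (norm x)\<^sup>2"
proof -
  have "(\<Sum>k\<in>{a, b}. (x $ k)\<^sup>2) \<le> (\<Sum>k\<in>UNIV. (x $ k)\<^sup>2)"
    by (rule sum_mono2) auto
  moreover have "(norm x)\<^sup>2 = (\<Sum>k\<in>UNIV. (x $ k)\<^sup>2)"
    unfolding power2_norm_eq_inner inner_vec_def by (simp add: power2_eq_square)
  ultimately show ?thesis using assms by simp
qed

lemma angular_square_le:
  fixes x v :: "real^'n::finite"
  shows "(angular a b x v)\<^sup>2 \<le> (norm x)\<^sup>2 * (norm v)\<^sup>2"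
proof (cases "a = b")
  case True
  then show ?thesis by (simp add: angular_def)
next
  case False
  have "(angular a b x v)\<^sup>2 + (x $ a * v $ a + x $ b * v $ b)\<^sup>2 = ((x $ a)\<^sup>2 + (x $ b)\<^sup>2) * ((v $ a)\<^sup>2 + (v $ b)\<^sup>2)"
    by (simp add: angular_def power2_eq_square algebra_simps)
  then have "(angular a b x v)\<^sup>2 \<le> ((x $ a)\<^sup>2 + (x $ b)\<^sup>2) * ((v $ a)\<^sup>2 + (v $ b)\<^sup>2)"
    using zero_le_power2[of "x $ a * v $ a + x $ b * v $ b"] by linarith
  also have "\<dots> \<le> (norm x)\<^sup>2 * (norm v)\<^sup>2"
    by (intro mult_mono sum_two_squares_le_norm False) auto
  finally show ?thesis .
qed

lemma angular_square_le_annulus: "x \<in> annulus r \<Longrightarrow> (angular a b x v)\<^sup>2 \<le> (norm v)\<^sup>2"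
proof -
  assume "x \<in> annulus r"
  then have "(norm x)\<^sup>2 * (norm v)\<^sup>2 \<le> 1 * (norm v)\<^sup>2"
    by (intro mult_right_mono power_le_one) (auto simp: annulus_def)
  with angular_square_le[of a b x v] show ?thesis by simp
qed

lemma sqint_component_mult:
  fixes f :: "real^'n::finite \<Rightarrow> real"
  assumes "square_integrable (annulus r) f"
  shows "square_integrable (annulus r) (\<lambda>x. x $ k * f x)"
proof (rule sqint_bounded_mult[OF assms, where C = 1])
  show "(\<lambda>x::real^'n. x $ k) \<in> borel_measurable (lebesgue_on (annulus r))"
    by (intro measurable_on_annulus continuous_intros)
  show "\<bar>x $ k\<bar> \<le> 1" if "x \<in> annulus r" for x :: "real^'n"
    using component_le_norm_cart[of x k] that by (simp add: annulus_def)
qed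

lemma sqint_angular:
  assumes "has_weak_gradient (annulus r) u g"
  shows "square_integrable (annulus r) (\<lambda>x. angular a b x (g x))"
  unfolding angular_def by (intro sqint_diff sqint_component_mult has_weak_gradient_sqint[OF assms])

definition energy :: "'n::finite \<Rightarrow> 'n \<Rightarrow> real \<Rightarrow> real \<Rightarrow> real \<Rightarrow> (real^'n \<Rightarrow> real) \<Rightarrow> (real^'n \<Rightarrow> real^'n) \<Rightarrow> real" where
  "energy a b r \<alpha> m u g = (LINT x|lebesgue_on (annulus r). (norm (g x))\<^sup>2 - \<alpha>\<^sup>2 * (angular a b x (g x))\<^sup>2 + m * (u x)\<^sup>2)"

definition Lp_mass :: "real \<Rightarrow> real \<Rightarrow> (real^'n::finite \<Rightarrow> real) \<Rightarrow> real" where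
  "Lp_mass r p u = (LINT x|lebesgue_on (annulus r). \<bar>u x\<bar> powr p)"

lemma energy_integrable:
  assumes "square_integrable (annulus r) u" "has_weak_gradient (annulus r) u g"
  shows "integrable (lebesgue_on (annulus r)) (\<lambda>x. (norm (g x))\<^sup>2 - \<alpha>\<^sup>2 * (angular a b x (g x))\<^sup>2 + m * (u x)\<^sup>2)"
  by (intro Bochner_Integration.integrable_add Bochner_Integration.integrable_diff integrable_mult_right
      sqint_square sqint_angular[OF assms(2)] assms integrable_norm2_components has_weak_gradient_sqint[OF assms(2)])

lemma energy_eq:
  assumes "square_integrable (annulus r) u" "has_weak_gradient (annulus r) u g"
  shows "energy a b r \<alpha> m u g = (LINT x|lebesgue_on (annulus r). (norm (g x))\<^sup>2)
    - \<alpha>\<^sup>2 * (LINT x|lebesgue_on (annulus r). (angular a b x (g x))\<^sup>2) + m * (LINT x|lebesgue_on (annulus r). (u x)\<^sup>2)"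
  unfolding energy_def
  using sqint_square[OF sqint_angular[OF assms(2)]] sqint_square[OF assms(1)]
    integrable_norm2_components[OF has_weak_gradient_sqint[OF assms(2)]] by simp

lemma rayleigh_eq:
  assumes u: "square_integrable (annulus r) u" and g: "has_weak_gradient (annulus r) u g"
  shows "rayleigh a b (annulus r) \<alpha> m p u = energy a b r \<alpha> m u g / Lp_mass r p u powr (2 / p)"
proof -
  have w: "has_weak_gradient (annulus r) u (weak_grad (annulus r) u)"
    by (rule H1_weak_grad[OF H1I[OF u g]])
  have "energy a b r \<alpha> m u (weak_grad (annulus r) u) = energy a b r \<alpha> m u g"
    unfolding energy_def
  proof (rule integral_cong_AE)
    show "AE x in lebesgue_on (annulus r). (norm (weak_grad (annulus r) u x))\<^sup>2 - \<alpha>\<^sup>2 * (angular a b x (weak_grad (annulus r) u x))\<^sup>2 + m * (u x)\<^sup>2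
      = (norm (g x))\<^sup>2 - \<alpha>\<^sup>2 * (angular a b x (g x))\<^sup>2 + m * (u x)\<^sup>2"
      using weak_grad_AE[OF annulus_geometry(1) g] by (rule eventually_mono) simp
  qed (use energy_integrable[OF u w] energy_integrable[OF u g] in auto)
  then show ?thesis
    by (simp add: rayleigh_def energy_def Lp_mass_def weak_angular_deriv_def angular_def)
qed

lemma energy_nonneg:
  assumes "\<bar>\<alpha>\<bar> \<le> 1" "m \<ge> 0"
  shows "0 \<le> energy a b r \<alpha> m u g"
  unfolding energy_def
proof (rule Bochner_Integration.integral_nonneg)
  fix x :: "real^'a" assume "x \<in> space (lebesgue_on (annulus r))"
  then have 1: "(angular a b x (g x))\<^sup>2 \<le> (norm (g x))\<^sup>2" by (intro angular_square_le_annulus[of _ r]) simp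
  have "\<alpha>\<^sup>2 \<le> 1" using assms(1) by (simp add: abs_square_le_1)
  then have "\<alpha>\<^sup>2 * (angular a b x (g x))\<^sup>2 \<le> 1 * (angular a b x (g x))\<^sup>2" by (rule mult_right_mono) simp
  with 1 assms(2) show "0 \<le> (norm (g x))\<^sup>2 - \<alpha>\<^sup>2 * (angular a b x (g x))\<^sup>2 + m * (u x)\<^sup>2"
    using mult_nonneg_nonneg[OF assms(2) zero_le_power2[of "u x"]] by linarith
qed

lemma angular_reindex:
  assumes "bij \<pi>"
  shows "angular i j x (reindex (inv \<pi>) v) = angular (inv \<pi> i) (inv \<pi> j) (reindex \<pi> x) v"
  using surj_f_inv_f[OF bij_is_surj[OF assms]] by (simp add: angular_def)

text \<open>
  Renaming the coordinates moves the angular term to another coordinate plane and leaves the rest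
  of the quotient unchanged.
\<close>

lemma rayleigh_reindex:
  fixes v :: "real^'n::finite \<Rightarrow> real" and \<pi> :: "'n \<Rightarrow> 'n"
  assumes p: "bij \<pi>" and v: "v \<in> H1 (annulus r)"
  shows "rayleigh i j (annulus r) \<alpha> m p (\<lambda>x. v (reindex \<pi> x)) = rayleigh (inv \<pi> i) (inv \<pi> j) (annulus r) \<alpha> m p v"
proof -
  let ?S = "annulus r :: (real^'n) set"
  have o: "open ?S" and S: "perm_invariant ?S" by (rule annulus_geometry)+
  have Sm: "?S \<in> sets lebesgue" using o by auto
  note iso = isometry_reindex[OF S p]
  define g where "g = weak_grad ?S v"
  have sq: "square_integrable ?S v" and g: "has_weak_gradient ?S v g"
    using v H1_sqint H1_weak_grad unfolding g_def by blast+
  have "energy i j r \<alpha> m (\<lambda>x. v (reindex \<pi> x)) (\<lambda>x. reindex (inv \<pi>) (g (reindex \<pi> x))) = energy (inv \<pi> i) (inv \<pi> j) r \<alpha> m v g"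
    unfolding energy_def angular_reindex[OF p] norm_reindex[OF bij_imp_bij_inv[OF p]]
    using isometry_integral(1)[OF iso Sm borel_measurable_integrable[OF energy_integrable[OF sq g]]] .
  moreover have "Lp_mass r p (\<lambda>x. v (reindex \<pi> x)) = Lp_mass r p v"
    unfolding Lp_mass_def using isometry_integral(1)[OF iso Sm, of "\<lambda>x. \<bar>v x\<bar> powr p"] sqint_measurable[OF sq] by simp
  ultimately show ?thesis
    using rayleigh_eq[OF isometry_sqint[OF iso Sm sq] has_weak_gradient_reindex[OF o S p sq g]] rayleigh_eq[OF sq g] by simp
qed

lemma bij_two_points:
  assumes "a \<noteq> b" "i \<noteq> (j::'a)"
  obtains \<pi> :: "'a \<Rightarrow> 'a" where "bij \<pi>" "\<pi> a = i" "\<pi> b = j"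
proof -
  \<comment> \<open>First move \<open>a\<close> to \<open>i\<close>, then the image of \<open>b\<close> to \<open>j\<close>; the second swap does not touch \<open>i\<close>.\<close>
  define \<tau> where "\<tau> = Transposition.transpose a i"
  define \<sigma> where "\<sigma> = Transposition.transpose (\<tau> b) j"
  have t: "\<tau> a = i" by (simp add: \<tau>_def)
  have "\<tau> b \<noteq> i" using assms(1) unfolding \<tau>_def by (metis transpose_apply_second transpose_involutory transpose_apply_first)
  then have "\<sigma> i = i" using assms(2) by (simp add: \<sigma>_def transpose_apply_other)
  then show ?thesis
    using that[of "\<sigma> \<circ> \<tau>"] t by (simp add: \<sigma>_def \<tau>_def bij_comp)
qed

text \<open>
  Because of the permutation symmetry of the annulus, the infimum of the Rayleigh quotient is the
  same for all coordinate planes.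
\<close>

lemma ground_level_le_rayleigh:
  fixes i j a b :: "'n::finite"
  assumes ij: "i \<noteq> j" and ab: "a \<noteq> b" and \<alpha>: "\<bar>\<alpha>\<bar> \<le> 1" and m: "m \<ge> 0"
    and v: "v \<in> H10 (annulus r)" "\<not> ae_zero (annulus r) v"
  shows "ground_level i j (annulus r) \<alpha> m p \<le> rayleigh a b (annulus r) \<alpha> m p v"
proof -
  let ?S = "annulus r :: (real^'n) set"
  have o: "open ?S" and S: "perm_invariant ?S" by (rule annulus_geometry)+
  have Sm: "?S \<in> sets lebesgue" using o by auto
  obtain \<pi> where \<pi>: "bij \<pi>" "\<pi> a = i" "\<pi> b = j" using bij_two_points[OF ab ij] .
  then have inv: "inv \<pi> i = a" "inv \<pi> j = b" using inv_f_f[OF bij_is_inj[OF \<pi>(1)]] by blast+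
  let ?w = "\<lambda>x. v (reindex \<pi> x)"
  have "\<not> ae_zero ?S ?w"
  proof
    assume "ae_zero ?S ?w"
    then have "AE x in lebesgue_on ?S. v (reindex \<pi> (reindex (inv \<pi>) x)) = 0"
      unfolding ae_zero_def by (rule isometry_AE[OF isometry_reindex[OF S bij_imp_bij_inv[OF \<pi>(1)]] Sm])
    with v(2) show False by (simp add: ae_zero_def reindex_inverse(2)[OF \<pi>(1)])
  qed
  moreover have "?w \<in> H10 ?S" by (rule H10_reindex[OF o S \<pi>(1) v(1)])
  moreover have "bdd_below (rayleigh i j ?S \<alpha> m p ` {u \<in> H10 ?S. \<not> ae_zero ?S u})"
  proof (rule bdd_belowI2[where m = 0])
    fix u assume "u \<in> {u \<in> H10 ?S. \<not> ae_zero ?S u}"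
    then have h: "u \<in> H1 ?S" by (simp add: H10_H1)
    show "0 \<le> rayleigh i j ?S \<alpha> m p u"
      unfolding rayleigh_eq[OF H1_sqint[OF h] H1_weak_grad[OF h]]
      by (intro divide_nonneg_nonneg energy_nonneg \<alpha> m) simp
  qed
  ultimately have "ground_level i j ?S \<alpha> m p \<le> rayleigh i j ?S \<alpha> m p ?w"
    unfolding ground_level_def by (intro cINF_lower) auto
  also have "\<dots> = rayleigh a b ?S \<alpha> m p v"
    using rayleigh_reindex[OF \<pi>(1) H10_H1[OF v(1)]] inv by simp
  finally show ?thesis .
qed

section \<open>Ground states without angular dependence\<close>

text \<open>
  The angular term of the equation is bilinear, so it disappears as soon as the angular derivative
  of \<open>u\<close> does.
\<close>

lemma weak_solution_energy:
  fixes u :: "real^'n::finite \<Rightarrow> real"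
  assumes ws: "weak_solution i j (annulus r) \<alpha> m p u" and g: "has_weak_gradient (annulus r) u g"
    and L: "AE x in lebesgue_on (annulus r). angular i j x (g x) = 0"
    and v: "v \<in> H10 (annulus r)" and h: "has_weak_gradient (annulus r) v h"
  shows "(LINT x|lebesgue_on (annulus r). g x \<bullet> h x + m * (u x * v x)) = (LINT x|lebesgue_on (annulus r). \<bar>u x\<bar> powr (p - 2) * u x * v x)"
proof -
  let ?S = "annulus r :: (real^'n) set"
  have o: "open ?S" by (rule annulus_geometry)
  have u: "u \<in> H10 ?S" using ws by (simp add: weak_solution_def)
  note us = H1_sqint[OF H10_H1[OF u]] and vs = H1_sqint[OF H10_H1[OF v]]
  note ug = H1_weak_grad[OF H10_H1[OF u]] and vg = H1_weak_grad[OF H10_H1[OF v]]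
  note [measurable] = sqint_measurable[OF us] sqint_measurable[OF vs] weak_gradient_measurable[OF ug] weak_gradient_measurable[OF vg]
    weak_gradient_measurable[OF g] weak_gradient_measurable[OF h]
  have a1[measurable]: "(\<lambda>x. weak_angular_deriv i j ?S u x) \<in> borel_measurable (lebesgue_on ?S)"
    using sqint_measurable[OF sqint_angular[OF ug, of i j]] by (simp add: weak_angular_deriv_def angular_def)
  have a2[measurable]: "(\<lambda>x. weak_angular_deriv i j ?S v x) \<in> borel_measurable (lebesgue_on ?S)"
    using sqint_measurable[OF sqint_angular[OF vg, of i j]] by (simp add: weak_angular_deriv_def angular_def)
  have "(LINT x|lebesgue_on ?S. \<bar>u x\<bar> powr (p - 2) * u x * v x) =
     (LINT x|lebesgue_on ?S. weak_grad ?S u x \<bullet> weak_grad ?S v x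
           - \<alpha>\<^sup>2 * (weak_angular_deriv i j ?S u x * weak_angular_deriv i j ?S v x) + m * (u x * v x))"
    using ws v by (simp add: weak_solution_def)
  also have "\<dots> = (LINT x|lebesgue_on ?S. g x \<bullet> h x + m * (u x * v x))"
  proof (rule integral_cong_AE)
    show "AE x in lebesgue_on ?S. weak_grad ?S u x \<bullet> weak_grad ?S v x
           - \<alpha>\<^sup>2 * (weak_angular_deriv i j ?S u x * weak_angular_deriv i j ?S v x) + m * (u x * v x)
        = g x \<bullet> h x + m * (u x * v x)"
      using weak_grad_AE[OF o g] weak_grad_AE[OF o h] L
      by eventually_elim (simp add: weak_angular_deriv_def angular_def)
  qed measurable
  finally show ?thesis by simp
qed

lemma abs_powr_mult_self: "\<bar>t\<bar> powr (p - 2) * t * t = \<bar>t::real\<bar> powr p"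
proof (cases "t = 0")
  case False
  then show ?thesis using powr_add[of "\<bar>t\<bar>" "p - 2" 2] by (simp add: power2_eq_square)
qed simp

text \<open>
  The equation tested with \<open>u\<close>. Its left side is positive by the Hardy-Poincare inequality; as the
  Bochner integral of a nonintegrable function is \<open>0\<close>, this also proves that \<open>|u|^p\<close> is
  integrable.
\<close>

lemma angular_free_solution_mass:
  fixes u :: "real^'n::finite \<Rightarrow> real"
  assumes N: "CARD('n) \<ge> 2" and r: "0 < r" "r < 1" and m: "m \<ge> 0"
    and ws: "weak_solution i j (annulus r) \<alpha> m p u" and nz: "\<not> ae_zero (annulus r) u"
    and g: "has_weak_gradient (annulus r) u g"
    and L: "AE x in lebesgue_on (annulus r). angular i j x (g x) = 0"
  shows "(LINT x|lebesgue_on (annulus r). (norm (g x))\<^sup>2) + m * (LINT x|lebesgue_on (annulus r). (u x)\<^sup>2) = Lp_mass r p u"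
    "Lp_mass r p u > 0" "integrable (lebesgue_on (annulus r)) (\<lambda>x. \<bar>u x\<bar> powr p)"
    "kappa CARD('n) r m > 0" "(LINT x|lebesgue_on (annulus r). (u x / norm x)\<^sup>2) > 0"
proof -
  let ?S = "annulus r :: (real^'n) set"
  have u: "u \<in> H10 ?S" using ws by (simp add: weak_solution_def)
  note us = H1_sqint[OF H10_H1[OF u]]
  have "(LINT x|lebesgue_on ?S. g x \<bullet> g x + m * (u x * u x)) = Lp_mass r p u"
    using weak_solution_energy[OF ws g L u g] by (simp add: Lp_mass_def abs_powr_mult_self)
  moreover have "(LINT x|lebesgue_on ?S. g x \<bullet> g x + m * (u x * u x)) = (LINT x|lebesgue_on ?S. (norm (g x))\<^sup>2) + m * (LINT x|lebesgue_on ?S. (u x)\<^sup>2)"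
    using sqint_square[OF us] integrable_norm2_components[OF has_weak_gradient_sqint[OF g]]
    by (simp add: power2_norm_eq_inner power2_eq_square[of "u _"])
  ultimately show eq: "(LINT x|lebesgue_on ?S. (norm (g x))\<^sup>2) + m * (LINT x|lebesgue_on ?S. (u x)\<^sup>2) = Lp_mass r p u"
    by simp
  have ix: "integrable (lebesgue_on ?S) (\<lambda>x. (u x / norm x)\<^sup>2)"
    by (intro sqint_square sqint_div_norm r us)
  show X: "(LINT x|lebesgue_on ?S. (u x / norm x)\<^sup>2) > 0"
  proof (rule ccontr)
    assume "\<not> ?thesis"
    moreover have "(LINT x|lebesgue_on ?S. (u x / norm x)\<^sup>2) \<ge> 0" by (rule Bochner_Integration.integral_nonneg) simp
    ultimately have "(LINT x|lebesgue_on ?S. (u x / norm x)\<^sup>2) = 0" by linarith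
    then have "AE x in lebesgue_on ?S. (u x / norm x)\<^sup>2 = 0"
      using integral_nonneg_eq_0_iff_AE[OF ix] by simp
    moreover have "AE x in lebesgue_on ?S. x \<in> ?S" by (rule AE_I2) simp
    ultimately have "AE x in lebesgue_on ?S. u x = 0"
      by eventually_elim (use r in \<open>auto simp: annulus_def\<close>)
    with nz show False by (simp add: ae_zero_def)
  qed
  have pr: "0 < (pi / (1 - r))\<^sup>2 * r ^ k" for k using r by simp
  have mr: "0 \<le> m * r\<^sup>2" using m by simp
  show \<kappa>: "kappa CARD('n) r m > 0"
    using pr mr by (auto simp: kappa_def less_max_iff_disj intro!: add_nonneg_pos)
  have "0 < kappa CARD('n) r m * (LINT x|lebesgue_on ?S. (u x / norm x)\<^sup>2)" using \<kappa> X by simp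
  also have "\<dots> \<le> Lp_mass r p u" using H10_kappa[OF N r m u g] eq by simp
  finally show "Lp_mass r p u > 0" .
  then show "integrable (lebesgue_on ?S) (\<lambda>x. \<bar>u x\<bar> powr p)"
    unfolding Lp_mass_def using not_integrable_integral_eq by fastforce
qed

text \<open>
  A nonzero \<open>L\<^sub>a\<^sub>b u\<close> would make the Rayleigh quotient for the \<open>a\<close>-\<open>b\<close>-plane smaller than the
  minimum, which is attained by \<open>u\<close> with a vanishing angular term.
\<close>

lemma ground_state_angular_zero:
  fixes u :: "real^'n::finite \<Rightarrow> real"
  assumes N: "CARD('n) \<ge> 2" and ij: "i \<noteq> j" and r: "0 < r" "r < 1" and m: "m \<ge> 0" and \<alpha>: "0 < \<alpha>" "\<alpha> \<le> 1"
    and gs: "ground_state i j (annulus r) \<alpha> m p u"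
    and g: "has_weak_gradient (annulus r) u g"
    and L: "AE x in lebesgue_on (annulus r). angular i j x (g x) = 0"
    and ab: "a \<noteq> b"
  shows "AE x in lebesgue_on (annulus r). angular a b x (g x) = 0"
proof -
  let ?S = "annulus r :: (real^'n) set"
  have ws: "weak_solution i j ?S \<alpha> m p u" and nz: "\<not> ae_zero ?S u" and R: "rayleigh i j ?S \<alpha> m p u = ground_level i j ?S \<alpha> m p"
    using gs by (auto simp: ground_state_def)
  have u: "u \<in> H10 ?S" using ws by (simp add: weak_solution_def)
  note us = H1_sqint[OF H10_H1[OF u]]
  have D: "Lp_mass r p u powr (2 / p) > 0" using angular_free_solution_mass(2)[OF N r m ws nz g L] by simp
  have ai: "integrable (lebesgue_on ?S) (\<lambda>x. (angular a b x (g x))\<^sup>2)" for a b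
    by (intro sqint_square sqint_angular[OF g])
  have "rayleigh i j ?S \<alpha> m p u \<le> rayleigh a b ?S \<alpha> m p u"
    unfolding R using \<alpha> by (intro ground_level_le_rayleigh ij ab m u nz) auto
  then have "energy i j r \<alpha> m u g \<le> energy a b r \<alpha> m u g"
    unfolding rayleigh_eq[OF us g] using D by (simp add: divide_le_cancel)
  moreover have "(LINT x|lebesgue_on ?S. (angular i j x (g x))\<^sup>2) = 0"
    using integral_nonneg_eq_0_iff_AE[OF ai, of i j] L by simp
  ultimately have "\<alpha>\<^sup>2 * (LINT x|lebesgue_on ?S. (angular a b x (g x))\<^sup>2) \<le> 0"
    unfolding energy_eq[OF us g] by simp
  then have "(LINT x|lebesgue_on ?S. (angular a b x (g x))\<^sup>2) \<le> 0"
    using \<alpha> by (simp add: mult_le_0_iff)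
  moreover have "0 \<le> (LINT x|lebesgue_on ?S. (angular a b x (g x))\<^sup>2)" by (rule Bochner_Integration.integral_nonneg) simp
  ultimately have "(LINT x|lebesgue_on ?S. (angular a b x (g x))\<^sup>2) = 0" by simp
  then show ?thesis
    using integral_nonneg_eq_0_iff_AE[OF ai, of a b] by simp
qed

section \<open>First spherical harmonics\<close>

text \<open>
  The restrictions of the linear functions to the unit sphere, extended to be constant along rays.
\<close>

definition dir :: "'n::finite \<Rightarrow> real^'n \<Rightarrow> real" where
  "dir a x = x $ a * inverse (norm x)"

lemma smooth_on_dir: "0 < r \<Longrightarrow> smooth_on l (annulus r) (dir a)"
  unfolding dir_def[abs_def]
  by (intro smooth_on_mult annulus_geometry smooth_on_component smooth_on_subset[OF smooth_on_inverse_norm])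
    (auto simp: annulus_def)

lemma grad_dir:
  fixes x :: "real^'n::finite"
  assumes "x \<noteq> 0"
  shows "dir a differentiable (at x)"
    "grad (dir a) x = inverse (norm x) *\<^sub>R axis a 1 - (dir a x * (inverse (norm x))\<^sup>2) *\<^sub>R x"
proof -
  have d: "(\<lambda>x::real^'n. x $ a) differentiable (at x)" by (rule differentiableI[OF has_derivative_component])
  note dn = partial_deriv_inverse_norm(1)[OF assms]
  show "dir a differentiable (at x)"
    unfolding dir_def[abs_def] by (rule differentiable_mult[OF d dn])
  show "grad (dir a) x = inverse (norm x) *\<^sub>R axis a 1 - (dir a x * (inverse (norm x))\<^sup>2) *\<^sub>R x"
    unfolding dir_def[abs_def] vec_eq_iff grad_nth partial_deriv_mult[OF d dn] partial_deriv_inverse_norm(2)[OF assms]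
    by (auto simp: axis_def power2_eq_square)
qed

lemma dir_bounds:
  fixes x :: "real^'n::finite"
  shows "\<bar>dir a x\<bar> \<le> 1"
proof (cases "x = 0")
  case False
  then show ?thesis using component_le_norm_cart[of x a] by (simp add: dir_def abs_mult divide_le_eq_1 flip: divide_inverse)
qed (simp add: dir_def)

lemma integrable_mult_dir_power:
  fixes f :: "real^'n::finite \<Rightarrow> real"
  assumes "0 < r" "integrable (lebesgue_on (annulus r)) f"
  shows "integrable (lebesgue_on (annulus r)) (\<lambda>x. f x * dir a x ^ k)"
proof (rule Bochner_Integration.integrable_bound[OF assms(2)])
  have "dir a \<in> borel_measurable (lebesgue_on (annulus r))"
    by (rule smooth_measurable[OF annulus_geometry(1) smooth_on_dir[OF assms(1), of 0]])
  then show "(\<lambda>x. f x * dir a x ^ k) \<in> borel_measurable (lebesgue_on (annulus r))"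
    using assms(2) by simp
  have "\<bar>f x\<bar> * \<bar>dir a x\<bar> ^ k \<le> \<bar>f x\<bar> * 1" for x
    by (intro mult_left_mono power_le_one dir_bounds) auto
  then show "AE x in lebesgue_on (annulus r). norm (f x * dir a x ^ k) \<le> norm (f x)"
    by (simp add: abs_mult power_abs)
qed

lemma partial_dir_bound:
  fixes x :: "real^'n::finite"
  assumes "0 < r" "x \<in> annulus r"
  shows "\<bar>partial_deriv k (dir a) x\<bar> \<le> 2 / r"
proof -
  have x: "x \<noteq> 0" "r < norm x" using assms by (auto simp: annulus_def)
  have i: "inverse (norm x) \<le> 1 / r" using x assms by (simp add: inverse_eq_divide frac_le)
  have "partial_deriv k (dir a) x = inverse (norm x) * axis a 1 $ k - dir a x * (dir k x * inverse (norm x))"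
    using arg_cong[OF grad_dir(2)[OF x(1), of a], of "\<lambda>v. v $ k"] by (simp add: dir_def power2_eq_square)
  moreover have "\<bar>inverse (norm x) * axis a 1 $ k\<bar> \<le> inverse (norm x) * 1"
    unfolding abs_mult by (intro mult_mono) (auto simp: axis_def)
  moreover have "\<bar>dir a x * (dir k x * inverse (norm x))\<bar> \<le> 1 * (1 * inverse (norm x))"
    unfolding abs_mult by (intro mult_mono dir_bounds) auto
  ultimately have "\<bar>partial_deriv k (dir a) x\<bar> \<le> 2 * inverse (norm x)" by linarith
  also have "\<dots> \<le> 2 / r" using i by simp
  finally show ?thesis .
qed

lemma angular_grad_dir:
  fixes x :: "real^'n::finite"
  assumes "x \<noteq> 0" "a \<noteq> b"
  shows "angular a b x (grad (dir a) x) = - dir b x" "angular a b x (grad (dir b) x) = dir a x"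
  unfolding grad_dir(2)[OF assms(1)] using assms(2)
  by (auto simp: angular_def axis_def dir_def algebra_simps)

lemma sum_dir_square: "x \<noteq> 0 \<Longrightarrow> (\<Sum>a\<in>UNIV. (dir a x)\<^sup>2) = 1"
proof -
  assume x: "x \<noteq> 0"
  have "(\<Sum>a\<in>UNIV. (dir a x)\<^sup>2) = (x \<bullet> x) * (inverse (norm x))\<^sup>2"
    by (simp add: dir_def power_mult_distrib inner_vec_def sum_distrib_right power2_eq_square[of "x $ _"])
  also have "\<dots> = 1" using x by (simp add: power2_norm_eq_inner[symmetric] power_mult_distrib[symmetric])
  finally show ?thesis .
qed

text \<open>
  The mixed terms cancel because \<open>\<Sum> Y\<^sub>a \<nabla>Y\<^sub>a\<close> is half the gradient of \<open>\<Sum> Y\<^sub>a\<^sup>2 = 1\<close>, and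
  \<open>\<Sum> |\<nabla>Y\<^sub>a|\<^sup>2 = (N - 1) / |x|\<^sup>2\<close>.
\<close>

lemma sum_norm_grad_dir_mult:
  fixes x v :: "real^'n::finite"
  assumes "x \<noteq> 0"
  shows "(\<Sum>a\<in>UNIV. (norm (dir a x *\<^sub>R v + s *\<^sub>R grad (dir a) x))\<^sup>2) = (norm v)\<^sup>2 + (real CARD('n) - 1) * (s / norm x)\<^sup>2"
proof -
  define n where "n = inverse (norm x)"
  have xx: "x \<bullet> x * n\<^sup>2 = 1" using assms by (simp add: n_def power2_norm_eq_inner[symmetric] power_mult_distrib[symmetric])
  have dx: "x $ a * n = dir a x" for a by (simp add: dir_def n_def)
  have dv: "(\<Sum>a\<in>UNIV. dir a x * v $ a) = n * (x \<bullet> v)"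
    by (simp add: dir_def n_def inner_vec_def sum_distrib_left mult_ac)
  have 1: "(norm (grad (dir a) x))\<^sup>2 = n\<^sup>2 - (dir a x)\<^sup>2 * n\<^sup>2" for a
  proof -
    have "(norm (grad (dir a) x))\<^sup>2 = n\<^sup>2 - 2 * n * (dir a x * n\<^sup>2) * x $ a + (dir a x * n\<^sup>2)\<^sup>2 * (x \<bullet> x)"
      unfolding grad_dir(2)[OF assms] power2_norm_eq_inner n_def[symmetric]
      by (simp add: inner_diff_left inner_diff_right inner_axis inner_axis' power2_eq_square algebra_simps)
    also have "\<dots> = n\<^sup>2 - 2 * (dir a x * n\<^sup>2) * (x $ a * n) + (dir a x)\<^sup>2 * n\<^sup>2 * (x \<bullet> x * n\<^sup>2)"
      by (simp add: power2_eq_square algebra_simps)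
    also have "\<dots> = n\<^sup>2 - (dir a x)\<^sup>2 * n\<^sup>2"
      unfolding xx dx by (simp add: power2_eq_square algebra_simps)
    finally show ?thesis .
  qed
  have 2: "dir a x * (v \<bullet> grad (dir a) x) = n * (dir a x * v $ a) - (dir a x)\<^sup>2 * n\<^sup>2 * (x \<bullet> v)" for a
    unfolding grad_dir(2)[OF assms] n_def[symmetric]
    by (simp add: inner_diff_right inner_axis inner_commute power2_eq_square algebra_simps)
  have "(norm (dir a x *\<^sub>R v + s *\<^sub>R grad (dir a) x))\<^sup>2
    = (dir a x)\<^sup>2 * (norm v)\<^sup>2 + 2 * s * (dir a x * (v \<bullet> grad (dir a) x)) + s\<^sup>2 * (norm (grad (dir a) x))\<^sup>2" for a
    unfolding power2_norm_eq_inner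
    by (simp add: inner_add_left inner_add_right inner_commute power2_eq_square algebra_simps)
  then have "(\<Sum>a\<in>UNIV. (norm (dir a x *\<^sub>R v + s *\<^sub>R grad (dir a) x))\<^sup>2)
    = (\<Sum>a\<in>UNIV. (dir a x)\<^sup>2) * (norm v)\<^sup>2 + 2 * s * (\<Sum>a\<in>UNIV. dir a x * (v \<bullet> grad (dir a) x))
      + s\<^sup>2 * (\<Sum>a\<in>UNIV. (norm (grad (dir a) x))\<^sup>2)"
    by (simp add: sum.distrib sum_distrib_left sum_distrib_right)
  also have "(\<Sum>a\<in>UNIV. dir a x * (v \<bullet> grad (dir a) x)) = 0"
  proof -
    have "(\<Sum>a\<in>UNIV. dir a x * (v \<bullet> grad (dir a) x))
      = n * (\<Sum>a\<in>UNIV. dir a x * v $ a) - (\<Sum>a\<in>UNIV. (dir a x)\<^sup>2) * n\<^sup>2 * (x \<bullet> v)"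
      unfolding 2 by (simp add: sum_subtractf sum_distrib_left sum_distrib_right mult.assoc)
    also have "\<dots> = 0" unfolding dv sum_dir_square[OF assms] by (simp add: power2_eq_square)
    finally show ?thesis .
  qed
  also have "(\<Sum>a\<in>UNIV. (norm (grad (dir a) x))\<^sup>2) = (real CARD('n) - 1) * n\<^sup>2"
    unfolding 1 using sum_dir_square[OF assms]
    by (simp add: sum_subtractf sum_distrib_right[symmetric] left_diff_distrib)
  finally show ?thesis
    by (simp add: sum_dir_square[OF assms] n_def divide_inverse power_mult_distrib mult_ac)
qed

section \<open>Functions without angular derivative are orthogonal to the first harmonics\<close>

text \<open>
  The angular derivative is divergence free, so it can be moved from \<open>Y\<^sub>b\<close> to \<open>c\<close> in the integral
  of \<open>c Y\<^sub>a = c L\<^sub>a\<^sub>b Y\<^sub>b\<close>.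
\<close>

lemma angular_pairing_Cc:
  fixes c :: "real^'n::finite \<Rightarrow> real"
  assumes r: "0 < r" and c: "c \<in> Cc (Suc 0) (annulus r)" and ab: "a \<noteq> b"
  shows "(LINT x|lebesgue_on (annulus r). c x * dir a x) = - (LINT x|lebesgue_on (annulus r). dir b x * angular a b x (grad c x))"
proof -
  let ?S = "annulus r :: (real^'n) set"
  let ?M = "lebesgue_on ?S"
  have o: "open ?S" by (rule annulus_geometry)
  have dc: "c differentiable (at x)" for x using c by (simp add: Cc_def)
  \<comment> \<open>The field \<open>G\<^sub>a e\<^sub>b - G\<^sub>b e\<^sub>a\<close> has divergence \<open>L\<^sub>a\<^sub>b (Y\<^sub>b c)\<close>.\<close>
  define G where "G k x = x $ k * dir b x * c x" for k x
  have sm: "smooth_on l ?S (\<lambda>x. x $ k * dir b x)" for k l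
    by (intro smooth_on_mult smooth_on_component smooth_on_dir r o)
  have G: "G k \<in> Cc (Suc 0) ?S" for k unfolding G_def by (intro Cc_mult[OF c sm o])
  have dG: "partial_deriv l (G k) x = x $ k * dir b x * partial_deriv l c x
     + (x $ k * partial_deriv l (dir b) x + (if l = k then 1 else 0) * dir b x) * c x" if "x \<in> ?S" for k l x
  proof -
    have x: "x \<noteq> 0" using that r annulus_pos by blast
    have d1: "(\<lambda>x::real^'n. x $ k) differentiable (at x)" by (rule differentiableI[OF has_derivative_component])
    note d2 = grad_dir(1)[OF x, of b]
    show ?thesis
      unfolding G_def partial_deriv_mult[OF differentiable_mult[OF d1 d2] dc] partial_deriv_mult[OF d1 d2] by simp
  qed
  have z: "(LINT x|?M. partial_deriv l (G k) x) = 0" and zi: "integrable ?M (partial_deriv l (G k))" for l k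
    by (rule integral_partial_deriv_Cc[OF G o], rule Cc_lebesgue_on(1)[OF Cc_partial[OF G] o])
  have ic: "integrable ?M (\<lambda>x. c x * dir a x)"
    using Cc_lebesgue_on(1)[OF Cc_mult[OF Cc_Suc_D[OF c] smooth_on_dir[OF r] o] o] by (simp add: mult.commute)
  have "(LINT x|?M. c x * dir a x + dir b x * angular a b x (grad c x)) = (LINT x|?M. partial_deriv b (G a) x - partial_deriv a (G b) x)"
  proof (rule Bochner_Integration.integral_cong[OF refl])
    fix x assume "x \<in> space ?M"
    then have x: "x \<in> ?S" "x \<noteq> 0" using annulus_pos[OF r] by auto
    have "angular a b x (grad (dir b) x) = dir a x" by (rule angular_grad_dir[OF x(2) ab])
    then have D: "dir a x = x $ a * partial_deriv b (dir b) x - x $ b * partial_deriv a (dir b) x" by (simp add: angular_def)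
    show "c x * dir a x + dir b x * angular a b x (grad c x) = partial_deriv b (G a) x - partial_deriv a (G b) x"
      unfolding dG[OF x(1)] using ab by (simp add: angular_def D algebra_simps)
  qed
  also have "\<dots> = 0" using z zi by simp
  finally have "(LINT x|?M. c x * dir a x + dir b x * angular a b x (grad c x)) = 0" .
  moreover have "integrable ?M (\<lambda>x. dir b x * angular a b x (grad c x))"
  proof -
    have "square_integrable ?S (\<lambda>x. angular a b x (grad c x))"
      by (rule sqint_angular[OF has_weak_gradient_Cc[OF o c]])
    then have "square_integrable ?S (\<lambda>x. dir b x * angular a b x (grad c x))"
      by (rule sqint_bounded_mult[OF _ smooth_measurable[OF o smooth_on_dir[OF r, of 0]] dir_bounds])
    then show ?thesis by (rule sqint_integrable[OF annulus_geometry(2)])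
  qed
  ultimately show ?thesis using ic by simp
qed

lemma Cc_compose:
  fixes \<phi> :: "real^'n::finite \<Rightarrow> real"
  assumes \<phi>: "\<phi> \<in> Cc (Suc 0) S" and H: "\<And>s. (H has_real_derivative H' s) (at s)" "continuous_on UNIV H'" "H 0 = 0"
  shows "(\<lambda>x. H (\<phi> x)) \<in> Cc (Suc 0) S" "grad (\<lambda>x. H (\<phi> x)) x = H' (\<phi> x) *\<^sub>R grad \<phi> x"
proof -
  obtain K where K: "smooth_on (Suc 0) UNIV \<phi>" "compact K" "K \<subseteq> S" "\<And>x. x \<notin> K \<Longrightarrow> \<phi> x = 0"
    using CcE[OF \<phi>] by blast
  have d: "((\<lambda>x. H (\<phi> x)) has_derivative (\<lambda>h. (H' (\<phi> x) *\<^sub>R grad \<phi> x) \<bullet> h)) (at x)" for x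
    using has_derivative_compose[OF has_derivative_grad[of \<phi> x] H(1)[unfolded has_field_derivative_def]] K(1) by simp
  show "grad (\<lambda>x. H (\<phi> x)) x = H' (\<phi> x) *\<^sub>R grad \<phi> x" by (rule grad_eq(1)[OF d])
  have "smooth_on 1 UNIV (\<lambda>x. H (\<phi> x))"
  proof (rule smooth_on_1I[OF open_UNIV d])
    fix k
    have "continuous_on UNIV (\<lambda>x. H' (\<phi> x))"
      by (rule continuous_on_compose2[OF H(2) smooth_on_imp_continuous_on[OF K(1)]]) auto
    then show "continuous_on UNIV (\<lambda>x. (H' (\<phi> x) *\<^sub>R grad \<phi> x) $ k)"
      using smooth_on_imp_continuous_partial[OF K(1), of k] by (auto intro: continuous_intros)
  qed
  then have "smooth_on (Suc 0) UNIV (\<lambda>x. H (\<phi> x))" by (simp only: One_nat_def)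
  then show "(\<lambda>x. H (\<phi> x)) \<in> Cc (Suc 0) S"
    by (rule CcI[OF _ K(2,3)]) (use K(4) H(3) in auto)
qed

text \<open>
  Apply the pairing to \<open>H \<circ> \<phi>\<close> for test functions \<open>\<phi>\<close> close to \<open>u\<close>. The angular derivative of \<open>\<phi>\<close>
  is small in \<open>L\<^sup>2\<close>, because that of \<open>u\<close> vanishes. The Lipschitz bound on \<open>H\<close> keeps both errors of
  first order in the distance of \<open>\<phi>\<close> and \<open>u\<close>.
\<close>

lemma angular_zero_pairing:
  fixes u :: "real^'n::finite \<Rightarrow> real"
  assumes r: "0 < r" and u: "u \<in> H10 (annulus r)" and g: "has_weak_gradient (annulus r) u g"
    and ab: "a \<noteq> b" and L: "AE x in lebesgue_on (annulus r). angular a b x (g x) = 0"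
    and H: "\<And>s. (H has_real_derivative H' s) (at s)" "continuous_on UNIV H'" "H 0 = 0" "\<And>s. \<bar>H' s\<bar> \<le> C"
  shows "(LINT x|lebesgue_on (annulus r). H (u x) * dir a x) = 0"
proof -
  let ?S = "annulus r :: (real^'n) set"
  let ?M = "lebesgue_on ?S"
  have o: "open ?S" by (rule annulus_geometry)
  have Sl: "?S \<in> lmeasurable" by (rule annulus_geometry)
  have us: "square_integrable ?S u" by (rule H1_sqint[OF H10_H1[OF u]])
  have C: "C \<ge> 0" using H(4)[of 0] abs_ge_zero order_trans by blast
  have lip: "\<bar>H s - H t\<bar> \<le> C * \<bar>s - t\<bar>" for s t
    using field_differentiable_bound[OF convex_UNIV H(1) _ UNIV_I UNIV_I, of C s t] H(4) by simp
  have Hc: "continuous_on UNIV H" using H(1) by (intro continuous_at_imp_continuous_on ballI DERIV_isCont) auto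
  have Hm: "(\<lambda>x. H (v x)) \<in> borel_measurable ?M" if "square_integrable ?S v" for v
    using measurable_compose[OF sqint_measurable[OF that] borel_measurable_continuous_onI[OF Hc]] .
  have dm: "dir k \<in> borel_measurable ?M" for k :: 'n by (rule smooth_measurable[OF o smooth_on_dir[OF r, of 0]])
  have Hs: "square_integrable ?S (\<lambda>x. H (v x))" if v: "square_integrable ?S v" for v
    unfolding square_integrable_def
  proof
    show "integrable ?M (\<lambda>x. (H (v x))\<^sup>2)"
    proof (rule integrable_of_bound[where g = "\<lambda>x. C\<^sup>2 * (v x)\<^sup>2"])
      show "integrable ?M (\<lambda>x. C\<^sup>2 * (v x)\<^sup>2)" using sqint_square[OF v] by simp
      show "(\<lambda>x. (H (v x))\<^sup>2) \<in> borel_measurable ?M" using Hm[OF v] by simp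
      fix x
      have "\<bar>H (v x)\<bar> \<le> C * \<bar>v x\<bar>" using lip[of "v x" 0] H(3) by simp
      then have "\<bar>H (v x)\<bar>\<^sup>2 \<le> (C * \<bar>v x\<bar>)\<^sup>2" by (rule power_mono) simp
      then show "\<bar>(H (v x))\<^sup>2\<bar> \<le> C\<^sup>2 * (v x)\<^sup>2" by (simp add: power_mult_distrib)
    qed
  qed (rule Hm[OF v])
  have Hd: "integrable ?M (\<lambda>x. H (v x) * dir a x)" if v: "square_integrable ?S v" for v
    using sqint_integrable[OF Sl sqint_bounded_mult[OF Hs[OF v] dm dir_bounds]] by (simp add: mult.commute)
  define \<mu> where "\<mu> = measure ?M ?S"
  have bound: "\<bar>LINT x|?M. H (u x) * dir a x\<bar> \<le> \<epsilon> * (C * (\<mu> + 1))" if \<epsilon>: "\<epsilon> > 0" for \<epsilon>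
  proof -
    obtain \<phi> where \<phi>: "\<phi> \<in> test_functions ?S" "H1_energy ?S (\<lambda>x. u x - \<phi> x) (\<lambda>x. g x - grad \<phi> x) < \<epsilon>\<^sup>2"
      using H10_approx[OF o u g, of "\<epsilon>\<^sup>2"] \<epsilon> by auto
    define w where "w x = u x - \<phi> x" for x
    define h where "h x = g x - grad \<phi> x" for x
    have \<phi>s: "square_integrable ?S \<phi>" by (rule test_sqint(1)[OF o \<phi>(1)])
    have wsq: "square_integrable ?S w" and hw: "has_weak_gradient ?S w h"
      unfolding w_def h_def by (intro sqint_diff has_weak_gradient_minus_test o us g \<phi>s \<phi>)+
    have \<phi>1: "\<phi> \<in> Cc (Suc 0) ?S" using \<phi>(1) by (simp add: test_functions_Cc)
    note c = Cc_compose[OF \<phi>1 H(1-3)]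
    have pair: "(LINT x|?M. H (\<phi> x) * dir a x) = - (LINT x|?M. dir b x * (H' (\<phi> x) * angular a b x (grad \<phi> x)))"
      using angular_pairing_Cc[OF r c(1) ab] by (simp add: c(2) angular_scaleR)
    have ci: "integrable ?M (\<lambda>x. dir b x * (H' (\<phi> x) * angular a b x (grad \<phi> x)))"
    proof -
      have "square_integrable ?S (\<lambda>x. angular a b x (grad (\<lambda>x. H (\<phi> x)) x))"
        by (rule sqint_angular[OF has_weak_gradient_Cc[OF o c(1)]])
      then have "square_integrable ?S (\<lambda>x. dir b x * angular a b x (grad (\<lambda>x. H (\<phi> x)) x))"
        by (rule sqint_bounded_mult[OF _ dm dir_bounds])
      from sqint_integrable[OF Sl this] show ?thesis by (simp add: c(2) angular_scaleR)
    qed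
    have iE: "integrable ?M (\<lambda>x. (w x)\<^sup>2 + (norm (h x))\<^sup>2)" by (rule H1_energy_integrable[OF wsq hw])
    have ib: "integrable ?M (\<lambda>x. C * (\<epsilon> + ((w x)\<^sup>2 + (norm (h x))\<^sup>2) / \<epsilon>))"
      using iE sqint_integrable[OF Sl sqint_const[OF Sl, of \<epsilon>]] by simp
    have "(LINT x|?M. H (u x) * dir a x) = (LINT x|?M. (H (u x) * dir a x - H (\<phi> x) * dir a x)
         - dir b x * (H' (\<phi> x) * angular a b x (grad \<phi> x)))"
      using Hd[OF us] Hd[OF \<phi>s] ci pair by simp
    then have "\<bar>LINT x|?M. H (u x) * dir a x\<bar> = \<bar>LINT x|?M. (H (u x) * dir a x - H (\<phi> x) * dir a x)
         - dir b x * (H' (\<phi> x) * angular a b x (grad \<phi> x))\<bar>"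
      by (rule arg_cong)
    also have "\<dots> \<le> (LINT x|?M. \<bar>(H (u x) * dir a x - H (\<phi> x) * dir a x)
         - dir b x * (H' (\<phi> x) * angular a b x (grad \<phi> x))\<bar>)"
      by (rule integral_abs_bound)
    also have "\<dots> \<le> (LINT x|?M. C * (\<epsilon> + ((w x)\<^sup>2 + (norm (h x))\<^sup>2) / \<epsilon>))"
    proof (rule integral_mono_AE[OF _ ib])
      show "integrable ?M (\<lambda>x. \<bar>(H (u x) * dir a x - H (\<phi> x) * dir a x) - dir b x * (H' (\<phi> x) * angular a b x (grad \<phi> x))\<bar>)"
        using Hd[OF us] Hd[OF \<phi>s] ci by simp
      have "AE x in ?M. x \<in> ?S" by (rule AE_I2) simp
      with L show "AE x in ?M. \<bar>(H (u x) * dir a x - H (\<phi> x) * dir a x) - dir b x * (H' (\<phi> x) * angular a b x (grad \<phi> x))\<bar>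
        \<le> C * (\<epsilon> + ((w x)\<^sup>2 + (norm (h x))\<^sup>2) / \<epsilon>)"
      proof eventually_elim
        case (elim x)
        \<comment> \<open>Young's inequality bounds the errors in \<open>L\<^sup>1\<close> by the quadratic integrals in the \<open>H\<^sup>1\<close> distance.\<close>
        have yng: "\<bar>t\<bar> \<le> \<epsilon> / 2 + t\<^sup>2 / \<epsilon>" for t
        proof -
          have "0 \<le> (\<epsilon> - \<bar>t\<bar>)\<^sup>2" by simp
          then have "2 * \<epsilon> * \<bar>t\<bar> \<le> \<epsilon>\<^sup>2 + t\<^sup>2" by (simp add: power2_diff)
          then have "\<bar>t\<bar> \<le> (\<epsilon>\<^sup>2 + t\<^sup>2) / (2 * \<epsilon>)" using \<epsilon> by (simp add: field_simps)
          also have "\<dots> = \<epsilon> / 2 + t\<^sup>2 / \<epsilon> / 2" using \<epsilon> by (simp add: field_simps power2_eq_square)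
          finally have "\<bar>t\<bar> \<le> \<epsilon> / 2 + t\<^sup>2 / \<epsilon> / 2" .
          moreover have "0 \<le> t\<^sup>2 / \<epsilon>" using \<epsilon> by simp
          moreover have "a \<le> b + c" if "a \<le> b + c / 2" "0 \<le> c" for a b c :: real using that by linarith
          ultimately show ?thesis by blast
        qed
        have 1: "\<bar>H (u x) * dir a x - H (\<phi> x) * dir a x\<bar> \<le> C * \<bar>w x\<bar>"
        proof -
          have "\<bar>H (u x) * dir a x - H (\<phi> x) * dir a x\<bar> = \<bar>H (u x) - H (\<phi> x)\<bar> * \<bar>dir a x\<bar>"
            by (simp add: left_diff_distrib[symmetric] abs_mult)
          also have "\<dots> \<le> (C * \<bar>w x\<bar>) * 1" unfolding w_def using C by (intro mult_mono lip dir_bounds) auto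
          finally show ?thesis by simp
        qed
        have "angular a b x (grad \<phi> x) = - angular a b x (h x)"
          using elim(1) by (simp add: h_def angular_diff)
        moreover have "\<bar>angular a b x (h x)\<bar> \<le> norm (h x)"
          using angular_square_le_annulus[OF elim(2), of a b "h x"] by (simp add: abs_le_square_iff[symmetric])
        ultimately have 2: "\<bar>angular a b x (grad \<phi> x)\<bar> \<le> norm (h x)" by simp
        have 3: "\<bar>dir b x * (H' (\<phi> x) * angular a b x (grad \<phi> x))\<bar> \<le> 1 * (C * norm (h x))"
          unfolding abs_mult using C by (intro mult_mono dir_bounds H(4) 2) auto
        have "\<bar>(H (u x) * dir a x - H (\<phi> x) * dir a x) - dir b x * (H' (\<phi> x) * angular a b x (grad \<phi> x))\<bar>
          \<le> C * \<bar>w x\<bar> + C * \<bar>norm (h x)\<bar>" using 1 3 by simp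
        also have "\<dots> \<le> C * (\<epsilon> / 2 + (w x)\<^sup>2 / \<epsilon>) + C * (\<epsilon> / 2 + (norm (h x))\<^sup>2 / \<epsilon>)"
          by (intro add_mono mult_left_mono yng C)
        also have "\<dots> = C * (\<epsilon> + ((w x)\<^sup>2 + (norm (h x))\<^sup>2) / \<epsilon>)" by (simp add: algebra_simps add_divide_distrib)
        finally show ?case .
      qed
    qed
    also have "\<dots> = C * (\<epsilon> * \<mu> + H1_energy ?S w h / \<epsilon>)"
      using iE sqint_integrable[OF Sl sqint_const[OF Sl, of \<epsilon>]] by (simp add: H1_energy_def \<mu>_def mult.commute)
    also have "\<dots> \<le> C * (\<epsilon> * \<mu> + \<epsilon>)"
    proof -
      have "H1_energy ?S w h / \<epsilon> \<le> \<epsilon>" using \<phi>(2) \<epsilon> by (simp add: w_def[abs_def] h_def[abs_def] divide_le_eq power2_eq_square)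
      then show ?thesis using C by (intro mult_left_mono add_left_mono) auto
    qed
    finally show ?thesis by (simp add: algebra_simps)
  qed
  have "((\<lambda>\<epsilon>. \<epsilon> * (C * (\<mu> + 1))) \<longlongrightarrow> 0 * (C * (\<mu> + 1))) (at_right 0)" by (intro tendsto_intros)
  then have "((\<lambda>\<epsilon>. \<epsilon> * (C * (\<mu> + 1))) \<longlongrightarrow> 0) (at_right 0)" by simp
  then have "\<bar>LINT x|?M. H (u x) * dir a x\<bar> \<le> 0"
    by (rule tendsto_lowerbound) (auto intro!: eventually_mono[OF eventually_at_right_less[of 0]] bound)
  then show ?thesis by simp
qed

lemma abs_powr_has_derivative:
  assumes "p > (2::real)"
  shows "((\<lambda>s. \<bar>s\<bar> powr p) has_real_derivative p * (\<bar>s\<bar> powr (p - 2) * s)) (at s)"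
proof (cases s "0::real" rule: linorder_cases)
  case greater
  have "((\<lambda>s. s powr p) has_real_derivative p * (\<bar>s\<bar> powr (p - 2) * s)) (at s)"
    using greater powr_add[of s "p - 2" 1] by (auto intro!: derivative_eq_intros)
  then show ?thesis
    by (rule has_field_derivative_transform_within_open[of _ _ _ "{0<..}"]) (use greater in auto)
next
  case less
  have "((\<lambda>s. (- s) powr p) has_real_derivative p * (\<bar>s\<bar> powr (p - 2) * s)) (at s)"
    using less powr_add[of "- s" "p - 2" 1] by (auto intro!: derivative_eq_intros)
  then show ?thesis
    by (rule has_field_derivative_transform_within_open[of _ _ _ "{..<0}"]) (use less in auto)
next
  case equal
  have "((\<lambda>h::real. \<bar>h\<bar> powr (p - 2) * h) \<longlongrightarrow> \<bar>0\<bar> powr (p - 2) * 0) (at 0)"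
    using assms by (intro tendsto_intros tendsto_powr') auto
  moreover have "\<bar>h\<bar> powr (p - 2) * h = (\<bar>0 + h\<bar> powr p - \<bar>0\<bar> powr p) / h" if "h \<noteq> 0" for h :: real
    using that abs_powr_mult_self[of h p] by (simp add: field_simps)
  ultimately have "((\<lambda>h::real. (\<bar>0 + h\<bar> powr p - \<bar>0\<bar> powr p) / h) \<longlongrightarrow> 0) (at 0)"
    using Lim_transform_eventually[of "\<lambda>h::real. \<bar>h\<bar> powr (p - 2) * h" 0 "at 0"]
    by (force simp: eventually_at_filter)
  then show ?thesis using equal by (simp add: DERIV_def)
qed

text \<open>
  The function \<open>|s|^p\<close> is not Lipschitz. It is the limit of \<open>|s|^p / (1 + e |s|^p)\<close> as \<open>e\<close> tends
  to zero, which has a bounded derivative for \<open>e > 0\<close> and is dominated by \<open>|s|^p\<close>.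
\<close>

lemma abs_powr_pairing:
  fixes u :: "real^'n::finite \<Rightarrow> real"
  assumes r: "0 < r" and u: "u \<in> H10 (annulus r)" and g: "has_weak_gradient (annulus r) u g"
    and ab: "a \<noteq> b" and L: "AE x in lebesgue_on (annulus r). angular a b x (g x) = 0"
    and p: "p > 2" and int: "integrable (lebesgue_on (annulus r)) (\<lambda>x. \<bar>u x\<bar> powr p)"
  shows "(LINT x|lebesgue_on (annulus r). \<bar>u x\<bar> powr p * dir a x) = 0"
proof -
  let ?M = "lebesgue_on (annulus r :: (real^'n) set)"
  define e where "e n = inverse (real (Suc n))" for n
  have e: "e n > 0" for n by (simp add: e_def)
  define H where "H n s = \<bar>s\<bar> powr p / (1 + e n * \<bar>s\<bar> powr p)" for n s
  define H' where "H' n s = p * (\<bar>s\<bar> powr (p - 2) * s) / (1 + e n * \<bar>s\<bar> powr p)\<^sup>2" for n s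
  have pos: "1 + e n * \<bar>s\<bar> powr p \<ge> 1" for n s using e[of n] by simp
  then have pos': "1 + e n * \<bar>s\<bar> powr p \<noteq> 0" for n s by (metis not_one_le_zero)
  have dH: "(H n has_real_derivative H' n s) (at s)" for n s
  proof -
    have "(H n has_real_derivative ((p * (\<bar>s\<bar> powr (p - 2) * s)) * (1 + e n * \<bar>s\<bar> powr p) - \<bar>s\<bar> powr p * (e n * (p * (\<bar>s\<bar> powr (p - 2) * s))))
        / ((1 + e n * \<bar>s\<bar> powr p) * (1 + e n * \<bar>s\<bar> powr p))) (at s)"
      unfolding H_def
    proof (rule DERIV_divide)
      show "((\<lambda>s. \<bar>s\<bar> powr p) has_real_derivative p * (\<bar>s\<bar> powr (p - 2) * s)) (at s)"
        by (rule abs_powr_has_derivative[OF p])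
      show "((\<lambda>s. 1 + e n * \<bar>s\<bar> powr p) has_real_derivative e n * (p * (\<bar>s\<bar> powr (p - 2) * s))) (at s)"
        using DERIV_add[OF DERIV_const[of 1] DERIV_cmult[OF abs_powr_has_derivative[OF p, of s], of "e n"]] by simp
    qed (rule pos')
    then show ?thesis by (simp add: H'_def power2_eq_square algebra_simps)
  qed
  have cH: "continuous_on UNIV (H' n)" for n
    unfolding H'_def using p pos' by (intro continuous_intros continuous_on_powr') auto
  have bH: "\<bar>H' n s\<bar> \<le> p * (1 + 1 / e n)" for n s
  proof -
    define Q where "Q = 1 + e n * \<bar>s\<bar> powr p"
    have Q: "Q \<ge> 1" unfolding Q_def by (rule pos)
    have "\<bar>s\<bar> powr (p - 2) * \<bar>s\<bar> \<le> 1 + \<bar>s\<bar> powr p"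
    proof (cases "\<bar>s\<bar> \<le> 1")
      case True
      then have "\<bar>s\<bar> powr (p - 2) * \<bar>s\<bar> \<le> 1 * 1" using p by (intro mult_mono powr_le1) auto
      then show ?thesis by (simp add: add_increasing2)
    next
      case False
      then have "\<bar>s\<bar> powr (p - 2) * \<bar>s\<bar> * 1 \<le> \<bar>s\<bar> powr (p - 2) * \<bar>s\<bar> * \<bar>s\<bar>" by (intro mult_left_mono) auto
      also have "\<dots> = \<bar>s\<bar> powr p" using abs_powr_mult_self[of "\<bar>s\<bar>" p] by simp
      finally show ?thesis by simp
    qed
    also have "\<dots> \<le> Q + Q / e n"
      using e[of n] by (intro add_mono) (auto simp: Q_def field_simps)
    also have "\<dots> \<le> (1 + 1 / e n) * Q\<^sup>2"
    proof -
      have "Q \<le> Q\<^sup>2" using Q by (simp add: power2_eq_square)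
      then have "(1 + 1 / e n) * Q \<le> (1 + 1 / e n) * Q\<^sup>2" using e[of n] by (intro mult_left_mono) auto
      then show ?thesis by (simp add: distrib_right)
    qed
    finally have "\<bar>s\<bar> powr (p - 2) * \<bar>s\<bar> / Q\<^sup>2 \<le> 1 + 1 / e n" using Q by (simp add: divide_le_eq)
    then have "p * (\<bar>s\<bar> powr (p - 2) * \<bar>s\<bar> / Q\<^sup>2) \<le> p * (1 + 1 / e n)" using p by (intro mult_left_mono) auto
    then show ?thesis using p by (simp add: H'_def Q_def[symmetric] abs_mult)
  qed
  have 0: "(LINT x|?M. H n (u x) * dir a x) = 0" for n
    by (rule angular_zero_pairing[OF r u g ab L dH cH _ bH]) (simp add: H_def)
  have um: "u \<in> borel_measurable ?M" by (rule sqint_measurable[OF H1_sqint[OF H10_H1[OF u]]])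
  have dm: "dir a \<in> borel_measurable ?M" by (rule smooth_measurable[OF annulus_geometry(1) smooth_on_dir[OF r, of 0]])
  have "(\<lambda>n. LINT x|?M. H n (u x) * dir a x) \<longlonglongrightarrow> (LINT x|?M. \<bar>u x\<bar> powr p * dir a x)"
  proof (rule integral_dominated_convergence[OF _ _ int])
    show "(\<lambda>x. \<bar>u x\<bar> powr p * dir a x) \<in> borel_measurable ?M" using um dm by simp
    show "(\<lambda>x. H n (u x) * dir a x) \<in> borel_measurable ?M" for n unfolding H_def using um dm by simp
    show "AE x in ?M. (\<lambda>n. H n (u x) * dir a x) \<longlonglongrightarrow> \<bar>u x\<bar> powr p * dir a x"
    proof (rule AE_I2)
      fix x
      have "(\<lambda>n. \<bar>u x\<bar> powr p / (1 + e n * \<bar>u x\<bar> powr p) * dir a x) \<longlonglongrightarrow> \<bar>u x\<bar> powr p / (1 + 0 * \<bar>u x\<bar> powr p) * dir a x"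
        unfolding e_def by (intro tendsto_intros LIMSEQ_inverse_real_of_nat) auto
      then show "(\<lambda>n. H n (u x) * dir a x) \<longlonglongrightarrow> \<bar>u x\<bar> powr p * dir a x" by (simp add: H_def)
    qed
    show "AE x in ?M. norm (H n (u x) * dir a x) \<le> \<bar>u x\<bar> powr p" for n
    proof (rule AE_I2)
      fix x
      have "\<bar>H n (u x)\<bar> \<le> \<bar>u x\<bar> powr p"
        using pos[of n "u x"] by (simp add: H_def divide_le_eq mult_le_cancel_left1)
      then have "\<bar>H n (u x)\<bar> * \<bar>dir a x\<bar> \<le> \<bar>u x\<bar> powr p * 1" by (intro mult_mono dir_bounds) auto
      then show "norm (H n (u x) * dir a x) \<le> \<bar>u x\<bar> powr p" by (simp add: abs_mult)
    qed
  qed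
  then show ?thesis using 0 LIMSEQ_unique[of "\<lambda>n. 0::real"] by simp
qed

section \<open>The second variation\<close>

text \<open>
  Taylor expansion to second order; as \<open>p > 2\<close>, the second derivative is smallest at the left end
  of the interval.
\<close>

lemma powr_taylor_lower:
  fixes p s t :: real
  assumes p: "p > 2" and t: "\<bar>s\<bar> \<le> t" "t < 1"
  shows "1 + p * s + p * (p - 1) / 2 * (1 - t) powr (p - 2) * s\<^sup>2 \<le> (1 + s) powr p"
proof (cases "s = 0")
  case False
  define D where "D m s = (if m = 0 then (1 + s) powr p else if m = 1 then p * (1 + s) powr (p - 1)
      else p * (p - 1) * (1 + s) powr (p - 2))" for m :: nat and s :: real
  have "\<forall>m x. m < 2 \<and> - t \<le> x \<and> x \<le> t \<longrightarrow> DERIV (D m) x :> D (Suc m) x"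
  proof (intro allI impI)
    fix m :: nat and x assume a: "m < 2 \<and> - t \<le> x \<and> x \<le> t"
    then have x: "1 + x > 0" using t by linarith
    have d: "((\<lambda>s. (1 + s) powr q) has_real_derivative q * (1 + x) powr (q - 1)) (at x)" for q
      using x by (auto intro!: derivative_eq_intros)
    from a have "m = 0 \<or> m = 1" by auto
    then show "DERIV (D m) x :> D (Suc m) x"
      using d[of p] DERIV_cmult[OF d[of "p - 1"], of p] by (auto simp: D_def[abs_def] algebra_simps)
  qed
  moreover have "D 0 = (\<lambda>s. (1 + s) powr p)" by (simp add: D_def[abs_def])
  ultimately have "\<exists>z. (if s < 0 then s < z \<and> z < 0 else 0 < z \<and> z < s) \<and>
    (1 + s) powr p = (\<Sum>m<2. D m 0 / fact m * (s - 0) ^ m) + D 2 z / fact 2 * (s - 0)\<^sup>2"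
    by (intro Taylor[of 2 D "\<lambda>s. (1 + s) powr p" "- t" t 0 s]) (use t False in auto)
  then obtain z where z: "if s < 0 then s < z \<and> z < 0 else 0 < z \<and> z < s"
    "(1 + s) powr p = (\<Sum>m<2. D m 0 / fact m * (s - 0) ^ m) + D 2 z / fact 2 * (s - 0)\<^sup>2"
    by blast
  have "(1 - t) powr (p - 2) \<le> (1 + z) powr (p - 2)"
    using z(1) t p by (intro powr_mono2) (auto split: if_splits)
  then have "p * (p - 1) / 2 * (1 - t) powr (p - 2) * s\<^sup>2 \<le> p * (p - 1) / 2 * (1 + z) powr (p - 2) * s\<^sup>2"
    using p by (intro mult_right_mono mult_left_mono) auto
  then show ?thesis
    using z(2) by (simp add: D_def eval_nat_numeral)
qed simp

text \<open>
  A lower bound for \<open>(1 + c)^q\<close> that is exact to first order at \<open>c = 0\<close> also for \<open>q < 1\<close>, where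
  the Bernoulli inequality points the other way.
\<close>

lemma powr_ge_reverse_bernoulli:
  fixes c q :: real
  assumes "c \<ge> 0" "q \<ge> 0"
  shows "1 + q * (c / (1 + c)) \<le> (1 + c) powr q"
proof -
  have "ln (inverse (1 + c)) \<le> inverse (1 + c) - 1"
    using assms by (intro ln_le_minus_one) simp
  moreover have "ln (inverse (1 + c)) = - ln (1 + c)" using assms by (simp add: ln_inverse)
  moreover have "c / (1 + c) = 1 - inverse (1 + c)" using assms by (simp add: field_simps)
  ultimately have "c / (1 + c) \<le> ln (1 + c)" by linarith
  then have "q * (c / (1 + c)) \<le> q * ln (1 + c)" using assms(2) by (rule mult_left_mono)
  also have "1 + q * ln (1 + c) \<le> exp (q * ln (1 + c))" by (rule exp_ge_add_one_self)
  finally have "1 + q * (c / (1 + c)) \<le> exp (q * ln (1 + c))" by simp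
  then show ?thesis using assms by (simp add: powr_def)
qed

text \<open>
  The comparison of Rayleigh quotients at distance \<open>t\<close> from the minimizer, to second order in \<open>t\<close>:
  here \<open>D\<close> is the common value of numerator and mass at the minimizer, \<open>B\<close> the second order term
  of the numerator, and \<open>E\<close> the weighted mass of the direction.
\<close>

lemma second_variation_limit:
  fixes B D E p :: real
  assumes p: "p > 2" and D: "D > 0" and E: "E \<ge> 0"
    and ineq: "\<And>t. 0 < t \<Longrightarrow> t < 1 \<Longrightarrow>
      D / D powr (2 / p) \<le> (D + t\<^sup>2 * B) / (D + p * (p - 1) / 2 * (1 - t) powr (p - 2) * t\<^sup>2 * E) powr (2 / p)"
  shows "(p - 1) * E \<le> B"
proof -
  define c where "c t = p * (p - 1) / 2 * (1 - t) powr (p - 2) * t\<^sup>2 * E / D" for t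
  have c: "c t \<ge> 0" for t unfolding c_def using p D E by simp
  have B: "(p - 1) * (1 - t) powr (p - 2) * E / (1 + c t) \<le> B" if t: "0 < t" "t < 1" for t
  proof -
    have M: "D + p * (p - 1) / 2 * (1 - t) powr (p - 2) * t\<^sup>2 * E = D * (1 + c t)"
      using D by (simp add: c_def field_simps)
    have Mp: "(D * (1 + c t)) powr (2 / p) = D powr (2 / p) * (1 + c t) powr (2 / p)"
      using D c[of t] by (simp add: powr_mult)
    have pos: "D powr (2 / p) > 0" "(1 + c t) powr (2 / p) > 0" using D c[of t] by auto
    have "D / D powr (2 / p) \<le> (D + t\<^sup>2 * B) / (D powr (2 / p) * (1 + c t) powr (2 / p))"
      using ineq[OF t] unfolding M Mp .
    then have "D * (1 + c t) powr (2 / p) \<le> D + t\<^sup>2 * B"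
      using pos by (simp add: field_simps)
    moreover have "D * (1 + 2 / p * (c t / (1 + c t))) \<le> D * (1 + c t) powr (2 / p)"
      using powr_ge_reverse_bernoulli[OF c, of "2 / p" t] p D by (intro mult_left_mono) auto
    ultimately have "D * (2 / p * (c t / (1 + c t))) \<le> t\<^sup>2 * B" by (simp add: algebra_simps)
    moreover have "D * (2 / p * (c t / (1 + c t))) = t\<^sup>2 * ((p - 1) * (1 - t) powr (p - 2) * E / (1 + c t))"
    proof -
      have "D * (2 / p) * c t = t\<^sup>2 * ((p - 1) * (1 - t) powr (p - 2) * E)"
        using D p by (simp add: c_def field_simps)
      then show ?thesis by (metis times_divide_eq_right mult.assoc)
    qed
    ultimately have "t\<^sup>2 * ((p - 1) * (1 - t) powr (p - 2) * E / (1 + c t)) \<le> t\<^sup>2 * B" by (simp only:)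
    then show ?thesis by (rule mult_left_le_imp_le) (use t in simp)
  qed
  have "((\<lambda>t. (p - 1) * (1 - t) powr (p - 2) * E / (1 + c t)) \<longlongrightarrow> (p - 1) * (1 - 0) powr (p - 2) * E / (1 + c 0)) (at_right 0)"
    unfolding c_def using D by (intro tendsto_intros) auto
  then have lim: "((\<lambda>t. (p - 1) * (1 - t) powr (p - 2) * E / (1 + c t)) \<longlongrightarrow> (p - 1) * E) (at_right 0)"
    by (simp add: c_def)
  have "\<forall>\<^sub>F t in at_right 0. (p - 1) * (1 - t) powr (p - 2) * E / (1 + c t) \<le> B"
    using eventually_at_right_real[of 0 1] by (rule eventually_mono) (auto intro: B)
  from tendsto_upperbound[OF lim this] show ?thesis by simp
qed

text \<open>
  Compare \<open>u\<close> with \<open>u (1 + t Y\<^sub>a)\<close> in the Rayleigh quotient for the \<open>a\<close>-\<open>b\<close>-plane. The first order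
  terms in \<open>t\<close> of numerator and denominator are multiples of \<open>\<integral> |u|^p Y\<^sub>a = 0\<close>, the former by the
  equation.
\<close>

lemma second_variation:
  fixes u :: "real^'n::finite \<Rightarrow> real"
  assumes N: "CARD('n) \<ge> 2" and ij: "i \<noteq> j" and r: "0 < r" "r < 1" and m: "m \<ge> 0" and \<alpha>: "0 < \<alpha>" "\<alpha> \<le> 1" and p: "p > 2"
    and gs: "ground_state i j (annulus r) \<alpha> m p u"
    and g: "has_weak_gradient (annulus r) u g"
    and L: "AE x in lebesgue_on (annulus r). angular i j x (g x) = 0"
    and ab: "a \<noteq> b"
  shows "(p - 1) * (LINT x|lebesgue_on (annulus r). \<bar>u x\<bar> powr p * (dir a x)\<^sup>2)
    \<le> (LINT x|lebesgue_on (annulus r). (norm (dir a x *\<^sub>R g x + u x *\<^sub>R grad (dir a) x))\<^sup>2)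
      - \<alpha>\<^sup>2 * (LINT x|lebesgue_on (annulus r). (dir b x * u x)\<^sup>2) + m * (LINT x|lebesgue_on (annulus r). (dir a x * u x)\<^sup>2)"
proof -
  let ?S = "annulus r :: (real^'n) set"
  let ?M = "lebesgue_on ?S"
  have o: "open ?S" by (rule annulus_geometry)
  have ws: "weak_solution i j ?S \<alpha> m p u" and nz: "\<not> ae_zero ?S u" and R: "rayleigh i j ?S \<alpha> m p u = ground_level i j ?S \<alpha> m p"
    using gs by (auto simp: ground_state_def)
  have u: "u \<in> H10 ?S" using ws by (simp add: weak_solution_def)
  note us = H1_sqint[OF H10_H1[OF u]]
  note mass = angular_free_solution_mass[OF N r m ws nz g L]
  have Lab: "AE x in ?M. angular a b x (g x) = 0"
    by (rule ground_state_angular_zero[OF N ij r m \<alpha> gs g L ab])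
  define D where "D = Lp_mass r p u"
  have D: "D > 0" using mass(2) by (simp add: D_def)
  define w where "w x = dir a x * u x" for x
  define k where "k x = dir a x *\<^sub>R g x + u x *\<^sub>R grad (dir a) x" for x
  have db: "\<bar>dir a x\<bar> \<le> 2 / r + 2" for x :: "real^'n" using dir_bounds[of a x] r by (simp add: add_increasing)
  have pb: "\<bar>partial_deriv l (dir a) x\<bar> \<le> 2 / r + 2" if "x \<in> ?S" for x l
    using partial_dir_bound[OF r(1) that, of l a] by simp
  have ws': "square_integrable ?S w"
    unfolding w_def by (rule has_weak_gradient_mult(1)[OF o us g smooth_on_dir[OF r(1)] db pb])
  have k: "has_weak_gradient ?S w k"
    unfolding w_def k_def by (rule has_weak_gradient_mult(2)[OF o us g smooth_on_dir[OF r(1)] db pb])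
  have wH: "w \<in> H10 ?S"
    unfolding w_def by (rule H10_mult[OF o u smooth_on_dir[OF r(1)] db pb])
  have dm: "dir l \<in> borel_measurable ?M" for l by (rule smooth_measurable[OF o smooth_on_dir[OF r(1), of 0]])
  have um: "u \<in> borel_measurable ?M" by (rule sqint_measurable[OF us])
  have up: "integrable ?M (\<lambda>x. \<bar>u x\<bar> powr p)" by (rule mass(3))
  have upd: "integrable ?M (\<lambda>x. \<bar>u x\<bar> powr p * dir a x)"
    using integrable_mult_dir_power[OF r(1) up, of a 1] by simp
  have upd2: "integrable ?M (\<lambda>x. \<bar>u x\<bar> powr p * (dir a x)\<^sup>2)"
    by (rule integrable_mult_dir_power[OF r(1) up])
  define E where "E = (LINT x|?M. \<bar>u x\<bar> powr p * (dir a x)\<^sup>2)"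
  have E: "E \<ge> 0" unfolding E_def by (rule Bochner_Integration.integral_nonneg) simp
  have first: "(LINT x|?M. \<bar>u x\<bar> powr p * dir a x) = 0"
    by (rule abs_powr_pairing[OF r(1) u g ab Lab p up])
  have gk: "(LINT x|?M. g x \<bullet> k x + m * (u x * w x)) = 0"
  proof -
    have "(LINT x|?M. g x \<bullet> k x + m * (u x * w x)) = (LINT x|?M. \<bar>u x\<bar> powr (p - 2) * u x * w x)"
      by (rule weak_solution_energy[OF ws g L wH k])
    also have "(\<lambda>x. \<bar>u x\<bar> powr (p - 2) * u x * w x) = (\<lambda>x. \<bar>u x\<bar> powr p * dir a x)"
    proof
      fix x
      have "\<bar>u x\<bar> powr (p - 2) * u x * w x = (\<bar>u x\<bar> powr (p - 2) * u x * u x) * dir a x"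
        by (simp add: w_def mult_ac)
      then show "\<bar>u x\<bar> powr (p - 2) * u x * w x = \<bar>u x\<bar> powr p * dir a x"
        unfolding abs_powr_mult_self .
    qed
    finally show ?thesis using first by simp
  qed
  define B where "B = energy a b r \<alpha> m w k"
  have var: "D / D powr (2 / p) \<le> (D + t\<^sup>2 * B) / (D + p * (p - 1) / 2 * (1 - t) powr (p - 2) * t\<^sup>2 * E) powr (2 / p)"
    if t: "0 < t" "t < 1" for t
  proof -
    \<comment> \<open>The competitor; its weak gradient is affine in \<open>t\<close>.\<close>
    define v where "v x = (1 + t * dir a x) * u x" for x
    define h where "h x = g x + t *\<^sub>R k x" for x
    have veq: "v = (\<lambda>x. 1 * u x + t * w x)" by (simp add: v_def w_def fun_eq_iff algebra_simps)
    have heq: "h = (\<lambda>x. 1 *\<^sub>R g x + t *\<^sub>R k x)" by (simp add: h_def fun_eq_iff)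
    have vs: "square_integrable ?S v" unfolding veq by (intro sqint_add sqint_cmult us ws')
    have vg: "has_weak_gradient ?S v h"
      unfolding veq heq by (rule has_weak_gradient_lincomb[OF o us ws' g k])
    have dpos: "1 + t * dir a x > 0" for x :: "real^'n"
    proof -
      have "\<bar>t * dir a x\<bar> \<le> t * 1" unfolding abs_mult using t dir_bounds[of a x] by (intro mult_mono) auto
      then show ?thesis using t by linarith
    qed
    have vH: "v \<in> H10 ?S"
      unfolding v_def
    proof (rule H10_mult[OF o u])
      show sm: "smooth_on l ?S (\<lambda>x. 1 + t * dir a x)" for l
        by (intro smooth_on_add smooth_on_mult smooth_on_const smooth_on_dir o r)
      fix x assume x: "x \<in> ?S"
      have "\<bar>t * dir a x\<bar> \<le> 1 * 1" unfolding abs_mult using t dir_bounds[of a x] by (intro mult_mono) auto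
      then have "\<bar>1 + t * dir a x\<bar> \<le> 2" by linarith
      then show "\<bar>1 + t * dir a x\<bar> \<le> 2 / r + 2" using r by (simp add: add_increasing)
      fix l
      have x0: "x \<noteq> 0" using x r annulus_pos by blast
      have "((\<lambda>x. 1 + t * dir a x) has_derivative (\<lambda>h. (t *\<^sub>R grad (dir a) x) \<bullet> h)) (at x)"
        using has_derivative_grad[OF grad_dir(1)[OF x0, of a]] by (auto intro!: derivative_eq_intros)
      then have "partial_deriv l (\<lambda>x. 1 + t * dir a x) x = t * partial_deriv l (dir a) x"
        using grad_eq(2) by fastforce
      moreover have "\<bar>t * partial_deriv l (dir a) x\<bar> \<le> 1 * (2 / r + 2)"
        unfolding abs_mult using t pb[OF x, of l] by (intro mult_mono) auto
      ultimately show "\<bar>partial_deriv l (\<lambda>x. 1 + t * dir a x) x\<bar> \<le> 2 / r + 2" by simp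
    qed
    have vnz: "\<not> ae_zero ?S v"
    proof
      assume "ae_zero ?S v"
      then have "AE x in ?M. v x = 0" by (simp add: ae_zero_def)
      then have "AE x in ?M. u x = 0"
        by (rule eventually_mono) (use dpos in \<open>auto simp: v_def less_le\<close>)
      with nz show False by (simp add: ae_zero_def)
    qed
    \<comment> \<open>The angular term of \<open>v\<close> has no part of order zero or one in \<open>t\<close>, because that of \<open>u\<close> vanishes.\<close>
    have en: "energy a b r \<alpha> m v h = D + t\<^sup>2 * B"
    proof -
      have i1: "integrable ?M (\<lambda>x. (norm (g x))\<^sup>2 + m * (u x)\<^sup>2)"
        using sqint_square[OF us] integrable_norm2_components[OF has_weak_gradient_sqint[OF g]] by simp
      have i2: "integrable ?M (\<lambda>x. g x \<bullet> k x + m * (u x * w x))"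
        using sqint_mult_integrable[OF us ws'] integrable_inner_components[OF has_weak_gradient_sqint[OF g] has_weak_gradient_sqint[OF k]]
        by simp
      have i3: "integrable ?M (\<lambda>x. (norm (k x))\<^sup>2 - \<alpha>\<^sup>2 * (angular a b x (k x))\<^sup>2 + m * (w x)\<^sup>2)"
        by (rule energy_integrable[OF ws' k])
      have "energy a b r \<alpha> m v h = (LINT x|?M. ((norm (g x))\<^sup>2 + m * (u x)\<^sup>2) + 2 * t * (g x \<bullet> k x + m * (u x * w x))
          + t\<^sup>2 * ((norm (k x))\<^sup>2 - \<alpha>\<^sup>2 * (angular a b x (k x))\<^sup>2 + m * (w x)\<^sup>2))"
        unfolding energy_def
      proof (rule integral_cong_AE)
        show "(\<lambda>x. (norm (h x))\<^sup>2 - \<alpha>\<^sup>2 * (angular a b x (h x))\<^sup>2 + m * (v x)\<^sup>2) \<in> borel_measurable ?M"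
          using energy_integrable[OF vs vg] by auto
        show "(\<lambda>x. ((norm (g x))\<^sup>2 + m * (u x)\<^sup>2) + 2 * t * (g x \<bullet> k x + m * (u x * w x))
          + t\<^sup>2 * ((norm (k x))\<^sup>2 - \<alpha>\<^sup>2 * (angular a b x (k x))\<^sup>2 + m * (w x)\<^sup>2)) \<in> borel_measurable ?M"
          by (rule borel_measurable_integrable[OF Bochner_Integration.integrable_add[OF
                  Bochner_Integration.integrable_add[OF i1 integrable_mult_right[OF i2]] integrable_mult_right[OF i3]]])
        show "AE x in ?M. (norm (h x))\<^sup>2 - \<alpha>\<^sup>2 * (angular a b x (h x))\<^sup>2 + m * (v x)\<^sup>2
          = ((norm (g x))\<^sup>2 + m * (u x)\<^sup>2) + 2 * t * (g x \<bullet> k x + m * (u x * w x))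
          + t\<^sup>2 * ((norm (k x))\<^sup>2 - \<alpha>\<^sup>2 * (angular a b x (k x))\<^sup>2 + m * (w x)\<^sup>2)"
          using Lab
        proof eventually_elim
          case (elim x)
          have n: "(norm (h x))\<^sup>2 = (norm (g x))\<^sup>2 + 2 * t * (g x \<bullet> k x) + t\<^sup>2 * (norm (k x))\<^sup>2"
            unfolding h_def power2_norm_eq_inner
            by (simp add: inner_add_left inner_add_right inner_commute power2_eq_square algebra_simps)
          have l: "angular a b x (h x) = t * angular a b x (k x)"
            by (simp add: h_def angular_add angular_scaleR elim)
          show ?case unfolding n l veq by (simp add: power2_eq_square algebra_simps)
        qed
      qed
      also have "\<dots> = (LINT x|?M. (norm (g x))\<^sup>2 + m * (u x)\<^sup>2) + 2 * t * (LINT x|?M. g x \<bullet> k x + m * (u x * w x)) + t\<^sup>2 * B"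
        unfolding B_def energy_def
        by (subst Bochner_Integration.integral_add[OF Bochner_Integration.integrable_add[OF i1 integrable_mult_right[OF i2]] integrable_mult_right[OF i3]],
            subst Bochner_Integration.integral_add[OF i1 integrable_mult_right[OF i2]]) simp
      also have "(LINT x|?M. (norm (g x))\<^sup>2 + m * (u x)\<^sup>2) = D"
        using mass(1) sqint_square[OF us] integrable_norm2_components[OF has_weak_gradient_sqint[OF g]] by (simp add: D_def)
      finally show ?thesis using gk by simp
    qed
    define Q where "Q = p * (p - 1) / 2 * (1 - t) powr (p - 2)"
    have Q: "Q \<ge> 0" using p by (simp add: Q_def)
    \<comment> \<open>The first order term in \<open>t\<close> integrates to zero.\<close>
    have vm: "Lp_mass r p v \<ge> D + Q * t\<^sup>2 * E"
    proof -
      have vp: "\<bar>v x\<bar> powr p = \<bar>u x\<bar> powr p * (1 + t * dir a x) powr p" for x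
        using dpos[of x] by (simp add: v_def abs_mult powr_mult mult.commute)
      have iv: "integrable ?M (\<lambda>x. \<bar>v x\<bar> powr p)"
      proof (rule integrable_of_bound[where g = "\<lambda>x. 2 powr p * \<bar>u x\<bar> powr p"])
        show "integrable ?M (\<lambda>x. 2 powr p * \<bar>u x\<bar> powr p)" using up by simp
        show "(\<lambda>x. \<bar>v x\<bar> powr p) \<in> borel_measurable ?M" using sqint_measurable[OF vs] by simp
        fix x
        have "\<bar>t * dir a x\<bar> \<le> 1 * 1" unfolding abs_mult using t dir_bounds[of a x] by (intro mult_mono) auto
        then have "(1 + t * dir a x) powr p \<le> 2 powr p" using dpos[of x] p by (intro powr_mono2) auto
        then have "\<bar>u x\<bar> powr p * (1 + t * dir a x) powr p \<le> \<bar>u x\<bar> powr p * 2 powr p" by (rule mult_left_mono) simp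
        then show "\<bar>\<bar>v x\<bar> powr p\<bar> \<le> 2 powr p * \<bar>u x\<bar> powr p" by (simp add: vp mult.commute)
      qed
      have "D + Q * t\<^sup>2 * E = (LINT x|?M. \<bar>u x\<bar> powr p + p * t * (\<bar>u x\<bar> powr p * dir a x) + Q * t\<^sup>2 * (\<bar>u x\<bar> powr p * (dir a x)\<^sup>2))"
        using up upd upd2 first by (simp add: D_def E_def Lp_mass_def)
      also have "\<dots> \<le> (LINT x|?M. \<bar>v x\<bar> powr p)"
      proof (rule integral_mono[OF _ iv])
        show "integrable ?M (\<lambda>x. \<bar>u x\<bar> powr p + p * t * (\<bar>u x\<bar> powr p * dir a x) + Q * t\<^sup>2 * (\<bar>u x\<bar> powr p * (dir a x)\<^sup>2))"
          using up upd upd2 by simp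
        fix x
        have "\<bar>t * dir a x\<bar> \<le> t * 1" unfolding abs_mult using t dir_bounds[of a x] by (intro mult_mono) auto
        then have "1 + p * (t * dir a x) + Q * (t * dir a x)\<^sup>2 \<le> (1 + t * dir a x) powr p"
          unfolding Q_def using t by (intro powr_taylor_lower p) auto
        then have "\<bar>u x\<bar> powr p * (1 + p * (t * dir a x) + Q * (t * dir a x)\<^sup>2) \<le> \<bar>v x\<bar> powr p"
          unfolding vp by (rule mult_left_mono) simp
        then show "\<bar>u x\<bar> powr p + p * t * (\<bar>u x\<bar> powr p * dir a x) + Q * t\<^sup>2 * (\<bar>u x\<bar> powr p * (dir a x)\<^sup>2) \<le> \<bar>v x\<bar> powr p"
          by (simp add: algebra_simps power_mult_distrib)
      qed
      finally show ?thesis by (simp add: Lp_mass_def)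
    qed
    have Mpos: "D + Q * t\<^sup>2 * E > 0" using D Q E by (simp add: add_pos_nonneg)
    have "D / D powr (2 / p) = rayleigh i j ?S \<alpha> m p u"
    proof -
      have "energy i j r \<alpha> m u g = D"
      proof -
        have "(LINT x|?M. (angular i j x (g x))\<^sup>2) = 0"
          using integral_nonneg_eq_0_iff_AE[OF sqint_square[OF sqint_angular[OF g, of i j]]] L by simp
        then show ?thesis unfolding energy_eq[OF us g] using mass(1) by (simp add: D_def)
      qed
      then show ?thesis unfolding rayleigh_eq[OF us g] by (simp add: D_def)
    qed
    also have "\<dots> \<le> rayleigh a b ?S \<alpha> m p v"
      unfolding R using \<alpha> by (intro ground_level_le_rayleigh ij ab m vH vnz) auto
    also have "\<dots> = (D + t\<^sup>2 * B) / Lp_mass r p v powr (2 / p)"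
      unfolding rayleigh_eq[OF vs vg] en ..
    also have "\<dots> \<le> (D + t\<^sup>2 * B) / (D + Q * t\<^sup>2 * E) powr (2 / p)"
    proof (rule divide_left_mono)
      show "(D + Q * t\<^sup>2 * E) powr (2 / p) \<le> Lp_mass r p v powr (2 / p)"
        using vm Mpos p by (intro powr_mono2) auto
      show "0 \<le> D + t\<^sup>2 * B" unfolding en[symmetric] using \<alpha> m by (intro energy_nonneg) auto
      show "0 < Lp_mass r p v powr (2 / p) * (D + Q * t\<^sup>2 * E) powr (2 / p)"
        using vm Mpos by auto
    qed
    finally show ?thesis by (simp add: Q_def)
  qed
  have "(p - 1) * E \<le> B" by (rule second_variation_limit[OF p D E var])
  also have "B = (LINT x|?M. (norm (k x))\<^sup>2) - \<alpha>\<^sup>2 * (LINT x|?M. (angular a b x (k x))\<^sup>2) + m * (LINT x|?M. (w x)\<^sup>2)"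
    unfolding B_def by (rule energy_eq[OF ws' k])
  also have "(LINT x|?M. (angular a b x (k x))\<^sup>2) = (LINT x|?M. (dir b x * u x)\<^sup>2)"
  proof (rule integral_cong_AE)
    show "(\<lambda>x. (angular a b x (k x))\<^sup>2) \<in> borel_measurable ?M"
      using sqint_square[OF sqint_angular[OF k, of a b]] by auto
    show "(\<lambda>x. (dir b x * u x)\<^sup>2) \<in> borel_measurable ?M" using um dm by simp
    have "AE x in ?M. x \<in> ?S" by (rule AE_I2) simp
    with Lab show "AE x in ?M. (angular a b x (k x))\<^sup>2 = (dir b x * u x)\<^sup>2"
    proof eventually_elim
      case (elim x)
      then have "x \<noteq> 0" using r annulus_pos by blast
      then show ?case
        using elim(1) ab by (simp add: k_def angular_add angular_scaleR angular_grad_dir power_mult_distrib)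
    qed
  qed
  finally show ?thesis by (simp add: E_def k_def w_def)
qed

text \<open>
  Sum the second variation inequality over all pairs \<open>a \<noteq> b\<close>. Each index occurs \<open>N - 1\<close> times in
  both places, and \<open>\<Sum> Y\<^sub>a\<^sup>2 = 1\<close> removes the spherical harmonics.
\<close>

lemma angular_free_ground_state_exponent_bound:
  fixes u :: "real^'n::finite \<Rightarrow> real"
  assumes N: "CARD('n) \<ge> 2" and ij: "i \<noteq> j" and r: "0 < r" "r < 1" and m: "m \<ge> 0" and \<alpha>: "0 < \<alpha>" "\<alpha> \<le> 1" and p: "p > 2"
    and gs: "ground_state i j (annulus r) \<alpha> m p u"
    and g: "has_weak_gradient (annulus r) u g"
    and L: "AE x in lebesgue_on (annulus r). angular i j x (g x) = 0"
  shows "(p - 2) * kappa CARD('n) r m \<le> real CARD('n) - 1 - r\<^sup>2 * \<alpha>\<^sup>2"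
proof -
  let ?S = "annulus r :: (real^'n) set"
  let ?M = "lebesgue_on ?S"
  have o: "open ?S" by (rule annulus_geometry)
  have ws: "weak_solution i j ?S \<alpha> m p u" and nz: "\<not> ae_zero ?S u"
    using gs by (auto simp: ground_state_def)
  have u: "u \<in> H10 ?S" using ws by (simp add: weak_solution_def)
  note us = H1_sqint[OF H10_H1[OF u]]
  note mass = angular_free_solution_mass[OF N r m ws nz g L]
  define n where "n = real CARD('n)"
  have n: "n \<ge> 2" using N by (simp add: n_def)
  have x0: "x \<noteq> 0" if "x \<in> space ?M" for x :: "real^'n" using that r annulus_pos by auto
  define X where "X = (LINT x|?M. (u x / norm x)\<^sup>2)"
  define U where "U = (LINT x|?M. (u x)\<^sup>2)"
  define G where "G = (LINT x|?M. (norm (g x))\<^sup>2)"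
  define D where "D = Lp_mass r p u"
  define V where "V a = (LINT x|?M. (dir a x * u x)\<^sup>2)" for a
  define K where "K a = (LINT x|?M. (norm (dir a x *\<^sub>R g x + u x *\<^sub>R grad (dir a) x))\<^sup>2)" for a
  define E where "E a = (LINT x|?M. \<bar>u x\<bar> powr p * (dir a x)\<^sup>2)" for a
  have db: "\<bar>dir a x\<bar> \<le> 2 / r + 2" for a and x :: "real^'n" using dir_bounds[of a x] r by (simp add: add_increasing)
  have pb: "\<bar>partial_deriv l (dir a) x\<bar> \<le> 2 / r + 2" if "x \<in> ?S" for a x l
    using partial_dir_bound[OF r(1) that, of l a] by simp
  have dm: "dir l \<in> borel_measurable ?M" for l by (rule smooth_measurable[OF o smooth_on_dir[OF r(1), of 0]])
  have um: "u \<in> borel_measurable ?M" by (rule sqint_measurable[OF us])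
  have iV: "integrable ?M (\<lambda>x. (dir a x * u x)\<^sup>2)" for a
    by (rule sqint_square[OF sqint_bounded_mult[OF us dm dir_bounds]])
  have iK: "integrable ?M (\<lambda>x. (norm (dir a x *\<^sub>R g x + u x *\<^sub>R grad (dir a) x))\<^sup>2)" for a
    using has_weak_gradient_mult(2)[OF o us g smooth_on_dir[OF r(1)] db pb, of a]
    by (intro integrable_norm2_components has_weak_gradient_sqint)
  have iE: "integrable ?M (\<lambda>x. \<bar>u x\<bar> powr p * (dir a x)\<^sup>2)" for a
    by (rule integrable_mult_dir_power[OF r(1) mass(3)])
  have iX: "integrable ?M (\<lambda>x. (u x / norm x)\<^sup>2)" by (intro sqint_square sqint_div_norm r us)
  have iG: "integrable ?M (\<lambda>x. (norm (g x))\<^sup>2)" by (intro integrable_norm2_components has_weak_gradient_sqint[OF g])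
  have sV: "(\<Sum>a\<in>UNIV. V a) = U"
  proof -
    have "(\<Sum>a\<in>UNIV. V a) = (LINT x|?M. (\<Sum>a\<in>UNIV. (dir a x * u x)\<^sup>2))"
      unfolding V_def by (rule Bochner_Integration.integral_sum[symmetric]) (rule iV)
    also have "\<dots> = U"
      unfolding U_def by (rule Bochner_Integration.integral_cong)
        (auto simp: power_mult_distrib sum_distrib_right[symmetric] sum_dir_square x0)
    finally show ?thesis .
  qed
  have sE: "(\<Sum>a\<in>UNIV. E a) = D"
  proof -
    have "(\<Sum>a\<in>UNIV. E a) = (LINT x|?M. (\<Sum>a\<in>UNIV. \<bar>u x\<bar> powr p * (dir a x)\<^sup>2))"
      unfolding E_def by (rule Bochner_Integration.integral_sum[symmetric]) (rule iE)
    also have "\<dots> = D"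
      unfolding D_def Lp_mass_def by (rule Bochner_Integration.integral_cong)
        (auto simp: sum_distrib_left[symmetric] sum_dir_square x0)
    finally show ?thesis .
  qed
  have sK: "(\<Sum>a\<in>UNIV. K a) = G + (n - 1) * X"
  proof -
    have "(\<Sum>a\<in>UNIV. K a) = (LINT x|?M. (\<Sum>a\<in>UNIV. (norm (dir a x *\<^sub>R g x + u x *\<^sub>R grad (dir a) x))\<^sup>2))"
      unfolding K_def by (rule Bochner_Integration.integral_sum[symmetric]) (rule iK)
    also have "\<dots> = (LINT x|?M. (norm (g x))\<^sup>2 + (n - 1) * (u x / norm x)\<^sup>2)"
      unfolding n_def by (rule Bochner_Integration.integral_cong[OF refl]) (rule sum_norm_grad_dir_mult[OF x0])
    also have "\<dots> = G + (n - 1) * X" using iG iX by (simp add: G_def X_def)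
    finally show ?thesis .
  qed
  have pair: "(p - 1) * E a \<le> K a - \<alpha>\<^sup>2 * V b + m * V a" if "a \<noteq> b" for a b
    using second_variation[OF N ij r m \<alpha> p gs g L that] by (simp add: E_def K_def V_def)
  have row: "(n - 1) * ((p - 1) * E a) \<le> (n - 1) * (K a + m * V a) - \<alpha>\<^sup>2 * (U - V a)" for a
  proof -
    have "(\<Sum>b\<in>UNIV - {a}. (p - 1) * E a) \<le> (\<Sum>b\<in>UNIV - {a}. (K a + m * V a) - \<alpha>\<^sup>2 * V b)"
    proof (rule sum_mono)
      fix b assume "b \<in> UNIV - {a}"
      then have "a \<noteq> b" by auto
      from pair[OF this] show "(p - 1) * E a \<le> (K a + m * V a) - \<alpha>\<^sup>2 * V b" by simp
    qed
    moreover have "(\<Sum>b\<in>UNIV - {a}. V b) = U - V a" using sV by (simp add: sum_diff1)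
    ultimately show ?thesis by (simp add: sum_subtractf sum_distrib_left[symmetric] n_def)
  qed
  have "(\<Sum>a\<in>UNIV. (n - 1) * ((p - 1) * E a)) \<le> (\<Sum>a\<in>UNIV. (n - 1) * (K a + m * V a) - \<alpha>\<^sup>2 * (U - V a))"
    by (rule sum_mono) (rule row)
  also have "\<dots> = (n - 1) * (G + (n - 1) * X + m * U - \<alpha>\<^sup>2 * U)"
    by (simp add: sum_subtractf sum.distrib sum_distrib_left[symmetric] sV sK n_def[symmetric]) (simp add: algebra_simps)
  also have "(\<Sum>a\<in>UNIV. (n - 1) * ((p - 1) * E a)) = (n - 1) * ((p - 1) * D)"
    by (simp only: sum_distrib_left[symmetric] sE)
  finally have "(p - 1) * D \<le> G + (n - 1) * X + m * U - \<alpha>\<^sup>2 * U"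
    using n by simp
  moreover have D: "G + m * U = D" using mass(1) by (simp add: G_def U_def D_def)
  ultimately have 1: "(p - 2) * D \<le> (n - 1) * X - \<alpha>\<^sup>2 * U" by (simp add: algebra_simps)
  have "(p - 2) * (kappa CARD('n) r m * X) \<le> (p - 2) * D"
    using H10_kappa[OF N r m u g] p D by (intro mult_left_mono) (auto simp: X_def G_def U_def)
  moreover have "\<alpha>\<^sup>2 * (r\<^sup>2 * X) \<le> \<alpha>\<^sup>2 * U"
    unfolding X_def U_def by (rule mult_left_mono[OF inverse_square_weight_le[OF r(1) us]]) simp
  ultimately have "((p - 2) * kappa CARD('n) r m) * X \<le> (n - 1 - r\<^sup>2 * \<alpha>\<^sup>2) * X"
    using 1 by (simp add: algebra_simps)
  then show ?thesis using mass(5) by (simp add: X_def n_def)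
qed

section \<open>Nonradiality of ground states\<close>

theorem theorem5p2:
  fixes i j :: "'n::finite" and m r \<alpha> p :: real and u :: "real^'n \<Rightarrow> real"
  assumes "CARD('n) \<ge> 2" and "i \<noteq> j"
    and "m \<ge> 0"
    and "0 < r" "r < 1"
    and "0 < \<alpha>" "\<alpha> < 1"
    and "2 < p" "ereal p < critical_exponent CARD('n)"
    and "p > (real CARD('n) - 1 - r\<^sup>2 * \<alpha>\<^sup>2) / kappa CARD('n) r m + 2"
    and "ground_state i j (annulus r) \<alpha> m p u"
  shows "plane_nonradial i j (annulus r) u"
proof (rule ccontr)
  assume "\<not> plane_nonradial i j (annulus r) u"
  then have inv: "AE x in lebesgue_on (annulus r). u (plane_rotation i j \<theta> x) = u x" for \<theta>
    by (auto simp: plane_nonradial_def)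
  have ws: "weak_solution i j (annulus r) \<alpha> m p u" and nz: "\<not> ae_zero (annulus r) u"
    using assms(11) by (auto simp: ground_state_def)
  then have u: "u \<in> H1 (annulus r)" by (simp add: weak_solution_def H10_H1)
  define g where "g = weak_grad (annulus r) u"
  have g: "has_weak_gradient (annulus r) u g" unfolding g_def by (rule H1_weak_grad[OF u])
  have L: "AE x in lebesgue_on (annulus r). angular i j x (g x) = 0"
    unfolding angular_def
    by (rule angular_derivative_zero_if_rotation_invariant[OF assms(2) H1_sqint[OF u] g inv])
  have "(p - 2) * kappa CARD('n) r m \<le> real CARD('n) - 1 - r\<^sup>2 * \<alpha>\<^sup>2"
    using assms by (intro angular_free_ground_state_exponent_bound[OF _ _ _ _ _ _ _ _ _ g L]) auto
  moreover have "kappa CARD('n) r m > 0"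
    by (rule angular_free_solution_mass(4)[OF assms(1,4,5,3) ws nz g L])
  ultimately have "p - 2 \<le> (real CARD('n) - 1 - r\<^sup>2 * \<alpha>\<^sup>2) / kappa CARD('n) r m"
    by (simp add: pos_le_divide_eq)
  with assms(10) show False by simp
qed

end
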